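(* Let $\pi$ be a set of primes with complement $\pi'$ in the set of all primes, and let $G$ be a finite $\pi$-separable group. Let $D$ be the $\pi$-decomposable residual of $G$, that is, the smallest normal subgroup of $G$ with $\pi$-decomposable quotient $G/D$, and let $\mathcal{L}$ be the lattice of all $\sigma^\pi$-permutable subgroups of $G$, where $\sigma^\pi=\{\pi,\pi'\}$. Then the lattice $\mathcal{L}$ is distributive if and only if the following conditions hold: (1) (i) every two members $A,B$ of $\mathcal{L}$ are permutable, i.e. $AB=BA$; (ii) the lattice $\mathcal{L}_n(G)$ of all normal subgroups of $G$ is distributive; (iii) $G/D$ is cyclic and $D$ is a meet-distributive element of $\mathcal{L}$. (2) In every factor group $\bar G=G/R$ (with $R$ a normal subgroup of $G$), any two $O^{\pi}(\bar G)$-isomorphic sections $\bar H/\bar K$ and $\bar L/\bar K$, where $\bar K$, $\bar H$ and $\bar L$ are $\sigma^\pi$-permutable $\pi$-subgroups of $\bar G$, coincide (i.e. $\bar H=\bar L$). (3) In every factor group $\bar G=G/R$ (with $R$ a normal subgroup of $G$), any two $O^{\pi'}(\bar G)$-isomorphic sections $\bar H/\bar K$ and $\bar L/\bar K$, where $\bar K$, $\bar H$ and $\bar L$ are $\sigma^\pi$-permutable $\pi'$-subgroups of $\bar G$, coincide (i.e. $\bar H=\bar L$).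
   Context: All groups are finite. A group $G$ is $\pi$-decomposable if $G=O_\pi(G)\times O_{\pi'}(G)$. A subgroup $A$ of a $\pi$-separable group $G$ is $\sigma^\pi$-permutable in $G$ if $A$ permutes (i.e. $AH=HA$) with all Hall $\pi$-subgroups $H$ and with all Hall $\pi'$-subgroups $H$ of $G$. The set of all $\sigma^\pi$-permutable subgroups of $G$, ordered by inclusion, is a lattice (join $\langle A,B\rangle$, meet $A\cap B$). An element $a$ of a lattice $\mathcal{L}$ is meet-distributive if $a\wedge(b\vee c)=(a\wedge b)\vee(a\wedge c)$ for all $b,c\in\mathcal{L}$. For a set of primes $\tau$ (here $\tau=\pi$ or $\tau=\pi'$), $O^{\tau}(G)$ is the smallest normal subgroup $N$ of $G$ such that $G/N$ is a $\tau$-group. It is known that $O^\tau(G)$ normalizes every $\sigma^\pi$-permutable $\tau$-subgroup of $G$. A section $H/K$ of such subgroups $K,H$ means $K\trianglelefteq H$, and $O^\tau(G)$ is a group of operators for $H/K$ via $(hK)^a=h^aK$ for $hK\in H/K$, $a\in O^\tau(G)$. Two such sections are $O^\tau(G)$-isomorphic if there is a group isomorphism between them commuting with the action of $O^\tau(G)$. *)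

theory Defs
  imports
    "HOL-Algebra.Elementary_Groups"
    "HOL-Algebra.Lattice"
    "HOL-Computational_Algebra.Primes"
begin

definition compl_primes :: "nat set \<Rightarrow> nat set" where
  "compl_primes \<pi> = {p. Factorial_Ring.prime p} - \<pi>"

(* Used for finite groups only: order G = 0 for infinite G. *)
definition pi_group :: "nat set \<Rightarrow> ('a, 'b) monoid_scheme \<Rightarrow> bool" where
  "pi_group \<pi> G \<longleftrightarrow> group G \<and> prime_factors (order G) \<subseteq> \<pi>"

definition pi_subgroup :: "nat set \<Rightarrow> ('a, 'b) monoid_scheme \<Rightarrow> 'a set \<Rightarrow> bool" where
  "pi_subgroup \<pi> G H \<longleftrightarrow> subgroup H G \<and> pi_group \<pi> (G\<lparr>carrier := H\<rparr>)"

definition hall_subgroup :: "nat set \<Rightarrow> ('a, 'b) monoid_scheme \<Rightarrow> 'a set \<Rightarrow> bool" where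
  "hall_subgroup \<pi> G H \<longleftrightarrow>
     pi_subgroup \<pi> G H \<and> prime_factors (card (rcosets\<^bsub>G\<^esub> H)) \<subseteq> compl_primes \<pi>"

definition pi_separable :: "nat set \<Rightarrow> ('a, 'b) monoid_scheme \<Rightarrow> bool" where
  "pi_separable \<pi> G \<longleftrightarrow>
     (\<exists>(N :: nat \<Rightarrow> 'a set) k.
        N 0 = {\<one>\<^bsub>G\<^esub>} \<and> N k = carrier G \<and> (\<forall>i\<le>k. N i \<lhd> G) \<and>
        (\<forall>i<k. N i \<subseteq> N (Suc i) \<and>
           (pi_group \<pi> (G\<lparr>carrier := N (Suc i)\<rparr> Mod N i) \<or>
            pi_group (compl_primes \<pi>) (G\<lparr>carrier := N (Suc i)\<rparr> Mod N i))))"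

(* O_pi(G): the largest normal pi-subgroup. GREATEST and LEAST on sets refer to inclusion. *)
definition pi_core :: "nat set \<Rightarrow> ('a, 'b) monoid_scheme \<Rightarrow> 'a set" where
  "pi_core \<pi> G = (GREATEST N. N \<lhd> G \<and> pi_subgroup \<pi> G N)"

(* O^tau(G) *)
definition pi_residual :: "nat set \<Rightarrow> ('a, 'b) monoid_scheme \<Rightarrow> 'a set" where
  "pi_residual \<tau> G = (LEAST N. N \<lhd> G \<and> pi_group \<tau> (G Mod N))"

(* The product is an internal one: multiplication in G is an isomorphism from the external
   direct product of the two cores onto G. *)
definition pi_decomposable :: "nat set \<Rightarrow> ('a, 'b) monoid_scheme \<Rightarrow> bool" where
  "pi_decomposable \<pi> G \<longleftrightarrow>
     (\<lambda>(x, y). x \<otimes>\<^bsub>G\<^esub> y) \<in>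
       iso (G\<lparr>carrier := pi_core \<pi> G\<rparr> \<times>\<times> G\<lparr>carrier := pi_core (compl_primes \<pi>) G\<rparr>) G"

definition pi_decomposable_residual :: "nat set \<Rightarrow> ('a, 'b) monoid_scheme \<Rightarrow> 'a set" where
  "pi_decomposable_residual \<pi> G = (LEAST N. N \<lhd> G \<and> pi_decomposable \<pi> (G Mod N))"

definition permutable :: "('a, 'b) monoid_scheme \<Rightarrow> 'a set \<Rightarrow> 'a set \<Rightarrow> bool" where
  "permutable G A B \<longleftrightarrow> A <#>\<^bsub>G\<^esub> B = B <#>\<^bsub>G\<^esub> A"

definition sigma_permutable :: "nat set \<Rightarrow> ('a, 'b) monoid_scheme \<Rightarrow> 'a set \<Rightarrow> bool" where
  "sigma_permutable \<pi> G A \<longleftrightarrow>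
     subgroup A G \<and>
     (\<forall>H. hall_subgroup \<pi> G H \<or> hall_subgroup (compl_primes \<pi>) G H \<longrightarrow> permutable G A H)"

(* Join and meet are the library's supremum and infimum in the inclusion order; for finite
   pi-separable G they are generate G (A \<union> B) and A \<inter> B. *)
definition sigma_permutable_lattice ::
    "nat set \<Rightarrow> ('a, 'b) monoid_scheme \<Rightarrow> 'a set gorder" where
  "sigma_permutable_lattice \<pi> G =
     \<lparr>carrier = {A. sigma_permutable \<pi> G A}, eq = (=), le = (\<subseteq>)\<rparr>"

definition normal_subgroup_lattice :: "('a, 'b) monoid_scheme \<Rightarrow> 'a set gorder" where
  "normal_subgroup_lattice G = \<lparr>carrier = {N. N \<lhd> G}, eq = (=), le = (\<subseteq>)\<rparr>"

definition meet_distributive :: "('a, 'b) gorder_scheme \<Rightarrow> 'a \<Rightarrow> bool" where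
  "meet_distributive L a \<longleftrightarrow>
     a \<in> carrier L \<and>
     (\<forall>b\<in>carrier L. \<forall>c\<in>carrier L.
        a \<sqinter>\<^bsub>L\<^esub> (b \<squnion>\<^bsub>L\<^esub> c) = (a \<sqinter>\<^bsub>L\<^esub> b) \<squnion>\<^bsub>L\<^esub> (a \<sqinter>\<^bsub>L\<^esub> c))"

locale distributive_lattice = lattice L for L (structure) +
  assumes meet_join_distrib:
    "\<lbrakk>x \<in> carrier L; y \<in> carrier L; z \<in> carrier L\<rbrakk>
      \<Longrightarrow> x \<sqinter> (y \<squnion> z) = (x \<sqinter> y) \<squnion> (x \<sqinter> z)"

(* H/K and L/K are Op-isomorphic, where a in Op acts by (hK)^a = (a^-1 h a)K.
   The cosets hK = Kh are written as right cosets, as in the library's quotient groups. *)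
definition operator_isomorphic ::
    "('a, 'b) monoid_scheme \<Rightarrow> 'a set \<Rightarrow> 'a set \<Rightarrow> 'a set \<Rightarrow> 'a set \<Rightarrow> bool" where
  "operator_isomorphic G Op K H L \<longleftrightarrow>
     (\<exists>\<phi> \<in> iso (G\<lparr>carrier := H\<rparr> Mod K) (G\<lparr>carrier := L\<rparr> Mod K).
        \<forall>a\<in>Op. \<forall>h\<in>H. \<forall>l\<in>L.
          \<phi> (K #>\<^bsub>G\<^esub> h) = K #>\<^bsub>G\<^esub> l \<longrightarrow>
          \<phi> (K #>\<^bsub>G\<^esub> (inv\<^bsub>G\<^esub> a \<otimes>\<^bsub>G\<^esub> h \<otimes>\<^bsub>G\<^esub> a)) = K #>\<^bsub>G\<^esub> (inv\<^bsub>G\<^esub> a \<otimes>\<^bsub>G\<^esub> l \<otimes>\<^bsub>G\<^esub> a))"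

(* Intended for tau = pi and for tau = compl_primes pi. *)
definition isomorphic_sections_coincide ::
    "nat set \<Rightarrow> nat set \<Rightarrow> ('a, 'b) monoid_scheme \<Rightarrow> bool" where
  "isomorphic_sections_coincide \<pi> \<tau> G \<longleftrightarrow>
     (\<forall>K H L.
        (\<forall>X\<in>{K, H, L}. sigma_permutable \<pi> G X \<and> pi_subgroup \<tau> G X) \<and>
        K \<lhd> G\<lparr>carrier := H\<rparr> \<and> K \<lhd> G\<lparr>carrier := L\<rparr> \<and>
        operator_isomorphic G (pi_residual \<tau> G) K H L
        \<longrightarrow> H = L)"

end

theory Submission
  imports
    Defs
    "HOL-Algebra.Sylow"
    "HOL-Algebra.Multiplicative_Group"
    "HOL-Algebra.Weak_Morphisms"
begin

text \<open>A \<open>\<sigma>\<^sup>\<pi>\<close>-permutable subgroup A is the product of the subgroups generated by its intersections with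
  the Hall \<open>\<pi>\<close>-subgroups and with the Hall \<open>\<pi>'\<close>-subgroups. Comparing orders shows that the first factor
  is normalized by \<open>O\<^sup>\<pi>(G)\<close>, the second one by \<open>O\<^bsup>\<pi>'\<^esup>(G)\<close>, and that \<open>(A \<inter> B) H = A H \<inter> B H\<close> for every
  Hall subgroup H. In particular \<open>D = O\<^sup>\<pi>(G) \<inter> O\<^bsup>\<pi>'\<^esup>(G)\<close> normalizes A.

  If the lattice is distributive, an element lying in as few maximal subgroups over D as possible lies in
  none of them, so G/D is cyclic; then A and B permute because \<open>\<langle>A, B\<rangle> \<inter> D = (A \<inter> D) (B \<inter> D)\<close>. An operator
  isomorphism between two different sections would, after passing to a minimal subgroup that it moves, have
  a graph that is a third complement of the same subgroup, contradicting distributivity.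

  Conversely, the conditions on D and G/D reduce distributivity to members below D. These are normal in D,
  so a failure produces a diamond with abelian factor group. Modulo the core of its bottom, the \<open>\<pi>\<close>-parts of
  its three atoms are \<open>\<pi>\<close>-groups, two of which are operator isomorphic through the third; likewise
  for \<open>\<pi>'\<close>.\<close>

section \<open>The Schur--Zassenhaus theorem\<close>

text \<open>From \<pi>-separability the proof extracts one fact, the existence of Hall \<pi>- and
  \<pi>'-subgroups in every subgroup, by Schur-Zassenhaus along the normal series. This fact passes
  to factor groups and is symmetric in \<pi> and \<pi>', so half of every argument comes by duality.
  The intersection of A with a Hall subgroup depends on that subgroup, so \<open>hall_part\<close>
  collects all of them. The result is invariant under the opposite residual, but in general it is no
  \<pi>-group. This is the obstacle in the converse, because conditions (2) and (3) speak of
  \<pi>-groups. For an abelian factor X/I, the \<pi>-part of X meets every Hall \<pi>'-subgroup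
  inside I. What these intersections generate is normalized by \<open>P\<close> and lies in the
  \<pi>'-part of I, which \<open>Q\<close> normalizes; as G = \<open>Q\<close> \<open>P\<close>, all
  its conjugates stay in I. So it vanishes modulo the core of I, and this is where the factor groups
  in (2) and (3) enter.\<close>

lemma card_eq_fibers:
  assumes "finite A" "\<And>y. y \<in> f ` A \<Longrightarrow> card {x \<in> A. f x = y} = n"
  shows "card A = n * card (f ` A)"
proof -
  have "card A = (\<Sum>y\<in>f ` A. card {x \<in> A. f x = y})"
    using assms(1) by (subst card_UN_disjoint[symmetric]) (auto intro: arg_cong[where f = card])
  then show ?thesis using assms(2) by simp
qed

context group
begin

lemma inv_mult_cancel: "x \<in> carrier G \<Longrightarrow> z \<in> carrier G \<Longrightarrow> inv x \<otimes> (x \<otimes> z) = z"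
  by (simp add: m_assoc[symmetric])

lemma mult_inv_cancel: "x \<in> carrier G \<Longrightarrow> z \<in> carrier G \<Longrightarrow> x \<otimes> (inv x \<otimes> z) = z"
  by (simp add: m_assoc[symmetric])

lemmas word_simps = m_assoc inv_mult_group inv_mult_cancel mult_inv_cancel

lemma rcos_eq_iff:
  assumes "subgroup A G" "x \<in> carrier G" "y \<in> carrier G"
  shows "A #> x = A #> y \<longleftrightarrow> x \<otimes> inv y \<in> A"
  using assms by (metis is_group rcos_self repr_independence subgroup.rcos_module)

lemma card_set_mult:
  assumes A: "subgroup A G" and B: "subgroup B G" and fin: "finite (carrier G)"
  shows "card (A <#> B) * card (A \<inter> B) = card A * card B"
proof -
  interpret A: subgroup A G by fact
  interpret B: subgroup B G by fact
  have finA: "finite A" and finB: "finite B"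
    using fin A.subset B.subset finite_subset by blast+
  let ?f = "\<lambda>(a, b). a \<otimes> b"
  have img: "?f ` (A \<times> B) = A <#> B" by (auto simp: set_mult_def)
  have "card (A \<times> B) = card (A \<inter> B) * card (?f ` (A \<times> B))"
  proof (rule card_eq_fibers)
    show "finite (A \<times> B)" using finA finB by simp
    fix y assume "y \<in> ?f ` (A \<times> B)"
    then obtain a b where ab: "a \<in> A" "b \<in> B" "y = a \<otimes> b" by auto
    \<comment> \<open>All factorizations of a b arise from this one by shifting an element c of A
      \<inter> B across; the count is valid also when AB is a mere set.\<close>
    have "bij_betw (\<lambda>c. (a \<otimes> c, inv c \<otimes> b)) (A \<inter> B) {x \<in> A \<times> B. ?f x = y}"
    proof (rule bij_betw_byWitness[where f' = "\<lambda>(x, z). inv a \<otimes> x"])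
      show "\<forall>c\<in>A \<inter> B. (\<lambda>(x, z). inv a \<otimes> x) (a \<otimes> c, inv c \<otimes> b) = c"
        using ab by (auto simp: word_simps)
      show "\<forall>x'\<in>{x \<in> A \<times> B. ?f x = y}. (\<lambda>c. (a \<otimes> c, inv c \<otimes> b)) ((\<lambda>(x, z). inv a \<otimes> x) x') = x'"
      proof
        fix x' assume "x' \<in> {x \<in> A \<times> B. ?f x = y}"
        then obtain x z where xz: "x' = (x, z)" "x \<in> A" "z \<in> B" "x \<otimes> z = a \<otimes> b" using ab by auto
        then have "inv x \<otimes> (a \<otimes> b) = z" by (metis A.mem_carrier B.mem_carrier inv_mult_cancel)
        then show "(\<lambda>c. (a \<otimes> c, inv c \<otimes> b)) ((\<lambda>(x, z). inv a \<otimes> x) x') = x'"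
          using ab(1,2) xz(1-3) by (simp add: word_simps)
      qed
      show "(\<lambda>c. (a \<otimes> c, inv c \<otimes> b)) ` (A \<inter> B) \<subseteq> {x \<in> A \<times> B. ?f x = y}"
        using ab by (auto simp: word_simps)
      show "(\<lambda>(x, z). inv a \<otimes> x) ` {x \<in> A \<times> B. ?f x = y} \<subseteq> A \<inter> B"
      proof
        fix w assume "w \<in> (\<lambda>(x, z). inv a \<otimes> x) ` {x \<in> A \<times> B. ?f x = y}"
        then obtain x z where h: "x \<in> A" "z \<in> B" "x \<otimes> z = y" and w: "w = inv a \<otimes> x" by auto
        have "x = a \<otimes> b \<otimes> inv z" using h ab by (metis A.mem_carrier B.mem_carrier inv_solve_right m_closed)
        then have "inv a \<otimes> x = b \<otimes> inv z" using h(2) ab by (simp add: word_simps)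
        then have "inv a \<otimes> x \<in> B" using h ab by simp
        then show "w \<in> A \<inter> B" using h ab w by simp
      qed
    qed
    then show "card {x \<in> A \<times> B. ?f x = y} = card (A \<inter> B)" by (simp add: bij_betw_same_card)
  qed
  then show ?thesis unfolding img by (simp add: card_cartesian_product mult.commute)
qed

end

text \<open>The cocycle of a transversal of an abelian normal subgroup becomes trivial after averaging
  it over the quotient, whose order is invertible modulo the order of the subgroup.\<close>

lemma (in group) abelian_normal_hall_splits:
  assumes A: "A \<lhd> G" and fin: "finite (carrier G)"
    and comm: "\<And>x y. x \<in> A \<Longrightarrow> y \<in> A \<Longrightarrow> x \<otimes> y = y \<otimes> x"
    and cop: "coprime (card A) (card (rcosets A))"
  shows "\<exists>C. subgroup C G \<and> card C * card A = order G"
proof -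
  interpret A: normal A G by fact
  interpret AG: comm_group "G\<lparr>carrier := A\<rparr>"
    using A.subgroup_axioms comm by (intro group.group_comm_groupI subgroup.subgroup_is_group) auto
  note [simp] = A.mem_carrier
  have finA: "finite A" using fin A.subset finite_subset by blast
  \<comment> \<open>The choice is made from the coset, not from g, so \<open>t\<close> is constant
    on cosets and its image \<open>T\<close> is a transversal.\<close>
  define t where "t g = (SOME x. x \<in> A #> g)" for g
  have t: "t g \<in> A #> g" if "g \<in> carrier G" for g
    unfolding t_def using rcos_self[OF that A.subgroup_axioms] by (rule someI)
  have t_carr [simp]: "t g \<in> carrier G" if "g \<in> carrier G" for g
    using t[OF that] that r_coset_subset_G[OF A.subset] by blast
  have t_eq: "t g = t h" if "A #> g = A #> h" for g h unfolding t_def using that by simp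
  have tcos: "A #> t g = A #> g" if "g \<in> carrier G" for g
    using repr_independence[OF t[OF that] that A.subgroup_axioms] by simp
  have t_eq_iff: "t g = t h \<longleftrightarrow> A #> g = A #> h" if "g \<in> carrier G" "h \<in> carrier G" for g h
    using t_eq[of g h] tcos[OF that(1)] tcos[OF that(2)] by metis
  have cos_mult: "A #> (x \<otimes> y) = A #> (x' \<otimes> y')"
    if "A #> x = A #> x'" "A #> y = A #> y'" "x \<in> carrier G" "y \<in> carrier G" "x' \<in> carrier G" "y' \<in> carrier G"
    for x y x' y'
    using A.rcos_sum[OF that(3,4)] A.rcos_sum[OF that(5,6)] that(1,2) by simp
  define T where "T = t ` carrier G"
  have finT: "finite T" and T_carr: "T \<subseteq> carrier G" using fin by (auto simp: T_def)
  have "card T = card (rcosets A)"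
  proof -
    have "bij_betw (\<lambda>x. A #> x) T (rcosets A)"
    proof (rule bij_betwI')
      fix x y assume "x \<in> T" "y \<in> T"
      then obtain g h where "x = t g" "y = t h" "g \<in> carrier G" "h \<in> carrier G" by (auto simp: T_def)
      then show "(A #> x = A #> y) = (x = y)" using tcos t_eq_iff by simp
    next
      fix x assume "x \<in> T"
      then show "A #> x \<in> rcosets A" using T_carr by (auto simp: RCOSETS_def)
    next
      fix y assume "y \<in> rcosets A"
      then obtain x where "x \<in> carrier G" "y = A #> x" by (auto simp: RCOSETS_def)
      then show "\<exists>x\<in>T. y = A #> x" using tcos by (auto simp: T_def)
    qed
    then show ?thesis by (rule bij_betw_same_card)
  qed
  \<comment> \<open>The factor set of the transversal: it measures inside A how far \<open>t\<close>
    is from a homomorphism, and it depends only on the two cosets.\<close>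
  define f where "f g h = t g \<otimes> t h \<otimes> inv (t (g \<otimes> h))" for g h
  have mem_iff: "x \<otimes> inv y \<in> A" if "A #> x = A #> y" "x \<in> carrier G" "y \<in> carrier G" for x y
    using that rcos_eq_iff[OF A.subgroup_axioms] by blast
  have fA: "f g h \<in> A" if "g \<in> carrier G" "h \<in> carrier G" for g h
    unfolding f_def by (rule mem_iff) (use that tcos cos_mult[of "t g" g "t h" h] in auto)
  have tt: "t g \<otimes> t h = f g h \<otimes> t (g \<otimes> h)" if "g \<in> carrier G" "h \<in> carrier G" for g h
    unfolding f_def using that by (simp add: m_assoc)
  have f_cong: "f g h = f g' h'" if "A #> g = A #> g'" "A #> h = A #> h'"
      "g \<in> carrier G" "h \<in> carrier G" "g' \<in> carrier G" "h' \<in> carrier G" for g h g' h'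
    unfolding f_def using t_eq[OF that(1)] t_eq[OF that(2)] t_eq[OF cos_mult[OF that]] by simp
  define cj where "cj g a = t g \<otimes> a \<otimes> inv (t g)" for g a
  have cjA: "cj g a \<in> A" if "g \<in> carrier G" "a \<in> A" for g a
    unfolding cj_def using A.inv_op_closed2 that t_carr by blast
  have cocycle: "f x y \<otimes> f (x \<otimes> y) z = cj x (f y z) \<otimes> f x (y \<otimes> z)"
    if [simp]: "x \<in> carrier G" "y \<in> carrier G" "z \<in> carrier G" for x y z
  proof -
    have "f x y \<otimes> f (x \<otimes> y) z \<otimes> t (x \<otimes> y \<otimes> z) = t x \<otimes> t y \<otimes> t z"
    proof -
      have "f x y \<otimes> f (x \<otimes> y) z \<otimes> t (x \<otimes> y \<otimes> z) = f x y \<otimes> (t (x \<otimes> y) \<otimes> t z)"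
        using fA tt[of "x \<otimes> y" z] by (simp add: m_assoc)
      also have "\<dots> = f x y \<otimes> t (x \<otimes> y) \<otimes> t z" using fA by (simp add: m_assoc)
      finally show ?thesis using tt[of x y] by simp
    qed
    moreover have "cj x (f y z) \<otimes> f x (y \<otimes> z) \<otimes> t (x \<otimes> y \<otimes> z) = t x \<otimes> t y \<otimes> t z"
    proof -
      have "cj x (f y z) \<otimes> f x (y \<otimes> z) \<otimes> t (x \<otimes> y \<otimes> z) = cj x (f y z) \<otimes> (t x \<otimes> t (y \<otimes> z))"
        using fA cjA tt[of x "y \<otimes> z"] by (simp add: m_assoc)
      also have "\<dots> = t x \<otimes> (f y z \<otimes> t (y \<otimes> z))"
        using fA by (simp add: cj_def word_simps)
      finally show ?thesis using tt[of y z] by (simp add: m_assoc)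
    qed
    ultimately have "f x y \<otimes> f (x \<otimes> y) z \<otimes> t (x \<otimes> y \<otimes> z)
        = cj x (f y z) \<otimes> f x (y \<otimes> z) \<otimes> t (x \<otimes> y \<otimes> z)" by simp
    then show ?thesis using fA cjA by (subst (asm) right_cancel) simp_all
  qed
  \<comment> \<open>Multiplying the cocycle identity over all z in \<open>T\<close> turns
    \<open>f x y\<close> into its power with exponent |G : A| and every other factor into a value of
    this product; the outcome is \<open>key\<close>.\<close>
  define c where "c g = finprod (G\<lparr>carrier := A\<rparr>) (f g) T" for g
  have cA: "c g \<in> A" if "g \<in> carrier G" for g
    using AG.finprod_closed[of "f g" T] fA T_carr that unfolding c_def by (auto simp: Pi_def)
  let ?m = "card T"
  have cj_hom: "cj g \<in> hom (G\<lparr>carrier := A\<rparr>) (G\<lparr>carrier := A\<rparr>)" if [simp]: "g \<in> carrier G" for g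
  proof (rule homI)
    fix a b assume "a \<in> carrier (G\<lparr>carrier := A\<rparr>)" "b \<in> carrier (G\<lparr>carrier := A\<rparr>)"
    then show "cj g (a \<otimes>\<^bsub>G\<lparr>carrier := A\<rparr>\<^esub> b) = cj g a \<otimes>\<^bsub>G\<lparr>carrier := A\<rparr>\<^esub> cj g b"
      by (simp add: cj_def word_simps)
  qed (use cjA in auto)
  have reindex: "finprod (G\<lparr>carrier := A\<rparr>) (\<lambda>z. f g (h \<otimes> z)) T = c g"
    if [simp]: "g \<in> carrier G" "h \<in> carrier G" for g h
  proof -
    \<comment> \<open>Left translation by h permutes the cosets of A, hence induces a permutation of
      \<open>T\<close>, and \<open>f\<close> does not see the change of representatives.\<close>
    define \<sigma> where "\<sigma> z = t (h \<otimes> z)" for z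
    have inj: "inj_on \<sigma> T"
    proof (rule inj_onI)
      fix y z assume yz: "y \<in> T" "z \<in> T" "\<sigma> y = \<sigma> z"
      then have [simp]: "y \<in> carrier G" "z \<in> carrier G" using T_carr by auto
      have "A #> (h \<otimes> y) = A #> (h \<otimes> z)" using yz t_eq_iff by (simp add: \<sigma>_def)
      then have "A #> (inv h \<otimes> (h \<otimes> y)) = A #> (inv h \<otimes> (h \<otimes> z))" by - (rule cos_mult, auto)
      then have "A #> y = A #> z" by (simp add: word_simps)
      then have "t y = t z" by (rule t_eq)
      moreover have "t w = w" if "w \<in> T" for w
        using that t_eq[OF tcos] by (auto simp: T_def)
      ultimately show "y = z" using yz by simp
    qed
    moreover have "\<sigma> ` T \<subseteq> T" using T_carr by (auto simp: \<sigma>_def T_def)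
    ultimately have img: "\<sigma> ` T = T" using finT by (simp add: endo_inj_surj)
    have "c g = finprod (G\<lparr>carrier := A\<rparr>) (f g) (\<sigma> ` T)" by (simp add: img c_def)
    also have "\<dots> = finprod (G\<lparr>carrier := A\<rparr>) (\<lambda>z. f g (\<sigma> z)) T"
      using inj fA T_carr img by (intro AG.finprod_reindex) auto
    also have "\<dots> = finprod (G\<lparr>carrier := A\<rparr>) (\<lambda>z. f g (h \<otimes> z)) T"
    proof (rule AG.finprod_cong')
      fix z assume "z \<in> T"
      then have "z \<in> carrier G" using T_carr by auto
      then show "f g (\<sigma> z) = f g (h \<otimes> z)" unfolding \<sigma>_def using tcos by (intro f_cong) auto
    qed (use fA T_carr in auto)
    finally show ?thesis by simp
  qed
  have key: "f x y [^] ?m \<otimes> c (x \<otimes> y) = cj x (c y) \<otimes> c x"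
    if [simp]: "x \<in> carrier G" "y \<in> carrier G" for x y
  proof -
    let ?F = "finprod (G\<lparr>carrier := A\<rparr>)"
    have fT: "(\<lambda>z. f x y) \<in> T \<rightarrow> A" "f (x \<otimes> y) \<in> T \<rightarrow> A"
        "(\<lambda>z. cj x (f y z)) \<in> T \<rightarrow> A" "(\<lambda>z. f x (y \<otimes> z)) \<in> T \<rightarrow> A"
      using fA cjA T_carr by auto
    have "f x y [^] ?m \<otimes> c (x \<otimes> y) = ?F (\<lambda>z. f x y) T \<otimes> c (x \<otimes> y)"
      using AG.finprod_const[of "f x y" T] fA by (simp add: nat_pow_consistent[symmetric])
    also have "\<dots> = ?F (\<lambda>z. f x y \<otimes> f (x \<otimes> y) z) T"
      unfolding c_def using AG.finprod_multf[of "\<lambda>z. f x y" T "f (x \<otimes> y)"] fT by simp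
    also have "\<dots> = ?F (\<lambda>z. cj x (f y z) \<otimes> f x (y \<otimes> z)) T"
      by (rule AG.finprod_cong') (use cocycle fA cjA T_carr in auto)
    also have "\<dots> = ?F (\<lambda>z. cj x (f y z)) T \<otimes> ?F (\<lambda>z. f x (y \<otimes> z)) T"
      using AG.finprod_multf[of "\<lambda>z. cj x (f y z)" T "\<lambda>z. f x (y \<otimes> z)"] fT by simp
    also have "?F (\<lambda>z. cj x (f y z)) T = cj x (c y)"
    proof -
      interpret cjh: group_hom "G\<lparr>carrier := A\<rparr>" "G\<lparr>carrier := A\<rparr>" "cj x"
        using cj_hom by (simp add: AG.group_axioms group_hom_axioms_def group_hom_def)
      have "?F (\<lambda>z. cj x (f y z)) T' = cj x (?F (f y) T')" if "finite T'" "T' \<subseteq> T" for T'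
        using that
      proof (induction T' rule: finite_induct)
        case empty then show ?case using cjh.hom_one by simp
      next
        case (insert z F)
        then have "z \<in> carrier G" "F \<subseteq> carrier G" using T_carr by auto
        then have "f y \<in> F \<rightarrow> A" "f y z \<in> A" "(\<lambda>z. cj x (f y z)) \<in> F \<rightarrow> A" using fA cjA by auto
        then show ?case using insert cjh.hom_mult AG.finprod_closed[of "f y" F] cjA by (simp add: Pi_def)
      qed
      then show ?thesis unfolding c_def using finT by simp
    qed
    also note reindex[OF that]
    finally show ?thesis .
  qed
  \<comment> \<open>\<open>k\<close> inverts |G : A| modulo |A|. Here coprimality enters: raising to
    the power \<open>k\<close> undoes the exponent in \<open>key\<close>.\<close>
  obtain k where k: "\<And>a. a \<in> A \<Longrightarrow> (a [^] ?m) [^] (k::nat) = a"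
  proof -
    have "?m \<noteq> 0" using finT T_def by auto
    then obtain x y where xy: "?m * x = card A * y + 1"
      using bezout_nat[of ?m "card A"] cop \<open>card T = _\<close> by (metis coprime_commute coprime_imp_gcd_eq_1)
    have "a [^] (?m * x) = a" if "a \<in> A" for a
    proof -
      have "a [^] card A = \<one>"
        using AG.pow_order_eq_1[of a] that by (simp add: order_def nat_pow_consistent[symmetric])
      then show ?thesis using that nat_pow_mult[of a "card A * y" 1] nat_pow_pow[of a "card A" y]
        unfolding xy by simp
    qed
    then show ?thesis using that[of x] nat_pow_pow by simp
  qed
  have pow_mult: "(a \<otimes> b) [^] (n::nat) = a [^] n \<otimes> b [^] n" if "a \<in> A" "b \<in> A" for a b n
    using that comm[OF that] pow_mult_distrib[of a b n] by simp
  have powA: "a [^] (n::nat) \<in> A" if "a \<in> A" for a n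
    using that by (induction n) auto
  \<comment> \<open>The cochain whose coboundary is the inverse of \<open>f\<close>. Multiplying
    \<open>t\<close> by it makes the factor set trivial, so \<open>s\<close> below is an
    endomorphism.\<close>
  define e where "e g = inv (c g [^] k)" for g
  have eA: "e g \<in> A" if "g \<in> carrier G" for g unfolding e_def using cA powA that by auto
  have ekey: "e x \<otimes> cj x (e y) \<otimes> f x y = e (x \<otimes> y)" if [simp]: "x \<in> carrier G" "y \<in> carrier G" for x y
  proof -
    have "f x y \<otimes> c (x \<otimes> y) [^] k = (f x y [^] ?m \<otimes> c (x \<otimes> y)) [^] k"
      using k fA cA powA pow_mult by simp
    also have "\<dots> = cj x (c y) [^] k \<otimes> c x [^] k"
      using key cA cjA pow_mult by simp
    also have "cj x (c y) [^] k = cj x (c y [^] k)"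
    proof -
      interpret cjh: group_hom "G\<lparr>carrier := A\<rparr>" "G\<lparr>carrier := A\<rparr>" "cj x"
        using cj_hom by (simp add: AG.group_axioms group_hom_axioms_def group_hom_def)
      show ?thesis using cjh.hom_nat_pow[of "c y" k] cA by (simp add: nat_pow_consistent[symmetric])
    qed
    finally have eq: "f x y \<otimes> c (x \<otimes> y) [^] k = cj x (c y [^] k) \<otimes> c x [^] k" .
    have ce: "cj x (e y) = inv (cj x (c y [^] k))"
      unfolding e_def cj_def using cA powA by (simp add: word_simps)
    let ?a = "cj x (c y [^] k)" and ?b = "c x [^] k" and ?d = "c (x \<otimes> y) [^] k"
    have mem: "?a \<in> A" "?b \<in> A" "?d \<in> A" "f x y \<in> A" using cA powA cjA fA by auto
    have "e x \<otimes> cj x (e y) \<otimes> f x y = inv (?a \<otimes> ?b) \<otimes> f x y"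
      unfolding ce using mem by (simp add: e_def inv_mult_group)
    also have "\<dots> = inv (f x y \<otimes> ?d) \<otimes> f x y" by (simp add: eq)
    also have "\<dots> = inv ?d"
      using mem by (simp add: word_simps)
    finally show ?thesis by (simp add: e_def)
  qed
  define s where "s g = e g \<otimes> t g" for g
  have s_hom: "s (x \<otimes> y) = s x \<otimes> s y" if [simp]: "x \<in> carrier G" "y \<in> carrier G" for x y
  proof -
    have [simp]: "e x \<in> carrier G" "e y \<in> carrier G" "f x y \<in> carrier G" "cj x (e y) \<in> carrier G"
      using eA fA cjA A.mem_carrier by auto
    have "s x \<otimes> s y = e x \<otimes> (cj x (e y) \<otimes> (t x \<otimes> t y))"
      unfolding s_def cj_def by (simp add: word_simps)
    also have "\<dots> = e x \<otimes> cj x (e y) \<otimes> f x y \<otimes> t (x \<otimes> y)"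
      unfolding tt[OF that] by (simp add: m_assoc)
    finally show ?thesis by (simp add: ekey s_def)
  qed
  have s_cos: "A #> s g = A #> g" if "g \<in> carrier G" for g
    using that eA[OF that] tcos A.rcos_const[OF is_group] coset_mult_assoc[OF A.subset, of "e g" "t g"]
    unfolding s_def by simp
  have s_carr: "s g \<in> carrier G" if "g \<in> carrier G" for g using that eA by (simp add: s_def)
  interpret s: group_hom G G s
    using s_hom s_carr by unfold_locales (auto simp: hom_def)
  \<comment> \<open>\<open>c\<close> and \<open>t\<close> take the same value on A as at the
    identity. Since \<open>s g\<close> stays in the coset of g, an element of the image that lies in
    A comes from A, hence is trivial.\<close>
  have ker: "s g = \<one>" if "g \<in> A" for g
  proof -
    have [simp]: "g \<in> carrier G" using that by simp
    have cos: "A #> g = A #> \<one>" using that A.rcos_const[OF is_group] by (simp add: A.subset)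
    have "c g = c \<one>" unfolding c_def
      by (rule AG.finprod_cong') (use f_cong[OF cos] fA T_carr in \<open>auto simp: subset_iff\<close>)
    then have "s g = s \<one>" unfolding s_def e_def using t_eq[OF cos] by simp
    then show ?thesis by simp
  qed
  let ?C = "s ` carrier G"
  have C: "subgroup ?C G" using s.img_is_subgroup .
  have int: "?C \<inter> A = {\<one>}"
  proof (intro equalityI subsetI)
    fix x assume "x \<in> ?C \<inter> A"
    then obtain g where g: "g \<in> carrier G" "x = s g" "s g \<in> A" by auto
    then have "A #> g = A" using s_cos A.rcos_const[OF is_group] by metis
    then have "g \<in> A" using g rcos_self[OF _ A.subgroup_axioms] by metis
    then show "x \<in> {\<one>}" using ker g by simp
  qed (use A.one_closed s.hom_one in force)
  have "?C <#> A = carrier G"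
  proof
    show "?C <#> A \<subseteq> carrier G" using s_carr by (auto simp: set_mult_def)
    show "carrier G \<subseteq> ?C <#> A"
    proof
      fix g assume g: "g \<in> carrier G"
      then have "g \<in> A #> s g" using s_cos rcos_self[OF _ A.subgroup_axioms] by metis
      also have "A #> s g = s g <# A" using A.coset_eq s_carr g by blast
      finally show "g \<in> ?C <#> A" using g by (auto simp: l_coset_def set_mult_def)
    qed
  qed
  then have "card ?C * card A = order G"
    using card_set_mult[OF C A.subgroup_axioms fin] int by (simp add: order_def)
  then show ?thesis using C by blast
qed

text \<open>Without a fixed point every orbit has a size that is a power of p greater than 1, so p
  would divide |E|. The action is a bare function constrained only on \<open>E\<close>, so that it
  can act on cosets as well as on elements.\<close>

lemma (in group) p_group_fixed_point:
  assumes p: "Factorial_Ring.prime p" "order G = p ^ n" and fin: "finite E" "\<not> p dvd card E"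
    and closed: "\<And>g e. g \<in> carrier G \<Longrightarrow> e \<in> E \<Longrightarrow> f g e \<in> E"
    and f_one: "\<And>e. e \<in> E \<Longrightarrow> f \<one> e = e"
    and f_mult: "\<And>g h e. g \<in> carrier G \<Longrightarrow> h \<in> carrier G \<Longrightarrow> e \<in> E \<Longrightarrow> f (g \<otimes> h) e = f g (f h e)"
  shows "\<exists>e\<in>E. \<forall>g\<in>carrier G. f g e = e"
proof (rule ccontr)
  assume nofix: "\<not> (\<exists>e\<in>E. \<forall>g\<in>carrier G. f g e = e)"
  have finG: "finite (carrier G)"
    using p by (metis order_gt_0_iff_finite prime_gt_0_nat zero_less_power)
  define orb where "orb e = (\<lambda>g. f g e) ` carrier G" for e
  have self: "e \<in> orb e" if "e \<in> E" for e
    using f_one[OF that] unfolding orb_def by (metis image_eqI one_closed)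
  have sub: "orb e \<subseteq> E" if "e \<in> E" for e using closed that by (auto simp: orb_def)
  have f_inv: "f (inv g) (f g e) = e" if "g \<in> carrier G" "e \<in> E" for g e
    using that f_mult[of "inv g" g e] f_one by simp
  have orb_eq: "orb (f g e) = orb e" if "g \<in> carrier G" "e \<in> E" for g e
  proof -
    have *: "orb (f g e) \<subseteq> orb e" if "g \<in> carrier G" "e \<in> E" for g e
    proof
      fix y assume "y \<in> orb (f g e)"
      then obtain h where h: "h \<in> carrier G" "y = f h (f g e)" by (auto simp: orb_def)
      then have "y = f (h \<otimes> g) e" using f_mult[OF h(1) that] by simp
      then show "y \<in> orb e" unfolding orb_def using h that by blast
    qed
    have "orb (f (inv g) (f g e)) \<subseteq> orb (f g e)"
      by (rule *) (use that closed in auto)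
    then show ?thesis using *[OF that] f_inv[OF that] by simp
  qed
  have dvd: "p dvd card (orb e)" if e: "e \<in> E" for e
  proof -
    have "card (carrier G) = card {g \<in> carrier G. f g e = e} * card (orb e)"
      unfolding orb_def
    proof (rule card_eq_fibers[OF finG])
      fix y assume "y \<in> (\<lambda>g. f g e) ` carrier G"
      then obtain h where h: "h \<in> carrier G" "y = f h e" by auto
      have "bij_betw (\<lambda>g. h \<otimes> g) {g \<in> carrier G. f g e = e} {g \<in> carrier G. f g e = y}"
      proof (rule bij_betw_byWitness[where f' = "\<lambda>g. inv h \<otimes> g"])
        show "(\<lambda>g. inv h \<otimes> g) ` {g \<in> carrier G. f g e = y} \<subseteq> {g \<in> carrier G. f g e = e}"
          using h f_inv[OF h(1) e] f_mult[of "inv h" _ e] e by auto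
        show "(\<lambda>g. h \<otimes> g) ` {g \<in> carrier G. f g e = e} \<subseteq> {g \<in> carrier G. f g e = y}"
          using h f_mult[OF h(1) _ e] by auto
      qed (use h in \<open>auto simp: word_simps\<close>)
      then show "card {x \<in> carrier G. f x e = y} = card {g \<in> carrier G. f g e = e}"
        by (simp add: bij_betw_same_card)
    qed
    then have "card (orb e) dvd p ^ n" using p(2) unfolding order_def by (metis dvd_triv_right)
    then obtain i where i: "card (orb e) = p ^ i" using p by (auto simp: divides_primepow_nat)
    moreover have "i \<noteq> 0"
    proof
      assume "i = 0"
      then obtain x where "orb e = {x}" using i by (auto simp: card_1_singleton_iff)
      then have "\<forall>g\<in>carrier G. f g e = e" using self[OF e] by (auto simp: orb_def)
      then show False using nofix e by blast
    qed
    ultimately show ?thesis by (metis dvd_power bot_nat_0.not_eq_extremum)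
  qed
  have "p dvd card (\<Union>(orb ` E))"
  proof (rule dvd_partition)
    have "\<Union>(orb ` E) \<subseteq> E" using sub by auto
    then show "finite (\<Union>(orb ` E))" using fin(1) finite_subset by blast
    show "\<forall>C\<in>orb ` E. p dvd card C" using dvd by auto
    show "\<forall>C1\<in>orb ` E. \<forall>C2\<in>orb ` E. C1 \<noteq> C2 \<longrightarrow> C1 \<inter> C2 = {}"
    proof (intro ballI impI, rule ccontr)
      fix C1 C2 assume C: "C1 \<in> orb ` E" "C2 \<in> orb ` E" "C1 \<noteq> C2" "C1 \<inter> C2 \<noteq> {}"
      then obtain e1 e2 x where x: "e1 \<in> E" "e2 \<in> E" "C1 = orb e1" "C2 = orb e2" "x \<in> orb e1" "x \<in> orb e2"
        by auto
      have orb_x: "orb x = orb e" if e: "e \<in> E" "x \<in> orb e" for e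
      proof -
        obtain g where "g \<in> carrier G" "x = f g e" using e(2) by (auto simp: orb_def)
        then show ?thesis using orb_eq[of g e] e(1) by simp
      qed
      have "orb x = orb e1" "orb x = orb e2" using orb_x[OF x(1,5)] orb_x[OF x(2,6)] .
      then show False using C x by simp
    qed
  qed
  moreover have "\<Union>(orb ` E) = E" using self sub by auto
  ultimately show False using fin by simp
qed

section \<open>Frattini's argument and centres of p-groups\<close>

context group
begin

text \<open>P acts on its own right cosets in N, an element x multiplying by the inverse of g x
  g^-1. The number m of cosets is prime to p, and a fixed coset P n says precisely that n g
  conjugates P into itself.\<close>

lemma frattini:
  assumes N: "N \<lhd> G" and fin: "finite (carrier G)" and P: "subgroup P G" "P \<subseteq> N"
    and p: "Factorial_Ring.prime p" "card P = p ^ a" "card N = p ^ a * m" "\<not> p dvd m"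
    and g: "g \<in> carrier G"
  shows "\<exists>n\<in>N. \<forall>x\<in>P. n \<otimes> g \<otimes> x \<otimes> inv (n \<otimes> g) \<in> P"
proof -
  interpret N: normal N G by fact
  interpret P: subgroup P G by fact
  interpret GN: group "G\<lparr>carrier := N\<rparr>" using N.subgroup_is_group[OF is_group] .
  interpret GP: group "G\<lparr>carrier := P\<rparr>" using P.subgroup_is_group[OF is_group] .
  have PN: "subgroup P (G\<lparr>carrier := N\<rparr>)" using P N.subgroup_axioms by (simp add: subgroup_incl)
  let ?E = "rcosets\<^bsub>G\<lparr>carrier := N\<rparr>\<^esub> P"
  have finN: "finite N" using fin N.subset finite_subset by blast
  have "card ?E * card P = card N"
    using GN.lagrange_finite[of P] PN finN by (simp add: order_def)
  then have cE: "card ?E = m" using p by (simp add: prime_gt_0_nat)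
  have E: "?E = (\<lambda>x. P #> x) ` N" by (auto simp: RCOSETS_def r_coset_def)
  define f where "f h C = C #> (g \<otimes> inv h \<otimes> inv g)" for h C
  have mem: "g \<otimes> inv h \<otimes> inv g \<in> N" if "h \<in> P" for h
    using N.inv_op_closed2[OF g] that P by (meson P.m_inv_closed subsetD)
  have fx: "f h (P #> x) = P #> (x \<otimes> (g \<otimes> inv h \<otimes> inv g))" if "h \<in> P" "x \<in> N" for h x
    unfolding f_def using coset_mult_assoc[OF P.subset, of x "g \<otimes> inv h \<otimes> inv g"] that mem[OF that(1)] by simp
  have "\<exists>e\<in>?E. \<forall>h\<in>carrier (G\<lparr>carrier := P\<rparr>). f h e = e"
  proof (rule GP.p_group_fixed_point[OF p(1)])
    show "order (G\<lparr>carrier := P\<rparr>) = p ^ a" using p by (simp add: order_def)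
    show "finite ?E" using finN by (simp add: E)
    show "\<not> p dvd card ?E" using cE p by simp
    show "f h e \<in> ?E" if "h \<in> carrier (G\<lparr>carrier := P\<rparr>)" "e \<in> ?E" for h e
    proof -
      obtain x where "h \<in> P" "x \<in> N" "e = P #> x" using \<open>h \<in> _\<close> \<open>e \<in> _\<close> unfolding E by auto
      then show ?thesis using fx[of h x] mem[of h] unfolding E by simp
    qed
    show "f \<one>\<^bsub>G\<lparr>carrier := P\<rparr>\<^esub> e = e" if "e \<in> ?E" for e
    proof -
      obtain x where "x \<in> N" "e = P #> x" using \<open>e \<in> _\<close> unfolding E by auto
      then show ?thesis using fx[of \<one> x] g by simp
    qed
    fix h k e assume "h \<in> carrier (G\<lparr>carrier := P\<rparr>)" "k \<in> carrier (G\<lparr>carrier := P\<rparr>)" "e \<in> ?E"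
    then obtain x where hk: "h \<in> P" "k \<in> P" "x \<in> N" "e = P #> x" unfolding E by auto
    have "f h (f k e) = P #> ((x \<otimes> (g \<otimes> inv k \<otimes> inv g)) \<otimes> (g \<otimes> inv h \<otimes> inv g))"
      using hk fx[OF hk(2,3)] fx[of h "x \<otimes> (g \<otimes> inv k \<otimes> inv g)"] mem[OF hk(2)] by simp
    also have "\<dots> = f (h \<otimes> k) e" using hk g fx[of "h \<otimes> k" x] by (simp add: word_simps)
    finally show "f (h \<otimes>\<^bsub>G\<lparr>carrier := P\<rparr>\<^esub> k) e = f h (f k e)" by simp
  qed
  then obtain x where x: "x \<in> N" "\<And>h. h \<in> P \<Longrightarrow> f h (P #> x) = P #> x" unfolding E by auto
  have "x \<otimes> g \<otimes> h \<otimes> inv (x \<otimes> g) \<in> P" if h: "h \<in> P" for h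
  proof -
    have "P #> (x \<otimes> (g \<otimes> inv (inv h) \<otimes> inv g)) = P #> x" using x fx[of "inv h" x] h by simp
    then have "x \<otimes> (g \<otimes> inv (inv h) \<otimes> inv g) \<otimes> inv x \<in> P"
      using rcos_eq_iff[OF P(1), of "x \<otimes> (g \<otimes> inv (inv h) \<otimes> inv g)" x] x(1) g h by simp
    then show ?thesis using x(1) g h by (simp add: word_simps)
  qed
  then show ?thesis using x by blast
qed

text \<open>Conjugation acts on P without the identity, a set whose size is prime to p; a fixed
  point is central.\<close>

lemma p_group_center_nontrivial:
  assumes P: "subgroup P G" and p: "Factorial_Ring.prime p" "card P = p ^ n" "n > 0"
  shows "\<exists>z\<in>P. z \<noteq> \<one> \<and> (\<forall>x\<in>P. x \<otimes> z = z \<otimes> x)"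
proof -
  interpret P: subgroup P G by fact
  interpret GP: group "G\<lparr>carrier := P\<rparr>" using P.subgroup_is_group[OF is_group] .
  have finP: "finite P" using p by (metis card.infinite not_prime_0 power_eq_0_iff)
  have "\<exists>z\<in>P - {\<one>}. \<forall>x\<in>carrier (G\<lparr>carrier := P\<rparr>). x \<otimes> z \<otimes> inv x = z"
  proof (rule GP.p_group_fixed_point[OF p(1)])
    show "order (G\<lparr>carrier := P\<rparr>) = p ^ n" using p by (simp add: order_def)
    have "p dvd card P" using p by simp
    moreover have "card P = card (P - {\<one>}) + 1" using card.remove[OF finP P.one_closed] by simp
    ultimately show "\<not> p dvd card (P - {\<one>})" using p(1)
      by (metis dvd_add_right_iff nat_dvd_1_iff_1 not_prime_1)
    show "x \<otimes> z \<otimes> inv x \<in> P - {\<one>}" if "x \<in> carrier (G\<lparr>carrier := P\<rparr>)" "z \<in> P - {\<one>}" for x z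
    proof -
      have "x \<otimes> z \<otimes> inv x \<noteq> \<one>"
      proof
        assume "x \<otimes> z \<otimes> inv x = \<one>"
        then have "inv x \<otimes> (x \<otimes> z \<otimes> inv x) \<otimes> x = \<one>" using that by simp
        then show False using that by (simp add: word_simps)
      qed
      then show ?thesis using that by simp
    qed
  qed (use finP in \<open>auto simp: word_simps\<close>)
  then obtain z where z: "z \<in> P" "z \<noteq> \<one>" "\<And>x. x \<in> P \<Longrightarrow> x \<otimes> z \<otimes> inv x = z" by auto
  have "x \<otimes> z = z \<otimes> x" if "x \<in> P" for x
  proof -
    have "x \<otimes> z = (x \<otimes> z \<otimes> inv x) \<otimes> x" using that z(1) by (simp add: word_simps)
    then show ?thesis using z(3)[OF that] by simp
  qed
  then show ?thesis using z by blast
qed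

end

lemma (in group_hom) card_preimage:
  assumes fin: "finite (carrier G)" and B: "B \<subseteq> h ` carrier G"
  shows "card {x \<in> carrier G. h x \<in> B} = card (kernel G H h) * card B"
proof -
  have "card {x \<in> carrier G. h x \<in> B} = card (kernel G H h) * card (h ` {x \<in> carrier G. h x \<in> B})"
  proof (rule card_eq_fibers)
    fix y assume "y \<in> h ` {x \<in> carrier G. h x \<in> B}"
    then obtain g where g: "g \<in> carrier G" "h g \<in> B" "y = h g" by auto
    have "bij_betw (\<lambda>z. g \<otimes> z) (kernel G H h) {x \<in> {x \<in> carrier G. h x \<in> B}. h x = y}"
      by (rule bij_betw_byWitness[where f' = "\<lambda>x. inv g \<otimes> x"])
        (use g in \<open>auto simp: kernel_def G.word_simps\<close>)
    then show "card {x \<in> {x \<in> carrier G. h x \<in> B}. h x = y} = card (kernel G H h)"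
      by (simp add: bij_betw_same_card)
  qed (use fin in simp)
  moreover have "h ` {x \<in> carrier G. h x \<in> B} = B" using B by auto
  ultimately show ?thesis by simp
qed

lemma (in group_hom) subgroup_preimage:
  assumes "subgroup B H"
  shows "subgroup {x \<in> carrier G. h x \<in> B} G"
proof -
  interpret B: subgroup B H by fact
  show ?thesis by unfold_locales auto
qed

lemma (in group) card_rcosets_mult:
  assumes "subgroup H G" "finite (carrier G)"
  shows "card (rcosets H) * card H = card (carrier G)"
  using lagrange_finite[OF assms(2,1)] by (simp add: order_def)

lemma (in group) card_subgroup_dvd:
  assumes "subgroup A G" "subgroup B G" "A \<subseteq> B"
  shows "card A dvd card B"
proof -
  interpret B: group "G\<lparr>carrier := B\<rparr>" using assms subgroup.subgroup_is_group by blast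
  have "card (rcosets\<^bsub>G\<lparr>carrier := B\<rparr>\<^esub> A) * card A = card B"
    using B.lagrange[OF subgroup_incl[OF assms]] by (simp add: order_def)
  then show ?thesis by (metis dvd_triv_right)
qed

lemma (in group) finite_subgroup: "subgroup H G \<Longrightarrow> finite (carrier G) \<Longrightarrow> finite H"
  using finite_subset subgroup.subset by metis

lemma (in group) card_subgroup_pos: "subgroup H G \<Longrightarrow> finite (carrier G) \<Longrightarrow> card H > 0"
  using finite_subgroup subgroup.one_closed by (metis card_gt_0_iff empty_iff)

text \<open>Membership asks only for an inclusion. Conjugation is injective on the finite set P, so
  the inclusion is an equality, and this gives closure under inverses.\<close>

lemma (in group) subgroup_normalizer_finite:
  assumes P: "subgroup P G" and fin: "finite (carrier G)"
  shows "subgroup {g \<in> carrier G. \<forall>x\<in>P. g \<otimes> x \<otimes> inv g \<in> P} G" (is "subgroup ?M G")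
proof
  interpret P: subgroup P G by fact
  have finP: "finite P" using finite_subgroup[OF P fin] .
  show "\<one> \<in> ?M" by simp
  show "x \<otimes> y \<in> ?M" if "x \<in> ?M" "y \<in> ?M" for x y
  proof -
    have "x \<otimes> y \<otimes> z \<otimes> inv (x \<otimes> y) = x \<otimes> (y \<otimes> z \<otimes> inv y) \<otimes> inv x" if "z \<in> P" for z
      using \<open>x \<in> ?M\<close> \<open>y \<in> ?M\<close> that by (simp add: word_simps)
    then show ?thesis using that by auto
  qed
  show "inv x \<in> ?M" if x: "x \<in> ?M" for x
  proof -
    have xc: "x \<in> carrier G" using x by simp
    have "inj_on (\<lambda>z. x \<otimes> z \<otimes> inv x) P" using xc by (auto simp: inj_on_def)
    then have img: "(\<lambda>z. x \<otimes> z \<otimes> inv x) ` P = P" using x finP by (intro endo_inj_surj) auto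
    have "inv x \<otimes> z \<otimes> inv (inv x) \<in> P" if z: "z \<in> P" for z
    proof -
      have "z \<in> (\<lambda>z. x \<otimes> z \<otimes> inv x) ` P" using z img by simp
      then obtain w where "w \<in> P" "z = x \<otimes> w \<otimes> inv x" by blast
      then show ?thesis using xc by (simp add: word_simps)
    qed
    then show ?thesis using xc by simp
  qed
qed auto

text \<open>The inductive step on |G|. Let P be a Sylow p-subgroup of N. If its normalizer is
  proper, it supplements N by Frattini's argument and is treated by induction. Otherwise P is normal
  in G, and so is its nontrivial centre Z: induction in G/Z reduces the claim to a subgroup in which
  only the abelian Z has to be split off.\<close>

lemma schur_zassenhaus_step:
  fixes G :: "'a monoid" (structure)
  assumes grp: "group G" and fin: "finite (carrier G)" and N: "N \<lhd> G"
    and cop: "coprime (card N) (card (rcosets N))"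
    and IH: "\<And>(H :: 'a monoid) M. \<lbrakk>order H < order G; group H; finite (carrier H); M \<lhd> H;
      coprime (card M) (card (rcosets\<^bsub>H\<^esub> M))\<rbrakk> \<Longrightarrow> \<exists>C. subgroup C H \<and> card C * card M = order H"
  shows "\<exists>C. subgroup C G \<and> card C * card N = order G"
proof -
  interpret group G by fact
  interpret N: normal N G by fact
  note card_pos = card_subgroup_pos[OF _ fin]
  have index: "card (rcosets N) * card N = card (carrier G)"
    using card_rcosets_mult[OF N.subgroup_axioms fin] .
  show ?thesis
  proof (cases "card N = 1")
    case True
    then show ?thesis using subgroup_self by (intro exI[of _ "carrier G"]) (simp add: order_def)
  next
    case False
    then obtain p where p: "Factorial_Ring.prime p" "p dvd card N" using prime_factor_nat by blast
    have N0: "card N > 0" using card_pos N.subgroup_axioms by blast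
    define a where "a = multiplicity p (card N)"
    have a: "a > 0" unfolding a_def using p N0 by (simp add: prime_multiplicity_gt_zero_iff)
    obtain m where m: "card N = p ^ a * m" "\<not> p dvd m"
      using multiplicity_decompose'[of "card N" p] N0 prime_gt_Suc_0_nat[OF p(1)] unfolding a_def by auto
    interpret GN: group "G\<lparr>carrier := N\<rparr>" using N.subgroup_is_group[OF is_group] .
    obtain P where P': "subgroup P (G\<lparr>carrier := N\<rparr>)" "card P = p ^ a"
      using sylow_thm[OF p(1) GN.is_group, of a m] m finite_subgroup[OF N.subgroup_axioms fin]
      by (auto simp: order_def)
    have P: "subgroup P G" using incl_subgroup[OF N.subgroup_axioms P'(1)] .
    have PN: "P \<subseteq> N" using subgroup.subset[OF P'(1)] by simp
    interpret P: subgroup P G by fact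
    define M where "M = {g \<in> carrier G. \<forall>x\<in>P. g \<otimes> x \<otimes> inv g \<in> P}"
    have M: "subgroup M G" unfolding M_def using subgroup_normalizer_finite[OF P fin] .
    interpret M: subgroup M G by fact
    show ?thesis
    proof (cases "M = carrier G")
      case False
      let ?G1 = "G\<lparr>carrier := M\<rparr>" and ?N1 = "N \<inter> M"
      interpret G1: group ?G1 using M.subgroup_is_group[OF is_group] .
      have N1: "?N1 \<lhd> ?G1" using normal_Int_subgroup[OF M N] .
      have N1G: "subgroup ?N1 G" using subgroups_Inter_pair[OF N.subgroup_axioms M] .
      have "N <#> M = carrier G"
      proof
        show "N <#> M \<subseteq> carrier G" using N.subset M.subset by (rule set_mult_closed)
        show "carrier G \<subseteq> N <#> M"
        proof
          fix g assume g: "g \<in> carrier G"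
          then obtain n where n: "n \<in> N" "\<forall>x\<in>P. n \<otimes> g \<otimes> x \<otimes> inv (n \<otimes> g) \<in> P"
            using frattini[OF N fin P PN p(1) P'(2) m g] by blast
          have "n \<otimes> g \<in> M" using n g N.mem_carrier[OF n(1)] unfolding M_def by simp
          moreover have "g = inv n \<otimes> (n \<otimes> g)" using n(1) g by (simp add: word_simps)
          ultimately show "g \<in> N <#> M" using n(1) unfolding set_mult_def by blast
        qed
      qed
      then have cM: "card (carrier G) * card ?N1 = card N * card M"
        using card_set_mult[OF N.subgroup_axioms M fin] by simp
      have ix1: "card (rcosets\<^bsub>?G1\<^esub> ?N1) * card ?N1 = card M"
        using G1.card_rcosets_mult[OF normal_imp_subgroup[OF N1]] finite_subgroup[OF M fin] by simp
      have pos: "card ?N1 > 0" using card_pos[OF N1G] .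
      have "card (rcosets N) * card N * card ?N1 = card N * (card (rcosets\<^bsub>?G1\<^esub> ?N1) * card ?N1)"
        using cM index ix1 by simp
      then have ixeq: "card (rcosets\<^bsub>?G1\<^esub> ?N1) = card (rcosets N)" using pos N0 by simp
      have "coprime (card ?N1) (card (rcosets\<^bsub>?G1\<^esub> ?N1))"
        unfolding ixeq using cop card_subgroup_dvd[OF N1G N.subgroup_axioms]
        by (meson Int_lower1 coprime_divisors dvd_refl)
      moreover have "order ?G1 < order G"
        using False M.subset fin by (auto simp: order_def intro!: psubset_card_mono)
      ultimately obtain C where C: "subgroup C ?G1" "card C * card ?N1 = card M"
        using IH[of ?G1 ?N1] N1 G1.is_group finite_subgroup[OF M fin] by (auto simp: order_def)
      have "card C * card N * card ?N1 = card (carrier G) * card ?N1" using C(2) cM by (simp add: ac_simps)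
      then have "card C * card N = order G" using pos by (simp add: order_def)
      then show ?thesis using incl_subgroup[OF M C(1)] by blast
    next
      case True
      \<comment> \<open>The centre of P. It is invariant under all conjugations that preserve P, and
        in this case those are all conjugations of G.\<close>
      define Z where "Z = {z \<in> P. \<forall>x\<in>P. x \<otimes> z = z \<otimes> x}"
      have ZP: "Z \<subseteq> P" by (auto simp: Z_def)
      have "subgroup Z G"
      proof
        show "x \<otimes> y \<in> Z" if "x \<in> Z" "y \<in> Z" for x y
        proof -
          have [simp]: "x \<in> carrier G" "y \<in> carrier G" using that ZP by auto
          have "w \<otimes> (x \<otimes> y) = x \<otimes> y \<otimes> w" if "w \<in> P" for w
          proof -
            have "w \<otimes> (x \<otimes> y) = (w \<otimes> x) \<otimes> y" using that by (simp add: m_assoc)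
            also have "\<dots> = x \<otimes> (w \<otimes> y)" using that \<open>x \<in> Z\<close> by (simp add: Z_def m_assoc)
            also have "\<dots> = x \<otimes> y \<otimes> w" using that \<open>y \<in> Z\<close> by (simp add: Z_def m_assoc)
            finally show ?thesis .
          qed
          moreover have "x \<otimes> y \<in> P" using that ZP by (meson P.m_closed subsetD)
          ultimately show ?thesis unfolding Z_def by blast
        qed
        show "inv x \<in> Z" if x: "x \<in> Z" for x
        proof -
          have [simp]: "x \<in> carrier G" using x ZP by auto
          have "w \<otimes> inv x = inv x \<otimes> w" if w: "w \<in> P" for w
          proof -
            have "inv w \<otimes> x = x \<otimes> inv w" using x w unfolding Z_def by blast
            then have "inv (x \<otimes> inv w) = inv (inv w \<otimes> x)" by simp
            then show ?thesis using w by (simp add: inv_mult_group)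
          qed
          moreover have "inv x \<in> P" using x ZP by (meson P.m_inv_closed subsetD)
          ultimately show ?thesis unfolding Z_def by blast
        qed
      qed (use ZP in \<open>auto simp: Z_def\<close>)
      moreover have "g \<otimes> z \<otimes> inv g \<in> Z" if g: "g \<in> carrier G" and z: "z \<in> Z" for g z
      proof -
        have gP: "g \<otimes> x \<otimes> inv g \<in> P" "inv g \<otimes> x \<otimes> g \<in> P" if "x \<in> P" for x
        proof -
          have "g \<in> M" "inv g \<in> M" using g True by auto
          then have "\<forall>x\<in>P. g \<otimes> x \<otimes> inv g \<in> P" "\<forall>x\<in>P. inv g \<otimes> x \<otimes> inv (inv g) \<in> P"
            unfolding M_def by blast+
          then show "g \<otimes> x \<otimes> inv g \<in> P" "inv g \<otimes> x \<otimes> g \<in> P" using that inv_inv[OF g] by simp_all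
        qed
        have "x \<otimes> (g \<otimes> z \<otimes> inv g) = g \<otimes> z \<otimes> inv g \<otimes> x" if "x \<in> P" for x
        proof -
          have zc: "z \<in> carrier G" using z ZP by auto
          have "x \<otimes> (g \<otimes> z \<otimes> inv g) = g \<otimes> ((inv g \<otimes> x \<otimes> g) \<otimes> z) \<otimes> inv g"
            using g zc that by (simp add: word_simps)
          also have "(inv g \<otimes> x \<otimes> g) \<otimes> z = z \<otimes> (inv g \<otimes> x \<otimes> g)" using z gP(2)[OF that] unfolding Z_def by blast
          also have "g \<otimes> (z \<otimes> (inv g \<otimes> x \<otimes> g)) \<otimes> inv g = g \<otimes> z \<otimes> inv g \<otimes> x"
            using g zc that by (simp add: word_simps)
          finally show ?thesis .
        qed
        moreover have "g \<otimes> z \<otimes> inv g \<in> P" using z gP(1) ZP by blast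
        ultimately show ?thesis unfolding Z_def by blast
      qed
      ultimately have Z: "Z \<lhd> G" using normal_inv_iff by blast
      interpret Z: normal Z G by fact
      have Zpos: "card Z > 0" using card_pos[OF Z.subgroup_axioms] .
      obtain z where "z \<in> Z" "z \<noteq> \<one>"
        using p_group_center_nontrivial[OF P p(1) P'(2) a] unfolding Z_def by blast
      then have "card Z \<noteq> 1" using Z.one_closed by (auto simp: card_1_singleton_iff)
      then have Z1: "card Z > 1" using Zpos by linarith
      have Zdvd: "card Z dvd card N" 
        using card_subgroup_dvd[OF Z.subgroup_axioms N.subgroup_axioms] ZP PN by blast
      \<comment> \<open>Choosing representatives realizes G/Z on a subset of the carrier of G. The
        group \<open>image_group f G\<close> therefore has the element type that the induction
        hypothesis demands.\<close>
      define f where "f x = (SOME y. y \<in> Z #> x)" for x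
      have f: "Z #> f x = Z #> x" if "x \<in> carrier G" for x
      proof -
        have "f x \<in> Z #> x"
          unfolding f_def using rcos_self[OF that Z.subgroup_axioms] by (rule someI)
        then show ?thesis using repr_independence[OF _ that Z.subgroup_axioms] by simp
      qed
      have wgm: "weak_group_morphism f Z G"
      proof (rule weak_group_morphismsI[OF Z])
        fix x y assume xy: "x \<in> carrier G" "y \<in> carrier G"
        have "f x = f y \<longleftrightarrow> Z #> x = Z #> y" 
        proof
          show "Z #> x = Z #> y" if "f x = f y"
            using f[OF xy(1)] f[OF xy(2)] unfolding that by simp
          show "f x = f y" if "Z #> x = Z #> y" unfolding f_def that ..
        qed
        then show "f x = f y \<longleftrightarrow> x \<otimes> inv y \<in> Z" using rcos_eq_iff[OF Z.subgroup_axioms xy] by simp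
      qed
      let ?H = "image_group f G"
      interpret h: group_hom G ?H f using weak_group_morphism_group_hom[OF wgm] .
      have ker: "kernel G ?H f = Z" using weak_group_morphism_ker[OF wgm] .
      have surj: "f ` carrier G = carrier ?H" by (simp add: image_group_carrier)
      have cpre: "card {x \<in> carrier G. f x \<in> B} = card Z * card B" if "B \<subseteq> carrier ?H" for B
        using h.card_preimage[OF fin, of B] that ker surj by simp
      have finH: "finite (carrier ?H)" using fin surj by (metis finite_imageI)
      have "{x \<in> carrier G. f x \<in> carrier ?H} = carrier G" by (auto simp: image_group_carrier)
      then have cH: "card (carrier G) = card Z * card (carrier ?H)" using cpre[of "carrier ?H"] by simp
      have preN: "{x \<in> carrier G. f x \<in> f ` N} = N"
      proof (intro equalityI subsetI)
        fix x assume "x \<in> {x \<in> carrier G. f x \<in> f ` N}"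
        then obtain n where n: "x \<in> carrier G" "n \<in> N" "f x = f n" by auto
        then have "Z #> x = Z #> n" using f by (metis N.mem_carrier)
        then have "x \<otimes> inv n \<in> Z" using rcos_eq_iff[OF Z.subgroup_axioms] n by simp
        then have "x \<otimes> inv n \<otimes> n \<in> N" using ZP PN n by (meson N.m_closed subsetD)
        then show "x \<in> N" using n by (simp add: word_simps)
      qed auto
      have cN: "card N = card Z * card (f ` N)"
        using cpre[of "f ` N"] preN N.subset surj by (metis image_mono)
      have N2: "f ` N \<lhd> ?H"
        using N.surj_hom_normal_subgroup[OF h.group_hom_axioms surj] .
      have "card (rcosets\<^bsub>?H\<^esub> (f ` N)) * card (f ` N) = card (carrier ?H)"
        using h.H.card_rcosets_mult[OF normal_imp_subgroup[OF N2] finH] .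
      then have "card (rcosets\<^bsub>?H\<^esub> (f ` N)) * card N = card (rcosets N) * card N"
        using index cH cN by (metis mult.left_commute)
      then have ixeq: "card (rcosets\<^bsub>?H\<^esub> (f ` N)) = card (rcosets N)" using N0 by simp
      have "coprime (card (f ` N)) (card (rcosets\<^bsub>?H\<^esub> (f ` N)))"
        unfolding ixeq using cop cN by (metis coprime_mult_left_iff)
      moreover have "order ?H < order G"
      proof -
        have "card (carrier ?H) > 0" using finH h.H.one_closed by (metis card_gt_0_iff empty_iff)
        then show ?thesis unfolding order_def cH using Z1 by simp
      qed
      ultimately obtain C where C: "subgroup C ?H" "card C * card (f ` N) = card (carrier ?H)"
        using IH[of ?H "f ` N"] N2 finH by (auto simp: order_def h.H.is_group)
      \<comment> \<open>The preimage of a complement of N/Z in G/Z. It has order |Z| |G : N|, so a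
        complement of the abelian normal subgroup Z in it has the order |G : N| that is
        wanted.\<close>
      define D where "D = {x \<in> carrier G. f x \<in> C}"
      have D: "subgroup D G" unfolding D_def by (rule h.subgroup_preimage[OF C(1)])
      have cD: "card D = card Z * card C"
        unfolding D_def using cpre subgroup.subset[OF C(1)] .
      interpret GD: group "G\<lparr>carrier := D\<rparr>" using subgroup.subgroup_is_group[OF D is_group] .
      have finD: "finite (carrier (G\<lparr>carrier := D\<rparr>))" using finite_subgroup[OF D fin] by simp
      have ZD: "Z \<subseteq> D"
      proof
        fix x assume "x \<in> Z"
        then have "x \<in> kernel G ?H f" using ker by simp
        then show "x \<in> D" using subgroup.one_closed[OF C(1)] unfolding D_def kernel_def by simp
      qed
      have ZnD: "Z \<lhd> G\<lparr>carrier := D\<rparr>" using normal_restrict_supergroup[OF D Z ZD] .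
      have "card (rcosets\<^bsub>G\<lparr>carrier := D\<rparr>\<^esub> Z) * card Z = card D"
        using GD.card_rcosets_mult[OF normal_imp_subgroup[OF ZnD] finD] by simp
      then have ixD: "card (rcosets\<^bsub>G\<lparr>carrier := D\<rparr>\<^esub> Z) = card C" using cD Zpos by simp
      have "card C * card N = card (carrier G)" using C(2) cN cH by (metis mult.left_commute)
      then have cC: "card C = card (rcosets N)" using index N0 by (metis mult_right_cancel not_gr0)
      have "coprime (card Z) (card (rcosets\<^bsub>G\<lparr>carrier := D\<rparr>\<^esub> Z))"
        unfolding ixD cC using cop Zdvd by (meson coprime_divisors dvd_refl)
      moreover have "x \<otimes>\<^bsub>G\<lparr>carrier := D\<rparr>\<^esub> y = y \<otimes>\<^bsub>G\<lparr>carrier := D\<rparr>\<^esub> x" if "x \<in> Z" "y \<in> Z" for x y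
      proof -
        have "x \<otimes> y = y \<otimes> x" using that ZP unfolding Z_def by blast
        then show ?thesis by simp
      qed
      ultimately have "\<exists>E. subgroup E (G\<lparr>carrier := D\<rparr>) \<and> card E * card Z = order (G\<lparr>carrier := D\<rparr>)"
        using GD.abelian_normal_hall_splits[OF ZnD finD] by blast
      then obtain E where E: "subgroup E (G\<lparr>carrier := D\<rparr>)" "card E * card Z = card D"
        unfolding order_def by auto
      have "card E = card C" using E(2) cD Zpos by simp
      then have "card E * card N = order G" using \<open>card C * card N = _\<close> by (simp add: order_def)
      then show ?thesis using incl_subgroup[OF D E(1)] by blast
    qed
  qed
qed


lemma schur_zassenhaus:
  fixes G :: "'a monoid"
  assumes "group G" "finite (carrier G)" "N \<lhd> G" "coprime (card N) (card (rcosets\<^bsub>G\<^esub> N))"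
  shows "\<exists>C. subgroup C G \<and> card C * card N = order G"
  using assms
proof (induction "order G" arbitrary: G N rule: less_induct)
  case less
  show ?case by (rule schur_zassenhaus_step[OF less.prems less.hyps])
qed

section \<open>Hall subgroups of separable groups\<close>

text \<open>Positivity excludes 0, whose set of prime factors is empty. Otherwise cardinalities of
  infinite sets and quotients truncated to 0 would pass as \<tau>-numbers.\<close>

definition pi_number :: "nat set \<Rightarrow> nat \<Rightarrow> bool" where
  "pi_number \<tau> n \<longleftrightarrow> n > 0 \<and> prime_factors n \<subseteq> \<tau>"

lemma pi_number_mult: "pi_number \<tau> (a * b) \<longleftrightarrow> pi_number \<tau> a \<and> pi_number \<tau> b"
  by (cases "a = 0 \<or> b = 0") (auto simp: pi_number_def prime_factors_product)

lemma pi_number_dvd: "a dvd b \<Longrightarrow> pi_number \<tau> b \<Longrightarrow> pi_number \<tau> a"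
  by (auto simp: dvd_def pi_number_mult)

lemma pi_number_1 [simp]: "pi_number \<tau> (Suc 0)"
  by (simp add: pi_number_def)

lemma pi_number_pos: "pi_number \<tau> n \<Longrightarrow> n > 0"
  by (simp add: pi_number_def)

lemma pi_number_coprime:
  assumes "pi_number \<tau> a" "pi_number (compl_primes \<tau>) b"
  shows "coprime a b"
proof (rule ccontr)
  assume "\<not> coprime a b"
  then have "gcd a b \<noteq> 1" by (simp add: coprime_iff_gcd_eq_1)
  then obtain p where "Factorial_Ring.prime p" "p dvd gcd a b" using prime_factor_nat by blast
  then have "p \<in> prime_factors a" "p \<in> prime_factors b"
    using assms by (auto simp: pi_number_def prime_factors_dvd)
  then show False using assms by (auto simp: pi_number_def compl_primes_def)
qed

lemma pi_number_eq_1: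
  assumes "pi_number \<tau> a" "pi_number (compl_primes \<tau>) a"
  shows "a = 1"
  using pi_number_coprime[OF assms] by simp

lemma compl_compl_primes: "\<pi> \<subseteq> {p. Factorial_Ring.prime p} \<Longrightarrow> compl_primes (compl_primes \<pi>) = \<pi>"
  by (auto simp: compl_primes_def)

section \<open>Hall subgroups in terms of orders and indices\<close>

context group
begin

lemma pi_group_subgroup_iff:
  "subgroup H G \<Longrightarrow> finite (carrier G) \<Longrightarrow> pi_group \<tau> (G\<lparr>carrier := H\<rparr>) \<longleftrightarrow> pi_number \<tau> (card H)"
  using card_subgroup_pos[of H] subgroup.subgroup_is_group[of H G] is_group
  by (auto simp: pi_group_def pi_number_def order_def)

lemma card_rcosets_eq:
  "subgroup H G \<Longrightarrow> finite (carrier G) \<Longrightarrow> card (rcosets H) = card (carrier G) div card H"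
  using card_rcosets_mult[of H] card_subgroup_pos[of H] by (metis div_mult_self_is_m)

lemma card_mult_index:
  "subgroup A G \<Longrightarrow> subgroup B G \<Longrightarrow> A \<subseteq> B \<Longrightarrow> card A * (card B div card A) = card B"
  using card_subgroup_dvd by (simp add: dvd_mult_div_cancel)

lemma index_pos:
  assumes "subgroup A G" "subgroup B G" "A \<subseteq> B" "finite (carrier G)"
  shows "card B div card A > 0"
  using card_mult_index[OF assms(1-3)] card_subgroup_pos[OF assms(2,4)] by (metis mult_0_right neq0_conv)

lemma pi_group_factor_iff:
  assumes "N \<lhd> G" "finite (carrier G)"
  shows "pi_group \<tau> (G Mod N) \<longleftrightarrow> pi_number \<tau> (card (carrier G) div card N)"
proof -
  have N: "subgroup N G" using assms normal_imp_subgroup by blast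
  have "order (G Mod N) = card (carrier G) div card N"
    using card_rcosets_eq[OF N assms(2)] by (simp add: order_def FactGroup_def)
  then show ?thesis
    using index_pos[OF N subgroup_self subgroup.subset[OF N] assms(2)] normal.factorgroup_is_group[OF assms(1)]
    by (simp add: pi_group_def pi_number_def)
qed

lemma hall_subgroup_iff:
  assumes "finite (carrier G)"
  shows "hall_subgroup \<tau> G H \<longleftrightarrow>
    subgroup H G \<and> pi_number \<tau> (card H) \<and> pi_number (compl_primes \<tau>) (card (carrier G) div card H)"
proof (cases "subgroup H G")
  case True
  have "pi_number (compl_primes \<tau>) (card (carrier G) div card H) \<longleftrightarrow>
      prime_factors (card (carrier G) div card H) \<subseteq> compl_primes \<tau>"
    using index_pos[OF True subgroup_self subgroup.subset[OF True] assms] unfolding pi_number_def by blast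
  then show ?thesis
    unfolding hall_subgroup_def pi_subgroup_def card_rcosets_eq[OF True assms] pi_group_subgroup_iff[OF True assms]
    using True by blast
qed (simp add: hall_subgroup_def pi_subgroup_def)

lemma quotient_hom:
  assumes "N \<lhd> G"
  shows "group_hom G (G Mod N) (\<lambda>x. N #> x)" "(\<lambda>x. N #> x) ` carrier G = carrier (G Mod N)"
    "kernel G (G Mod N) (\<lambda>x. N #> x) = N"
proof -
  interpret N: normal N G by fact
  show "group_hom G (G Mod N) (\<lambda>x. N #> x)"
    by (intro group_hom.intro group_hom_axioms.intro is_group N.factorgroup_is_group N.r_coset_hom_Mod)
  show "(\<lambda>x. N #> x) ` carrier G = carrier (G Mod N)" by (rule carrier_FactGroup[symmetric])
  show "kernel G (G Mod N) (\<lambda>x. N #> x) = N"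
    using rcos_eq_iff[OF N.subgroup_axioms, of _ \<one>] N.subset N.rcos_const[OF is_group]
    by (auto simp: kernel_def)
qed

lemma set_mult_normal_subgroup:
  assumes "subgroup A G" "N \<lhd> G"
  shows "subgroup (A <#> N) G"
proof -
  interpret A: subgroup A G by fact
  interpret N: normal N G by fact
  show ?thesis
  proof
    show "A <#> N \<subseteq> carrier G" by (auto simp: set_mult_def)
    have "\<one> = \<one> \<otimes> \<one>" by simp
    then show "\<one> \<in> A <#> N" unfolding set_mult_def using A.one_closed N.one_closed by blast
    fix x y assume "x \<in> A <#> N"
    then obtain a n where an: "a \<in> A" "n \<in> N" "x = a \<otimes> n" by (auto simp: set_mult_def)
    then have "inv x = inv a \<otimes> (a \<otimes> inv n \<otimes> inv a)" by (simp add: word_simps)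
    moreover have "a \<otimes> inv n \<otimes> inv a \<in> N" using an N.inv_op_closed2 by simp
    ultimately show "inv x \<in> A <#> N" unfolding set_mult_def using an by blast
    assume "y \<in> A <#> N"
    then obtain b m where bm: "b \<in> A" "m \<in> N" "y = b \<otimes> m" by (auto simp: set_mult_def)
    then have "x \<otimes> y = (a \<otimes> b) \<otimes> ((inv b \<otimes> n \<otimes> b) \<otimes> m)" using an by (simp add: word_simps)
    moreover have "(inv b \<otimes> n \<otimes> b) \<otimes> m \<in> N" using an bm N.inv_op_closed1 by simp
    ultimately show "x \<otimes> y \<in> A <#> N" unfolding set_mult_def using an bm by blast
  qed
qed

text \<open>One step down a normal series. The factor (M \<inter> N)/(M \<inter> K) embeds into N/K,
  so it is a normal Hall \<tau>'-subgroup of M/(M \<inter> K). Schur-Zassenhaus provides a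
  complement, and C is its preimage, so that passing from M to C costs only a \<tau>'-index.\<close>

lemma hall_step:
  assumes fin: "finite (carrier G)" and M: "subgroup M G"
    and N: "N \<lhd> G" and K: "K \<lhd> G" and KN: "K \<subseteq> N"
    and NK: "pi_number (compl_primes \<tau>) (card N div card K)"
    and MN: "pi_number \<tau> (card M div card (M \<inter> N))"
  shows "\<exists>C. subgroup C G \<and> C \<subseteq> M \<and> pi_number (compl_primes \<tau>) (card M div card C) \<and>
    pi_number \<tau> (card C div card (C \<inter> K))"
proof -
  note NS = normal_imp_subgroup[OF N] and KS = normal_imp_subgroup[OF K]
  note MNs = subgroups_Inter_pair[OF M NS] and MKs = subgroups_Inter_pair[OF M KS]
  note pos = card_subgroup_pos[OF _ fin]
  let ?a = "card (M \<inter> N) div card (M \<inter> K)"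
  let ?b = "card M div card (M \<inter> N)"
  have MKN: "M \<inter> K \<subseteq> M \<inter> N" using KN by auto
  have a: "card (M \<inter> K) * ?a = card (M \<inter> N)" using card_mult_index[OF MKs MNs MKN] .
  have b: "card (M \<inter> N) * ?b = card M" using card_mult_index[OF MNs M] by blast
  \<comment> \<open>Second isomorphism theorem in terms of orders: |M \<inter> N : M \<inter> K| =
    |(M \<inter> N) K : K|, and this divides |N : K|.\<close>
  have pa: "pi_number (compl_primes \<tau>) ?a"
  proof (rule pi_number_dvd[OF _ NK])
    have sub: "subgroup ((M \<inter> N) <#> K) G" using set_mult_normal_subgroup[OF MNs K] .
    have "(M \<inter> N) <#> K \<subseteq> N" using KN NS by (auto simp: set_mult_def intro: subgroup.m_closed)
    then have "card ((M \<inter> N) <#> K) dvd card N" using card_subgroup_dvd[OF sub NS] by blast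
    moreover have "card ((M \<inter> N) <#> K) * card (M \<inter> K) = card (M \<inter> N) * card K"
    proof -
      have "M \<inter> N \<inter> K = M \<inter> K" using KN by auto
      then show ?thesis using card_set_mult[OF MNs KS fin] by simp
    qed
    then have "card ((M \<inter> N) <#> K) * card (M \<inter> K) = ?a * card K * card (M \<inter> K)"
      using a by (metis mult.commute mult.left_commute)
    then have "card ((M \<inter> N) <#> K) = ?a * card K" using pos[OF MKs] by simp
    moreover have "card K * (card N div card K) = card N" using card_mult_index[OF KS NS KN] .
    ultimately show "?a dvd card N div card K"
      using pos[OF KS] by (metis dvd_times_right_cancel_iff mult.commute neq0_conv)
  qed
  let ?M = "G\<lparr>carrier := M\<rparr>"
  interpret M: group ?M using subgroup.subgroup_is_group[OF M is_group] .
  have finM: "finite (carrier ?M)" using finite_subgroup[OF M fin] by simp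
  have MK: "M \<inter> K \<lhd> ?M" using normal_Int_subgroup[OF M K] by (simp add: Int_commute)
  have MN': "M \<inter> N \<lhd> ?M" using normal_Int_subgroup[OF M N] by (simp add: Int_commute)
  let ?f = "\<lambda>x. (M \<inter> K) #>\<^bsub>?M\<^esub> x" and ?Q = "?M Mod (M \<inter> K)"
  interpret f: group_hom ?M ?Q ?f using M.quotient_hom(1)[OF MK] .
  note surj = M.quotient_hom(2)[OF MK] and ker = M.quotient_hom(3)[OF MK]
  have cpre: "card {x \<in> M. ?f x \<in> B} = card (M \<inter> K) * card B" if "B \<subseteq> carrier ?Q" for B
  proof -
    have "{x \<in> carrier ?M. ?f x \<in> B} = {x \<in> M. ?f x \<in> B}" by simp
    then show ?thesis using f.card_preimage[OF finM, of B] that unfolding ker surj by metis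
  qed
  have finQ: "finite (carrier ?Q)" using finM surj by (metis finite_imageI)
  let ?N = "?f ` (M \<inter> N)"
  have Nn: "?N \<lhd> ?Q" using normal.surj_hom_normal_subgroup[OF MN' f.group_hom_axioms surj] .
  have "{x \<in> M. ?f x \<in> ?N} = M \<inter> N"
  proof (intro equalityI subsetI)
    fix x assume "x \<in> {x \<in> M. ?f x \<in> ?N}"
    then obtain n where n: "x \<in> M" "n \<in> M \<inter> N" "?f x = ?f n" by auto
    then have "x \<otimes>\<^bsub>?M\<^esub> inv\<^bsub>?M\<^esub> n \<in> M \<inter> K"
      using M.rcos_eq_iff[OF normal_imp_subgroup[OF MK], of x n] by simp
    then have "x \<otimes> inv n \<in> N" using n m_inv_consistent[OF M, of n] KN by auto
    then have "x \<otimes> inv n \<otimes> n \<in> N" using n subgroup.m_closed[OF NS] by blast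
    moreover have "x \<in> carrier G" "n \<in> carrier G" using n M subgroup.mem_carrier by auto
    ultimately show "x \<in> M \<inter> N" using n(1) by (simp add: word_simps)
  qed auto
  moreover have "?N \<subseteq> carrier ?Q" using normal_imp_subgroup[OF Nn] by (rule subgroup.subset)
  ultimately have "card (M \<inter> N) = card (M \<inter> K) * card ?N" using cpre[of ?N] by argo
  then have cN: "card ?N = ?a" using a pos[OF MKs] by (metis mult_cancel1 neq0_conv)
  have "{x \<in> M. ?f x \<in> carrier ?Q} = M" using surj by fastforce
  then have "card M = card (M \<inter> K) * card (carrier ?Q)" using cpre[OF subset_refl] by argo
  then have "card (M \<inter> K) * (?a * ?b) = card (M \<inter> K) * card (carrier ?Q)"
    using a b by (metis mult.assoc)
  then have cQ: "card (carrier ?Q) = ?a * ?b" using pos[OF MKs] by (metis mult_cancel1 neq0_conv)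
  have ix: "card (rcosets\<^bsub>?Q\<^esub> ?N) = ?b"
    using f.H.card_rcosets_mult[OF normal_imp_subgroup[OF Nn] finQ] pi_number_pos[OF pa]
    unfolding cN cQ by simp
  have "coprime (card ?N) (card (rcosets\<^bsub>?Q\<^esub> ?N))"
    unfolding ix cN using pi_number_coprime[OF MN pa] by (simp add: coprime_commute)
  then obtain C where C: "subgroup C ?Q" "card C * card ?N = order ?Q"
    using schur_zassenhaus[OF f.H.is_group finQ Nn] by blast
  then have cC: "card C = ?b" using pi_number_pos[OF pa] unfolding order_def cN cQ by simp
  let ?C = "{x \<in> M. ?f x \<in> C}"
  have "subgroup ?C ?M" using f.subgroup_preimage[OF C(1)] by simp
  then have Cs: "subgroup ?C G" using incl_subgroup[OF M] by blast
  have cC2: "card ?C = card (M \<inter> K) * ?b" using cpre[OF subgroup.subset[OF C(1)]] cC by simp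
  have CK: "?C \<inter> K = M \<inter> K"
  proof
    show "M \<inter> K \<subseteq> ?C \<inter> K"
    proof
      fix x assume x: "x \<in> M \<inter> K"
      then have "x \<in> kernel ?M ?Q ?f" using ker by simp
      then show "x \<in> ?C \<inter> K" using x subgroup.one_closed[OF C(1)] unfolding kernel_def by simp
    qed
  qed auto
  have "card M = card ?C * ?a" using a b unfolding cC2 by (metis mult.assoc mult.commute)
  then have "card M div card ?C = ?a" using pos[OF Cs] by simp
  moreover have "card ?C div card (?C \<inter> K) = ?b" unfolding CK cC2 using pos[OF MKs] by simp
  ultimately show ?thesis using pa MN Cs by (intro exI[of _ ?C]) auto
qed

text \<open>Descend along the series from the top. A \<tau>-factor leaves the current subgroup H
  unchanged, a \<tau>'-factor is cut off by \<open>hall_step\<close>, and at the trivial bottom term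
  |H| itself is a \<tau>-number. M is arbitrary because Hall subgroups of a factor group are
  obtained from those of preimages.\<close>

theorem pi_separable_hall:
  assumes fin: "finite (carrier G)" and sep: "pi_separable \<pi> G" and primes: "\<pi> \<subseteq> {p. Factorial_Ring.prime p}"
    and \<tau>: "\<tau> = \<pi> \<or> \<tau> = compl_primes \<pi>" and M: "subgroup M G"
  shows "\<exists>H. subgroup H G \<and> H \<subseteq> M \<and> pi_number \<tau> (card H) \<and> pi_number (compl_primes \<tau>) (card M div card H)"
proof -
  obtain N k where N': "N 0 = {\<one>} \<and> N k = carrier G \<and> (\<forall>i\<le>k. N i \<lhd> G) \<and>
      (\<forall>i<k. N i \<subseteq> N (Suc i) \<and> (pi_group \<pi> (G\<lparr>carrier := N (Suc i)\<rparr> Mod N i) \<or>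
            pi_group (compl_primes \<pi>) (G\<lparr>carrier := N (Suc i)\<rparr> Mod N i)))"
    using sep unfolding pi_separable_def by (elim exE) (rule that)
  have N: "N 0 = {\<one>}" "N k = carrier G" "\<And>i. i \<le> k \<Longrightarrow> N i \<lhd> G"
      "\<And>i. i < k \<Longrightarrow> N i \<subseteq> N (Suc i)"
      "\<And>i. i < k \<Longrightarrow> pi_group \<pi> (G\<lparr>carrier := N (Suc i)\<rparr> Mod N i) \<or>
            pi_group (compl_primes \<pi>) (G\<lparr>carrier := N (Suc i)\<rparr> Mod N i)"
    using N' by (simp_all only: simp_thms)
  have NS: "subgroup (N i) G" if "i \<le> k" for i using N(3)[OF that] normal_imp_subgroup by blast
  have factor: "pi_number \<tau> (card (N (Suc i)) div card (N i)) \<or>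
      pi_number (compl_primes \<tau>) (card (N (Suc i)) div card (N i))" if i: "i < k" for i
  proof -
    let ?S = "G\<lparr>carrier := N (Suc i)\<rparr>"
    have S: "subgroup (N (Suc i)) G" using NS i by simp
    interpret S: group ?S using subgroup.subgroup_is_group[OF S is_group] .
    have "N i \<lhd> ?S" using normal_restrict_supergroup[OF S N(3) N(4)] i by simp
    then have "pi_group \<sigma> (?S Mod N i) \<longleftrightarrow> pi_number \<sigma> (card (N (Suc i)) div card (N i))" for \<sigma>
      using S.pi_group_factor_iff finite_subgroup[OF S fin] by simp
    then show ?thesis using N(5)[OF i] \<tau> compl_compl_primes[OF primes] by auto
  qed
  \<comment> \<open>The invariant of the descent: what M has lost so far is a \<tau>'-number, and
    what H has above \<open>N (k - j)\<close> is a \<tau>-number.\<close>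
  have ex: "\<exists>H. subgroup H G \<and> H \<subseteq> M \<and> pi_number (compl_primes \<tau>) (card M div card H) \<and>
      pi_number \<tau> (card H div card (H \<inter> N (k - j)))" if "j \<le> k" for j
    using that
  proof (induction j)
    case 0
    have "M \<inter> carrier G = M" using subgroup.subset[OF M] by auto
    then show ?case using M N(2) card_subgroup_pos[OF M fin] by (intro exI[of _ M]) simp
  next
    case (Suc j)
    then obtain H where H: "subgroup H G" "H \<subseteq> M" "pi_number (compl_primes \<tau>) (card M div card H)"
      "pi_number \<tau> (card H div card (H \<inter> N (k - j)))" by auto
    define i where "i = k - Suc j"
    have i: "i < k" "k - j = Suc i" "i \<le> k" "Suc i \<le> k" using Suc.prems by (auto simp: i_def)
    note HN = subgroups_Inter_pair[OF H(1) NS]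
    have Nsub: "H \<inter> N i \<subseteq> H \<inter> N (Suc i)" using N(4)[OF i(1)] by blast
    from factor[OF i(1)] show ?case
    proof
      assume \<tau>i: "pi_number \<tau> (card (N (Suc i)) div card (N i))"
      have "card (H \<inter> N (Suc i)) div card (H \<inter> N i) dvd card (N (Suc i)) div card (N i)"
      proof -
        have sub: "subgroup ((H \<inter> N (Suc i)) <#> N i) G"
          using set_mult_normal_subgroup[OF HN[OF i(4)] N(3)[OF i(3)]] .
        have "(H \<inter> N (Suc i)) <#> N i \<subseteq> N (Suc i)"
          using N(4)[OF i(1)] NS[OF i(4)] by (auto simp: set_mult_def intro: subgroup.m_closed)
        then have "card ((H \<inter> N (Suc i)) <#> N i) dvd card (N (Suc i))"
          using card_subgroup_dvd[OF sub NS[OF i(4)]] by blast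
        moreover have "H \<inter> N (Suc i) \<inter> N i = H \<inter> N i" using N(4)[OF i(1)] by auto
        then have "card ((H \<inter> N (Suc i)) <#> N i) * card (H \<inter> N i) = card (H \<inter> N (Suc i)) * card (N i)"
          using card_set_mult[OF HN[OF i(4)] NS[OF i(3)] fin] by simp
        then have "card ((H \<inter> N (Suc i)) <#> N i) * card (H \<inter> N i)
            = (card (H \<inter> N (Suc i)) div card (H \<inter> N i)) * card (N i) * card (H \<inter> N i)"
          using card_mult_index[OF HN[OF i(3)] HN[OF i(4)] Nsub] by (metis mult.commute mult.left_commute)
        then have "card ((H \<inter> N (Suc i)) <#> N i)
            = (card (H \<inter> N (Suc i)) div card (H \<inter> N i)) * card (N i)"
          using card_subgroup_pos[OF HN[OF i(3)] fin] by simp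
        moreover have "card (N i) * (card (N (Suc i)) div card (N i)) = card (N (Suc i))"
          using card_mult_index[OF NS[OF i(3)] NS[OF i(4)] N(4)[OF i(1)]] .
        ultimately show ?thesis
          using card_subgroup_pos[OF NS[OF i(3)] fin] by (metis dvd_times_right_cancel_iff mult.commute neq0_conv)
      qed
      then have "pi_number \<tau> (card (H \<inter> N (Suc i)) div card (H \<inter> N i))" using pi_number_dvd \<tau>i by blast
      then have "pi_number \<tau> ((card (H \<inter> N (Suc i)) div card (H \<inter> N i)) * (card H div card (H \<inter> N (Suc i))))"
        using H(4) i(2) by (simp add: pi_number_mult)
      moreover have "(card (H \<inter> N (Suc i)) div card (H \<inter> N i)) * (card H div card (H \<inter> N (Suc i)))
          = card H div card (H \<inter> N i)"
        using card_mult_index[OF HN[OF i(3)] HN[OF i(4)] Nsub] card_mult_index[OF HN[OF i(4)] H(1)]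
          card_mult_index[OF HN[OF i(3)] H(1)] card_subgroup_pos[OF HN[OF i(3)] fin]
        by (metis Int_lower1 mult.assoc mult_cancel1 neq0_conv)
      ultimately show ?case using H by (auto simp: i_def)
    next
      assume \<tau>i: "pi_number (compl_primes \<tau>) (card (N (Suc i)) div card (N i))"
      obtain C where C: "subgroup C G" "C \<subseteq> H" "pi_number (compl_primes \<tau>) (card H div card C)"
          "pi_number \<tau> (card C div card (C \<inter> N i))"
        using hall_step[OF fin H(1) N(3)[OF i(4)] N(3)[OF i(3)] N(4)[OF i(1)] \<tau>i] H(4) i(2) by auto
      have "card M div card C = (card M div card H) * (card H div card C)"
        using card_mult_index[OF C(1) H(1) C(2)] card_mult_index[OF H(1) M H(2)]
          card_mult_index[OF C(1) M] C(2) H(2) card_subgroup_pos[OF C(1) fin]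
        by (metis mult.assoc mult.commute mult_cancel1 neq0_conv order_trans)
      then have "pi_number (compl_primes \<tau>) (card M div card C)" using C(3) H(3) by (simp add: pi_number_mult)
      then show ?case using C H(2) by (auto simp: i_def)
    qed
  qed
  obtain H where H: "subgroup H G" "H \<subseteq> M" "pi_number (compl_primes \<tau>) (card M div card H)"
      "pi_number \<tau> (card H div card (H \<inter> N 0))" using ex[of k] by auto
  have "H \<inter> N 0 = {\<one>}" using N(1) subgroup.one_closed[OF H(1)] by auto
  then show ?thesis using H by auto
qed

end

section \<open>Permuting subgroups\<close>

lemma mem_set_mult: "x \<in> A <#>\<^bsub>G\<^esub> B \<longleftrightarrow> (\<exists>a\<in>A. \<exists>b\<in>B. x = a \<otimes>\<^bsub>G\<^esub> b)"
  by (auto simp: set_mult_def)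

lemma set_multI: "a \<in> A \<Longrightarrow> b \<in> B \<Longrightarrow> a \<otimes>\<^bsub>G\<^esub> b \<in> A <#>\<^bsub>G\<^esub> B"
  by (auto simp: set_mult_def)

lemma set_multE:
  assumes "x \<in> A <#>\<^bsub>G\<^esub> B"
  obtains a b where "a \<in> A" "b \<in> B" "x = a \<otimes>\<^bsub>G\<^esub> b"
  using assms unfolding mem_set_mult by blast

text \<open>X is an arbitrary set so that the property can be checked on generators. If X is a
  subgroup, the inclusion amounts to equality of A with its conjugates.\<close>

definition normalizes :: "('a, 'b) monoid_scheme \<Rightarrow> 'a set \<Rightarrow> 'a set \<Rightarrow> bool" where
  "normalizes G X A \<longleftrightarrow> (\<forall>x\<in>X. \<forall>a\<in>A. x \<otimes>\<^bsub>G\<^esub> a \<otimes>\<^bsub>G\<^esub> inv\<^bsub>G\<^esub> x \<in> A)"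

lemma normalizesD: "normalizes G X A \<Longrightarrow> x \<in> X \<Longrightarrow> a \<in> A \<Longrightarrow> x \<otimes>\<^bsub>G\<^esub> a \<otimes>\<^bsub>G\<^esub> inv\<^bsub>G\<^esub> x \<in> A"
  by (auto simp: normalizes_def)

lemma normalizesI: "(\<And>x a. x \<in> X \<Longrightarrow> a \<in> A \<Longrightarrow> x \<otimes>\<^bsub>G\<^esub> a \<otimes>\<^bsub>G\<^esub> inv\<^bsub>G\<^esub> x \<in> A) \<Longrightarrow> normalizes G X A"
  by (auto simp: normalizes_def)

lemma normalizes_mono: "normalizes G X A \<Longrightarrow> Y \<subseteq> X \<Longrightarrow> normalizes G Y A"
  by (auto simp: normalizes_def)

context group
begin

lemma normalizesD_inv:
  assumes "normalizes G X A" "subgroup X G" "x \<in> X" "a \<in> A"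
  shows "inv x \<otimes> a \<otimes> x \<in> A"
  using normalizesD[OF assms(1) subgroup.m_inv_closed[OF assms(2,3)] assms(4)]
    subgroup.mem_carrier[OF assms(2,3)] by simp

lemma set_mult_subset_subgroup:
  assumes "subgroup M G" "A \<subseteq> M" "B \<subseteq> M"
  shows "A <#> B \<subseteq> M"
  using assms by (auto simp: set_mult_def subset_iff intro: subgroup.m_closed)

lemma subset_set_mult_left: "subgroup B G \<Longrightarrow> A \<subseteq> carrier G \<Longrightarrow> A \<subseteq> A <#> B"
proof
  fix x assume *: "subgroup B G" "A \<subseteq> carrier G" "x \<in> A"
  have "x \<otimes> \<one> \<in> A <#> B" by (rule set_multI[OF *(3) subgroup.one_closed[OF *(1)]])
  moreover have "x \<in> carrier G" using * by blast
  ultimately show "x \<in> A <#> B" by simp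
qed

lemma subset_set_mult_right: "subgroup A G \<Longrightarrow> B \<subseteq> carrier G \<Longrightarrow> B \<subseteq> A <#> B"
proof
  fix x assume *: "subgroup A G" "B \<subseteq> carrier G" "x \<in> B"
  have "\<one> \<otimes> x \<in> A <#> B" by (rule set_multI[OF subgroup.one_closed[OF *(1)] *(3)])
  moreover have "x \<in> carrier G" using * by blast
  ultimately show "x \<in> A <#> B" by simp
qed

text \<open>Inversion exchanges AB and BA, so one inclusion gives the other.\<close>

lemma permutable_if_subset:
  assumes A: "subgroup A G" and B: "subgroup B G" and sub: "A <#> B \<subseteq> B <#> A"
  shows "A <#> B = B <#> A"
proof
  show "B <#> A \<subseteq> A <#> B"
  proof
    fix x assume "x \<in> B <#> A"
    then obtain b a where ba: "b \<in> B" "a \<in> A" "x = b \<otimes> a" by (auto simp: mem_set_mult)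
    have carr: "b \<in> carrier G" "a \<in> carrier G" using subgroup.mem_carrier[OF B ba(1)] subgroup.mem_carrier[OF A ba(2)] by auto
    have "inv a \<otimes> inv b \<in> A <#> B"
      by (rule set_multI[OF subgroup.m_inv_closed[OF A ba(2)] subgroup.m_inv_closed[OF B ba(1)]])
    then have "inv a \<otimes> inv b \<in> B <#> A" using sub by blast
    then obtain b' a' where ba': "b' \<in> B" "a' \<in> A" "inv a \<otimes> inv b = b' \<otimes> a'" unfolding mem_set_mult by blast
    have carr': "b' \<in> carrier G" "a' \<in> carrier G" using subgroup.mem_carrier[OF B ba'(1)] subgroup.mem_carrier[OF A ba'(2)] by auto
    have "x = inv (inv a \<otimes> inv b)" using ba carr by (simp add: word_simps)
    also have "\<dots> = inv a' \<otimes> inv b'" using ba' carr' by (simp add: inv_mult_group)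
    also have "\<dots> \<in> A <#> B"
      by (rule set_multI[OF subgroup.m_inv_closed[OF A ba'(2)] subgroup.m_inv_closed[OF B ba'(1)]])
    finally show "x \<in> A <#> B" .
  qed
qed (rule sub)

lemma subgroup_set_mult:
  assumes A: "subgroup A G" and B: "subgroup B G" and perm: "A <#> B = B <#> A"
  shows "subgroup (A <#> B) G"
proof -
  interpret A: subgroup A G by fact
  interpret B: subgroup B G by fact
  show ?thesis
  proof
    show "A <#> B \<subseteq> carrier G" by (auto simp: set_mult_def)
    show "\<one> \<in> A <#> B" using subset_set_mult_left[OF B A.subset] A.one_closed by blast
    fix x y assume "x \<in> A <#> B"
    then obtain a b where ab: "a \<in> A" "b \<in> B" "x = a \<otimes> b" by (auto simp: mem_set_mult)
    have "inv b \<otimes> inv a \<in> A <#> B" unfolding perm using ab by (intro set_multI) auto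
    then show "inv x \<in> A <#> B" using ab by (simp add: inv_mult_group)
    assume "y \<in> A <#> B"
    then obtain c d where cd: "c \<in> A" "d \<in> B" "y = c \<otimes> d" by (auto simp: mem_set_mult)
    have "b \<otimes> c \<in> A <#> B" unfolding perm using ab cd by (intro set_multI) auto
    then obtain c' b' where bc: "c' \<in> A" "b' \<in> B" "b \<otimes> c = c' \<otimes> b'" by (auto simp: mem_set_mult)
    have "x \<otimes> y = a \<otimes> (b \<otimes> c) \<otimes> d" using ab cd by (simp add: m_assoc)
    also have "\<dots> = (a \<otimes> c') \<otimes> (b' \<otimes> d)" unfolding bc(3) using ab bc(1,2) cd by (simp add: m_assoc)
    finally show "x \<otimes> y \<in> A <#> B" using ab bc(1,2) cd by (simp add: set_multI)
  qed
qed

lemma normalizes_permutable: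
  assumes A: "subgroup A G" and B: "subgroup B G" and nrm: "normalizes G A B"
  shows "A <#> B = B <#> A"
proof (rule permutable_if_subset[OF A B])
  show "A <#> B \<subseteq> B <#> A"
  proof
    fix x assume "x \<in> A <#> B"
    then obtain a b where ab: "a \<in> A" "b \<in> B" "x = a \<otimes> b" by (auto simp: mem_set_mult)
    then have "x = (a \<otimes> b \<otimes> inv a) \<otimes> a"
      using subgroup.mem_carrier[OF A] subgroup.mem_carrier[OF B] by (simp add: word_simps)
    then show "x \<in> B <#> A" using set_multI[OF normalizesD[OF nrm ab(1,2)] ab(1)] by simp
  qed
qed

lemma normal_iff_normalizes: "N \<lhd> G \<longleftrightarrow> subgroup N G \<and> normalizes G (carrier G) N"
  by (auto simp: normal_inv_iff normalizes_def)

lemma normalizes_generate_left: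
  assumes A: "subgroup A G" and fin: "finite (carrier G)" and X: "X \<subseteq> carrier G" and nrm: "normalizes G X A"
  shows "normalizes G (generate G X) A"
proof -
  have "generate G X \<subseteq> {g \<in> carrier G. \<forall>x\<in>A. g \<otimes> x \<otimes> inv g \<in> A}"
  proof (rule generate_subgroup_incl[OF _ subgroup_normalizer_finite[OF A fin]])
    show "X \<subseteq> {g \<in> carrier G. \<forall>x\<in>A. g \<otimes> x \<otimes> inv g \<in> A}"
      using nrm X unfolding normalizes_def by blast
  qed
  then show ?thesis by (auto simp: normalizes_def)
qed

lemma normalizes_generate_right:
  assumes X: "X \<subseteq> carrier G" and N: "N \<subseteq> carrier G"
    and conj: "\<And>n x. n \<in> N \<Longrightarrow> x \<in> X \<Longrightarrow> n \<otimes> x \<otimes> inv n \<in> generate G X"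
  shows "normalizes G N (generate G X)"
proof (rule normalizesI)
  fix n a assume n: "n \<in> N" and a: "a \<in> generate G X"
  have nc: "n \<in> carrier G" using n N by blast
  note S = generate_is_subgroup[OF X]
  from a show "n \<otimes> a \<otimes> inv n \<in> generate G X"
  proof (induction a rule: generate.induct)
    case one
    then show ?case using nc generate.one by simp
  next
    case (incl h)
    then show ?case using conj n by blast
  next
    case (inv h)
    have "inv (n \<otimes> h \<otimes> inv n) \<in> generate G X" using conj[OF n inv] subgroup.m_inv_closed[OF S] by blast
    moreover have "h \<in> carrier G" using inv X by blast
    ultimately show ?case using nc by (simp add: word_simps)
  next
    case (eng h1 h2)
    have "h1 \<in> carrier G" "h2 \<in> carrier G" using eng generate_in_carrier[OF X] by auto
    then have "n \<otimes> (h1 \<otimes> h2) \<otimes> inv n = (n \<otimes> h1 \<otimes> inv n) \<otimes> (n \<otimes> h2 \<otimes> inv n)"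
      using nc by (simp add: word_simps)
    then show ?case using eng subgroup.m_closed[OF S] by simp
  qed
qed

definition conjg :: "'a \<Rightarrow> 'a set \<Rightarrow> 'a set" where
  "conjg g A = (\<lambda>a. g \<otimes> a \<otimes> inv g) ` A"

lemma conjg_subgroup:
  assumes A: "subgroup A G" and g: "g \<in> carrier G"
  shows "subgroup (conjg g A) G"
proof -
  interpret A: subgroup A G by fact
  show ?thesis
  proof
    show "conjg g A \<subseteq> carrier G" using g by (auto simp: conjg_def)
    have "g \<otimes> \<one> \<otimes> inv g = \<one>" using g by simp
    then show "\<one> \<in> conjg g A" unfolding conjg_def using A.one_closed by (metis image_eqI)
    fix x y assume "x \<in> conjg g A"
    then obtain a where a: "a \<in> A" "x = g \<otimes> a \<otimes> inv g" by (auto simp: conjg_def)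
    have "inv x = g \<otimes> inv a \<otimes> inv g" using a g by (simp add: word_simps)
    then show "inv x \<in> conjg g A" unfolding conjg_def using a by blast
    assume "y \<in> conjg g A"
    then obtain b where b: "b \<in> A" "y = g \<otimes> b \<otimes> inv g" by (auto simp: conjg_def)
    have "x \<otimes> y = g \<otimes> (a \<otimes> b) \<otimes> inv g" using a b g by (simp add: word_simps)
    then show "x \<otimes> y \<in> conjg g A" unfolding conjg_def using a b by blast
  qed
qed

lemma conjg_card:
  assumes "A \<subseteq> carrier G" "g \<in> carrier G"
  shows "card (conjg g A) = card A"
  unfolding conjg_def by (rule card_image) (use assms in \<open>auto simp: inj_on_def subset_iff\<close>)

end

text \<open>As a is coprime to d and c to b, a and c divide each other. This separates the \<pi>-
  and the \<pi>'-part in every comparison of orders below.\<close>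

lemma pi_factor_unique:
  assumes "pi_number \<tau> a" "pi_number (compl_primes \<tau>) b" "pi_number \<tau> c" "pi_number (compl_primes \<tau>) d"
    and "a * b = c * d"
  shows "a = c" "b = d"
proof -
  have "coprime a d" "coprime c b" using assms pi_number_coprime by blast+
  then have "a dvd c" "c dvd a"
    using assms(5) by (metis coprime_dvd_mult_left_iff dvd_triv_left)+
  then show "a = c" by (rule dvd_antisym)
  then show "b = d" using assms(5) pi_number_pos[OF assms(1)] by simp
qed

text \<open>What separability contributes, recorded as an axiom: Hall subgroups for both sets of
  primes in every subgroup. In this form the setting is closed under exchanging \<pi> and \<pi>'
  (\<open>dual\<close>) and under factor groups (\<open>quotient_hall_full\<close>).\<close>

locale hall_full = group G for G :: "('a, 'b) monoid_scheme" (structure) +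
  fixes \<pi> :: "nat set"
  assumes fin: "finite (carrier G)" and primes: "\<pi> \<subseteq> {p. Factorial_Ring.prime p}"
    and hall_ex: "\<And>M \<tau>. subgroup M G \<Longrightarrow> \<tau> = \<pi> \<or> \<tau> = compl_primes \<pi> \<Longrightarrow>
      \<exists>H. subgroup H G \<and> H \<subseteq> M \<and> pi_number \<tau> (card H) \<and> pi_number (compl_primes \<tau>) (card M div card H)"
begin

abbreviation "\<pi>' \<equiv> compl_primes \<pi>"
abbreviation "hall \<equiv> hall_subgroup \<pi> G"
abbreviation "hall' \<equiv> hall_subgroup \<pi>' G"
abbreviation "sp \<equiv> sigma_permutable \<pi> G"

lemma cc [simp]: "compl_primes \<pi>' = \<pi>" using compl_compl_primes[OF primes] .

text \<open>Turns each result of the locale into its mirror image. Complementation is an involution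
  on sets of primes, hence the assumption \<open>primes\<close>.\<close>

lemma dual: "hall_full G \<pi>'"
proof
  show "\<pi>' \<subseteq> {p. Factorial_Ring.prime p}" by (auto simp: compl_primes_def)
  fix M \<tau> assume M: "subgroup M G" and "\<tau> = \<pi>' \<or> \<tau> = compl_primes \<pi>'"
  then have "\<tau> = \<pi> \<or> \<tau> = \<pi>'" by auto
  then show "\<exists>H. subgroup H G \<and> H \<subseteq> M \<and> pi_number \<tau> (card H) \<and> pi_number (compl_primes \<tau>) (card M div card H)"
    by (rule hall_ex[OF M])
qed (rule fin)

lemma sp_dual: "sigma_permutable \<pi>' G = sp"
  by (auto simp: sigma_permutable_def fun_eq_iff)

lemma finsub: "subgroup A G \<Longrightarrow> finite A" using finite_subgroup fin by blast

lemma cpos: "subgroup A G \<Longrightarrow> card A > 0" using card_subgroup_pos fin by blast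

lemma hallD: 
  assumes "hall H"
  shows "subgroup H G" "pi_number \<pi> (card H)" "pi_number \<pi>' (card (carrier G) div card H)"
  using assms hall_subgroup_iff[OF fin] by auto

lemma hallD': 
  assumes "hall' H"
  shows "subgroup H G" "pi_number \<pi>' (card H)" "pi_number \<pi> (card (carrier G) div card H)"
  using assms hall_subgroup_iff[OF fin] by auto

lemma hall_exists: obtains H where "hall H"
  using hall_ex[OF subgroup_self, of \<pi>] hall_subgroup_iff[OF fin] by auto

lemma hall'_exists: obtains H where "hall' H"
  using hall_ex[OF subgroup_self, of \<pi>'] hall_subgroup_iff[OF fin] by auto

lemma hall_conjg: "hall H \<Longrightarrow> g \<in> carrier G \<Longrightarrow> hall (conjg g H)"
  using hall_subgroup_iff[OF fin] conjg_subgroup conjg_card subgroup.subset by metis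

lemma hall_card_mult:
  assumes "hall H" "hall' K"
  shows "card H * card K = card (carrier G)"
proof -
  have 1: "card H * (card (carrier G) div card H) = card (carrier G)"
    using card_mult_index[OF hallD(1)[OF assms(1)] subgroup_self subgroup.subset[OF hallD(1)[OF assms(1)]]] .
  have 2: "card K * (card (carrier G) div card K) = card (carrier G)"
    using card_mult_index[OF hallD'(1)[OF assms(2)] subgroup_self subgroup.subset[OF hallD'(1)[OF assms(2)]]] .
  have "card (carrier G) div card H = card K"
    using pi_factor_unique(2)[OF hallD(2,3)[OF assms(1)] hallD'(3,2)[OF assms(2)]] 1 2 by (simp add: mult.commute)
  then show ?thesis using 1 by simp
qed

lemma pi_subgroups_Int:
  assumes "subgroup A G" "subgroup B G" "pi_number \<pi> (card A)" "pi_number \<pi>' (card B)"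
  shows "A \<inter> B = {\<one>}"
proof -
  have s: "subgroup (A \<inter> B) G" using subgroups_Inter_pair assms by blast
  have "card (A \<inter> B) = 1"
    using pi_number_eq_1[OF pi_number_dvd[OF card_subgroup_dvd[OF s assms(1)] assms(3)]
      pi_number_dvd[OF card_subgroup_dvd[OF s assms(2)] assms(4)]] by blast
  then show ?thesis using subgroup.one_closed[OF s] by (metis card_1_singletonE singletonD)
qed

lemma hall_set_mult:
  assumes "hall H" "hall' K"
  shows "H <#> K = carrier G"
proof -
  have "H \<inter> K = {\<one>}" using pi_subgroups_Int hallD[OF assms(1)] hallD'[OF assms(2)] by blast
  then have "card (H <#> K) = card (carrier G)"
    using card_set_mult[OF hallD(1)[OF assms(1)] hallD'(1)[OF assms(2)] fin] hall_card_mult[OF assms] by simp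
  moreover have "H <#> K \<subseteq> carrier G"
    using set_mult_closed subgroup.subset hallD(1)[OF assms(1)] hallD'(1)[OF assms(2)] by metis
  ultimately show ?thesis using fin by (metis card_subset_eq)
qed

lemma spD: assumes "sp A" shows "subgroup A G" using assms by (simp add: sigma_permutable_def)

lemma sp_perm: "sp A \<Longrightarrow> hall H \<Longrightarrow> A <#> H = H <#> A"
  by (auto simp: sigma_permutable_def permutable_def)

lemma sp_perm': "sp A \<Longrightarrow> hall' H \<Longrightarrow> A <#> H = H <#> A"
  by (auto simp: sigma_permutable_def permutable_def)

lemma spI:
  assumes "subgroup A G" "\<And>H. hall H \<Longrightarrow> A <#> H = H <#> A" "\<And>K. hall' K \<Longrightarrow> A <#> K = K <#> A"
  shows "sp A"
  using assms by (auto simp: sigma_permutable_def permutable_def)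

text \<open>AH is a subgroup because A permutes with H, so |A : A \<inter> H| = |AH : H| divides the
  \<pi>'-number |G : H|. Hence A \<inter> H is a Hall \<pi>-subgroup of A.\<close>

lemma sp_Int_index:
  assumes A: "sp A" and H: "hall H"
  shows "pi_number \<pi>' (card A div card (A \<inter> H))" "card (A <#> H) = (card A div card (A \<inter> H)) * card H"
proof -
  note As = spD[OF A] and Hs = hallD(1)[OF H]
  have AH: "subgroup (A <#> H) G" using subgroup_set_mult[OF As Hs sp_perm[OF A H]] .
  have I: "subgroup (A \<inter> H) G" using subgroups_Inter_pair[OF As Hs] .
  have i: "card (A \<inter> H) * (card A div card (A \<inter> H)) = card A" using card_mult_index[OF I As] by blast
  have "card (A \<inter> H) * card (A <#> H) = card (A \<inter> H) * ((card A div card (A \<inter> H)) * card H)"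
    using card_set_mult[OF As Hs fin] i by (metis mult.assoc mult.commute)
  then show c: "card (A <#> H) = (card A div card (A \<inter> H)) * card H" using cpos[OF I] by simp
  have "card (A <#> H) dvd card (carrier G)"
    using card_subgroup_dvd[OF AH subgroup_self] subgroup.subset[OF AH] by blast
  also have "card (carrier G) = (card (carrier G) div card H) * card H"
    using card_mult_index[OF Hs subgroup_self subgroup.subset[OF Hs]] by (metis mult.commute)
  finally have "(card A div card (A \<inter> H)) dvd card (carrier G) div card H"
    unfolding c using cpos[OF Hs] by simp
  then show "pi_number \<pi>' (card A div card (A \<inter> H))" using pi_number_dvd hallD(3)[OF H] by blast
qed

end

text \<open>A \<inter> H carries the whole \<pi>-part of |A| and A \<inter> K the whole \<pi>'-part,
  with H and K chosen independently of each other. They meet trivially, so both products fill A by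
  counting.\<close>

lemma (in hall_full) sp_card_mult:
  assumes A: "sp A" and H: "hall H" and K: "hall' K"
  shows "card A = card (A \<inter> H) * card (A \<inter> K)" "A = (A \<inter> H) <#> (A \<inter> K)" "A = (A \<inter> K) <#> (A \<inter> H)"
proof -
  interpret dual: hall_full G \<pi>' by (rule dual)
  note As = spD[OF A] and Hs = hallD(1)[OF H] and Ks = hallD'(1)[OF K]
  have I: "subgroup (A \<inter> H) G" using subgroups_Inter_pair[OF As Hs] .
  have J: "subgroup (A \<inter> K) G" using subgroups_Inter_pair[OF As Ks] .
  have i: "card (A \<inter> H) * (card A div card (A \<inter> H)) = card A" using card_mult_index[OF I As] by blast
  have j: "card (A \<inter> K) * (card A div card (A \<inter> K)) = card A" using card_mult_index[OF J As] by blast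
  have p: "pi_number \<pi> (card (A \<inter> H))" "pi_number \<pi>' (card (A \<inter> K))"
    using pi_number_dvd[OF card_subgroup_dvd[OF I Hs] hallD(2)[OF H]]
      pi_number_dvd[OF card_subgroup_dvd[OF J Ks] hallD'(2)[OF K]] by blast+
  have "pi_number \<pi> (card A div card (A \<inter> K))"
    using dual.sp_Int_index(1)[of A K] A K by (simp add: sp_dual)
  then have "card (A \<inter> H) = card A div card (A \<inter> K)"
    using pi_factor_unique(1)[OF p(1) sp_Int_index(1)[OF A H] _ p(2)] i j by (metis mult.commute)
  then show c: "card A = card (A \<inter> H) * card (A \<inter> K)" using j by (metis mult.commute)
  have int: "A \<inter> H \<inter> (A \<inter> K) = {\<one>}" using pi_subgroups_Int[OF I J p] .
  have "card ((A \<inter> H) <#> (A \<inter> K)) = card A" using card_set_mult[OF I J fin] c int by simp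
  moreover have "(A \<inter> H) <#> (A \<inter> K) \<subseteq> A" using set_mult_subset_subgroup[OF As] by blast
  ultimately show "A = (A \<inter> H) <#> (A \<inter> K)" using finsub[OF As] card_subset_eq by metis
  have "card ((A \<inter> K) <#> (A \<inter> H)) = card A"
    using card_set_mult[OF J I fin] c int by (simp add: Int_commute mult.commute)
  moreover have "(A \<inter> K) <#> (A \<inter> H) \<subseteq> A" using set_mult_subset_subgroup[OF As] by blast
  ultimately show "A = (A \<inter> K) <#> (A \<inter> H)" using finsub[OF As] card_subset_eq by metis
qed

section \<open>The lattice of \<sigma>-permutable subgroups\<close>

text \<open>\<open>hall_join \<tau> G\<close> is the residual \<open>O\<^bsup>\<tau>'\<^esup>(G)\<close> for the complementary set of primes, see \<open>pi_residual_eq\<close>.\<close>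

definition hall_join :: "nat set \<Rightarrow> ('a, 'b) monoid_scheme \<Rightarrow> 'a set" where
  "hall_join \<tau> G = generate G (\<Union>{H. hall_subgroup \<tau> G H})"

text \<open>All Hall subgroups contribute, since conjugation moves A \<inter> H to the intersection
  with another one. For A = G this is \<open>hall_join\<close>; in general it is not a
  \<tau>-group.\<close>

definition hall_part :: "nat set \<Rightarrow> ('a, 'b) monoid_scheme \<Rightarrow> 'a set \<Rightarrow> 'a set" where
  "hall_part \<tau> G A = generate G (\<Union>{A \<inter> H |H. hall_subgroup \<tau> G H})"

lemma (in group) normal_normalizes: "N \<lhd> G \<Longrightarrow> normalizes G (carrier G) N"
  by (simp add: normal_iff_normalizes)

section \<open>Closure properties of the lattice and the action of the residuals\<close>

context hall_full
begin

abbreviation "Q \<equiv> hall_join \<pi> G"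
abbreviation "P \<equiv> hall_join \<pi>' G"
abbreviation "D \<equiv> P \<inter> Q"

text \<open>Since AH and K together cover G, the order of AH \<inter> K is |AH| |K| / |G| = |A : A
  \<inter> H| = |A \<inter> K|. So enlarging A to AH does not enlarge the intersection with any Hall
  \<pi>'-subgroup.\<close>

lemma sp_hall_Int:
  assumes A: "sp A" and H: "hall H" and K: "hall' K"
  shows "(A <#> H) \<inter> K = A \<inter> K"
proof -
  note As = spD[OF A] and Hs = hallD(1)[OF H] and Ks = hallD'(1)[OF K]
  have AH: "subgroup (A <#> H) G" using subgroup_set_mult[OF As Hs sp_perm[OF A H]] .
  have AHK: "subgroup ((A <#> H) \<inter> K) G" using subgroups_Inter_pair[OF AH Ks] .
  have "H \<subseteq> A <#> H" using subset_set_mult_right[OF As] subgroup.subset[OF Hs] by blast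
  then have "H <#> K \<subseteq> (A <#> H) <#> K" using mono_set_mult by blast
  then have "(A <#> H) <#> K = carrier G"
    using hall_set_mult[OF H K] set_mult_closed[OF subgroup.subset[OF AH] subgroup.subset[OF Ks]] by blast
  then have "card H * card K * card ((A <#> H) \<inter> K) = card (A <#> H) * card K"
    using card_set_mult[OF AH Ks fin] hall_card_mult[OF H K] by simp
  then have "card H * card ((A <#> H) \<inter> K) = card (A <#> H)" using cpos[OF Ks] by simp
  also have "\<dots> = card H * (card A div card (A \<inter> H))" using sp_Int_index(2)[OF A H] by simp
  also have "card A div card (A \<inter> H) = card (A \<inter> K)"
    using sp_card_mult(1)[OF A H K] cpos[OF subgroups_Inter_pair[OF As Hs]] by simp
  finally have "card ((A <#> H) \<inter> K) = card (A \<inter> K)" using cpos[OF Hs] by simp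
  moreover have "A \<inter> K \<subseteq> (A <#> H) \<inter> K" using subset_set_mult_left[OF Hs subgroup.subset[OF As]] by blast
  ultimately show ?thesis using finsub[OF AHK] by (metis card_subset_eq)
qed

text \<open>Write an element of AH \<inter> BH as h k with k in a Hall \<pi>'-subgroup K. Then k
  lies in AH \<inter> K = A \<inter> K and in BH \<inter> K = B \<inter> K, so AH \<inter> BH is
  contained in H (A \<inter> B).\<close>

lemma sp_Int_perm:
  assumes A: "sp A" and B: "sp B" and H: "hall H"
  shows "(A \<inter> B) <#> H = H <#> (A \<inter> B)"
proof -
  note As = spD[OF A] and Bs = spD[OF B] and Hs = hallD(1)[OF H]
  note ABs = subgroups_Inter_pair[OF As Bs]
  obtain K where K: "hall' K" using hall'_exists .
  have AH: "subgroup (A <#> H) G" using subgroup_set_mult[OF As Hs sp_perm[OF A H]] .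
  have BH: "subgroup (B <#> H) G" using subgroup_set_mult[OF Bs Hs sp_perm[OF B H]] .
  let ?M = "(A <#> H) \<inter> (B <#> H)"
  have Ms: "subgroup ?M G" using subgroups_Inter_pair[OF AH BH] .
  have HM: "H \<subseteq> ?M" using subset_set_mult_right[OF As] subset_set_mult_right[OF Bs] subgroup.subset[OF Hs] by blast
  have "A \<subseteq> A <#> H" "B \<subseteq> B <#> H" using subset_set_mult_left[OF Hs] subgroup.subset As Bs by blast+
  then have ABM: "A \<inter> B \<subseteq> ?M" by blast
  have "?M \<subseteq> H <#> (A \<inter> B)"
  proof
    fix x assume x: "x \<in> ?M"
    then have "x \<in> H <#> K" using hall_set_mult[OF H K] subgroup.subset[OF Ms] by blast
    then obtain h k where hk: "h \<in> H" "k \<in> K" "x = h \<otimes> k" unfolding mem_set_mult by blast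
    have "k = inv h \<otimes> x"
      using hk subgroup.mem_carrier[OF Hs hk(1)] subgroup.mem_carrier[OF hallD'(1)[OF K] hk(2)]
      by (simp add: word_simps)
    moreover have "inv h \<in> ?M" using subgroup.m_inv_closed[OF Hs hk(1)] HM by blast
    ultimately have "k \<in> ?M" using subgroup.m_closed[OF Ms] x by metis
    then have "k \<in> A \<inter> B" using sp_hall_Int[OF A H K] sp_hall_Int[OF B H K] hk(2) by blast
    then show "x \<in> H <#> (A \<inter> B)" using hk unfolding mem_set_mult by blast
  qed
  moreover have "(A \<inter> B) <#> H \<subseteq> ?M" using set_mult_subset_subgroup[OF Ms ABM HM] .
  ultimately show ?thesis by (intro permutable_if_subset[OF ABs Hs]) blast
qed

text \<open>An element of H is moved past the generators one at a time. It changes on the way, so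
  the induction keeps it arbitrary.\<close>

lemma generate_perm:
  assumes A: "subgroup A G" and B: "subgroup B G" and H: "subgroup H G"
    and AH: "A <#> H = H <#> A" and BH: "B <#> H = H <#> B"
  shows "generate G (A \<union> B) <#> H = H <#> generate G (A \<union> B)"
proof -
  let ?J = "generate G (A \<union> B)"
  have sub: "A \<union> B \<subseteq> carrier G" using A B subgroup.subset by blast
  note J = generate_is_subgroup[OF sub]
  have inc: "A \<union> B \<subseteq> ?J" by (auto intro: generate.incl)
  have swap: "h \<otimes> j \<in> ?J <#> H" if j: "j \<in> A \<union> B" and h: "h \<in> H" for j h
  proof -
    have "h \<otimes> j \<in> H <#> A \<or> h \<otimes> j \<in> H <#> B" using j h unfolding mem_set_mult by blast
    then have "h \<otimes> j \<in> A <#> H \<or> h \<otimes> j \<in> B <#> H" using AH BH by argo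
    then show ?thesis using inc unfolding mem_set_mult by blast
  qed
  have "h \<otimes> j \<in> ?J <#> H" if "j \<in> ?J" "h \<in> H" for j h
    using that
  proof (induction j arbitrary: h rule: generate.induct)
    case one
    have "\<one> \<otimes> h \<in> ?J <#> H" by (rule set_multI[OF generate.one one])
    then show ?case using subgroup.mem_carrier[OF H one] by simp
  next
    case (incl j)
    then show ?case using swap by blast
  next
    case (inv j)
    then have "inv j \<in> A \<union> B" using subgroup.m_inv_closed[OF A] subgroup.m_inv_closed[OF B] by blast
    then show ?case using swap inv(2) by blast
  next
    case (eng j1 j2)
    obtain i h' where i: "i \<in> ?J" "h' \<in> H" "h \<otimes> j1 = i \<otimes> h'"
      using eng.IH(1)[OF eng.prems] unfolding mem_set_mult by blast
    obtain i' h'' where i': "i' \<in> ?J" "h'' \<in> H" "h' \<otimes> j2 = i' \<otimes> h''"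
      using eng.IH(2)[OF i(2)] unfolding mem_set_mult by blast
    have carr: "h \<in> carrier G" "h' \<in> carrier G" "h'' \<in> carrier G" "i \<in> carrier G" "i' \<in> carrier G"
        "j1 \<in> carrier G" "j2 \<in> carrier G"
      using subgroup.mem_carrier[OF H] subgroup.mem_carrier[OF J] eng i i' by blast+
    have "h \<otimes> (j1 \<otimes> j2) = (h \<otimes> j1) \<otimes> j2" using carr by (simp add: m_assoc)
    also have "\<dots> = i \<otimes> (h' \<otimes> j2)" unfolding i(3) using carr by (simp add: m_assoc)
    also have "\<dots> = (i \<otimes> i') \<otimes> h''" unfolding i'(3) using carr by (simp add: m_assoc)
    also have "\<dots> \<in> ?J <#> H" by (rule set_multI[OF subgroup.m_closed[OF J i(1) i'(1)] i'(2)])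
    finally show ?case .
  qed
  then have "H <#> ?J \<subseteq> ?J <#> H" by (auto simp only: mem_set_mult[where A = H])
  then show ?thesis using permutable_if_subset[OF H J] by argo
qed

lemma sp_join:
  assumes A: "sp A" and B: "sp B"
  shows "sp (generate G (A \<union> B))"
proof (rule spI)
  note As = spD[OF A] and Bs = spD[OF B]
  show "subgroup (generate G (A \<union> B)) G"
    using generate_is_subgroup[OF Un_least[OF subgroup.subset[OF As] subgroup.subset[OF Bs]]] .
  show "generate G (A \<union> B) <#> H = H <#> generate G (A \<union> B)" if "hall H" for H
    using generate_perm[OF As Bs hallD(1) sp_perm[OF A] sp_perm[OF B]] that by blast
  show "generate G (A \<union> B) <#> H = H <#> generate G (A \<union> B)" if "hall' H" for H
    using generate_perm[OF As Bs hallD'(1) sp_perm'[OF A] sp_perm'[OF B]] that by blast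
qed

lemma sp_normal: "N \<lhd> G \<Longrightarrow> sp N"
proof (rule spI)
  assume N: "N \<lhd> G"
  show s: "subgroup N G" using N normal_imp_subgroup by blast
  have *: "N <#> H = H <#> N" if "subgroup H G" for H
    using normalizes_permutable[OF that s normalizes_mono[OF normal_normalizes[OF N] subgroup.subset[OF that]]] by simp
  show "N <#> H = H <#> N" if "hall H" for H using * hallD(1)[OF that] .
  show "N <#> H = H <#> N" if "hall' H" for H using * hallD'(1)[OF that] .
qed

lemma conjg_perm:
  assumes A: "subgroup A G" and H: "subgroup H G" and g: "g \<in> carrier G"
    and perm: "A <#> conjg (inv g) H = conjg (inv g) H <#> A"
  shows "conjg g A <#> H = H <#> conjg g A"
proof (rule permutable_if_subset[OF conjg_subgroup[OF A g] H])
  show "conjg g A <#> H \<subseteq> H <#> conjg g A"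
  proof
    fix x assume "x \<in> conjg g A <#> H"
    then obtain y h where y: "y \<in> conjg g A" "h \<in> H" "x = y \<otimes> h" unfolding mem_set_mult by blast
    then obtain a where a: "a \<in> A" "y = g \<otimes> a \<otimes> inv g" unfolding conjg_def by blast
    have ah: "a \<in> A" "h \<in> H" "x = (g \<otimes> a \<otimes> inv g) \<otimes> h" using y a by simp_all
    have "inv g \<otimes> h \<otimes> inv (inv g) \<in> conjg (inv g) H" unfolding conjg_def using ah by blast
    then have "a \<otimes> (inv g \<otimes> h \<otimes> inv (inv g)) \<in> conjg (inv g) H <#> A"
      using ah(1) unfolding perm[symmetric] mem_set_mult by blast
    then obtain h' a' where ha: "h' \<in> H" "a' \<in> A"
        "a \<otimes> (inv g \<otimes> h \<otimes> inv (inv g)) = (inv g \<otimes> h' \<otimes> inv (inv g)) \<otimes> a'"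
      unfolding mem_set_mult conjg_def by blast
    have carr: "a \<in> carrier G" "a' \<in> carrier G" "h \<in> carrier G" "h' \<in> carrier G"
      using ah ha subgroup.mem_carrier[OF A] subgroup.mem_carrier[OF H] by blast+
    have "x = g \<otimes> (a \<otimes> (inv g \<otimes> h \<otimes> inv (inv g))) \<otimes> inv g"
      unfolding ah(3) using carr g by (simp add: word_simps)
    also have "\<dots> = h' \<otimes> (g \<otimes> a' \<otimes> inv g)" unfolding ha(3) using carr g by (simp add: word_simps)
    finally show "x \<in> H <#> conjg g A" using ha unfolding mem_set_mult conjg_def by blast
  qed
qed

lemma hall'_conjg: "hall' H \<Longrightarrow> g \<in> carrier G \<Longrightarrow> hall' (conjg g H)"
  by (rule hall_full.hall_conjg[OF dual])

lemma sp_conjg: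
  assumes A: "sp A" and g: "g \<in> carrier G"
  shows "sp (conjg g A)"
proof (rule spI)
  show "subgroup (conjg g A) G" using conjg_subgroup[OF spD[OF A] g] .
  show "conjg g A <#> H = H <#> conjg g A" if "hall H" for H
    using conjg_perm[OF spD[OF A] hallD(1)[OF that] g] sp_perm[OF A hall_conjg[OF that inv_closed[OF g]]] by blast
  show "conjg g A <#> H = H <#> conjg g A" if "hall' H" for H
    using conjg_perm[OF spD[OF A] hallD'(1)[OF that] g] sp_perm'[OF A hall'_conjg[OF that inv_closed[OF g]]] by blast
qed

lemma hall_Union_subset: "\<Union>{H. hall_subgroup \<tau> G H} \<subseteq> carrier G"
  using hall_subgroup_iff[OF fin] subgroup.subset by blast

lemma hall_part_Union_subset: "\<Union>{A \<inter> H |H. hall_subgroup \<tau> G H} \<subseteq> carrier G"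
  using hall_Union_subset by blast

lemma hall_join_subgroup: "subgroup (hall_join \<tau> G) G"
  unfolding hall_join_def by (rule generate_is_subgroup[OF hall_Union_subset])

lemma hall_part_subgroup: "subgroup (hall_part \<tau> G A) G"
  unfolding hall_part_def by (rule generate_is_subgroup[OF hall_part_Union_subset])

lemma hall_le_join: "hall_subgroup \<tau> G H \<Longrightarrow> H \<subseteq> hall_join \<tau> G"
  unfolding hall_join_def by (auto intro: generate.incl)

lemma hall_le_part: "hall_subgroup \<tau> G H \<Longrightarrow> A \<inter> H \<subseteq> hall_part \<tau> G A"
  unfolding hall_part_def by (auto intro: generate.incl)

lemma hall_part_le: 
  assumes "subgroup A G"
  shows "hall_part \<tau> G A \<subseteq> A"
  unfolding hall_part_def by (rule generate_subgroup_incl[OF _ assms]) blast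

lemma hall_part_mono: "A \<subseteq> B \<Longrightarrow> hall_part \<tau> G A \<subseteq> hall_part \<tau> G B"
  unfolding hall_part_def by (rule mono_generate) blast

lemma Q_normal: "Q \<lhd> G"
  unfolding normal_iff_normalizes
proof
  show "subgroup Q G" by (rule hall_join_subgroup)
  show "normalizes G (carrier G) Q"
    unfolding hall_join_def
  proof (rule normalizes_generate_right[OF hall_Union_subset subset_refl])
    fix n x assume n: "n \<in> carrier G" and "x \<in> \<Union> {H. hall H}"
    then obtain H where H: "hall H" "x \<in> H" by blast
    have "n \<otimes> x \<otimes> inv n \<in> conjg n H" unfolding conjg_def using H by blast
    then show "n \<otimes> x \<otimes> inv n \<in> generate G (\<Union> {H. hall H})"
      using hall_le_join[OF hall_conjg[OF H(1) n]] unfolding hall_join_def by blast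
  qed
qed

lemma P_normal: "P \<lhd> G" by (rule hall_full.Q_normal[OF dual])

lemma D_normal: "D \<lhd> G"
  using P_normal Q_normal subgroups_Inter_pair unfolding normal_iff_normalizes normalizes_def by blast

text \<open>Conjugating x from A \<inter> K by n from H keeps it in the subgroup AH and moves it
  into the conjugate of K by n, which is again a Hall \<pi>'-subgroup. By \<open>sp_hall_Int\<close>
  it is back in A.\<close>

lemma Q_normalizes_part':
  assumes A: "sp A"
  shows "normalizes G Q (hall_part \<pi>' G A)"
  unfolding hall_join_def
proof (rule normalizes_generate_left[OF hall_part_subgroup fin hall_Union_subset])
  have "normalizes G H (hall_part \<pi>' G A)" if H: "hall H" for H
    unfolding hall_part_def
  proof (rule normalizes_generate_right[OF hall_part_Union_subset subgroup.subset[OF hallD(1)[OF H]]])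
    fix n x assume n: "n \<in> H" and "x \<in> \<Union> {A \<inter> K |K. hall' K}"
    then obtain K where K: "hall' K" "x \<in> A" "x \<in> K" by blast
    note Hs = hallD(1)[OF H] and As = spD[OF A]
    have nc: "n \<in> carrier G" using n subgroup.mem_carrier[OF Hs] by blast
    note Kn = hall'_conjg[OF K(1) nc]
    have AH: "subgroup (A <#> H) G" using subgroup_set_mult[OF As Hs sp_perm[OF A H]] .
    have "n \<in> A <#> H" "x \<in> A <#> H"
      using n K subset_set_mult_right[OF As subgroup.subset[OF Hs]]
        subset_set_mult_left[OF Hs subgroup.subset[OF As]] by blast+
    then have "n \<otimes> x \<otimes> inv n \<in> A <#> H"
      using subgroup.m_closed[OF AH] subgroup.m_inv_closed[OF AH] by blast
    moreover have "n \<otimes> x \<otimes> inv n \<in> conjg n K" unfolding conjg_def using K by blast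
    ultimately have "n \<otimes> x \<otimes> inv n \<in> A \<inter> conjg n K" using sp_hall_Int[OF A H Kn] by blast
    then show "n \<otimes> x \<otimes> inv n \<in> generate G (\<Union> {A \<inter> K |K. hall' K})"
      using hall_le_part[OF Kn] unfolding hall_part_def by blast
  qed
  then show "normalizes G (\<Union> {H. hall H}) (hall_part \<pi>' G A)" unfolding normalizes_def by blast
qed

lemma P_normalizes_part:
  assumes A: "sp A"
  shows "normalizes G P (hall_part \<pi> G A)"
proof -
  have "sigma_permutable \<pi>' G A" using A sp_dual by metis
  then show ?thesis using hall_full.Q_normalizes_part'[OF dual] by simp
qed

lemma sp_parts: 
  assumes A: "sp A" and a: "a \<in> A"
  shows "\<exists>x\<in>hall_part \<pi> G A. \<exists>y\<in>hall_part \<pi>' G A. a = x \<otimes> y"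
proof -
  obtain H where H: "hall H" using hall_exists .
  obtain K where K: "hall' K" using hall'_exists .
  have "a \<in> (A \<inter> H) <#> (A \<inter> K)" using a sp_card_mult(2)[OF A H K] by argo
  then show ?thesis using hall_le_part[OF H] hall_le_part[OF K] unfolding mem_set_mult by blast
qed

lemma D_normalizes:
  assumes A: "sp A"
  shows "normalizes G D A"
proof (rule normalizesI)
  fix d a assume d: "d \<in> D" and a: "a \<in> A"
  obtain x y where xy: "x \<in> hall_part \<pi> G A" "y \<in> hall_part \<pi>' G A" "a = x \<otimes> y"
    using sp_parts[OF A a] by blast
  have "d \<otimes> x \<otimes> inv d \<in> hall_part \<pi> G A" using normalizesD[OF P_normalizes_part[OF A] _ xy(1)] d by blast
  moreover have "d \<otimes> y \<otimes> inv d \<in> hall_part \<pi>' G A"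
    using normalizesD[OF Q_normalizes_part'[OF A] _ xy(2)] d by blast
  ultimately have "(d \<otimes> x \<otimes> inv d) \<otimes> (d \<otimes> y \<otimes> inv d) \<in> A"
    using hall_part_le[OF spD[OF A]] subgroup.m_closed[OF spD[OF A]] by blast
  moreover have "d \<in> carrier G" using d subgroup.mem_carrier[OF hall_join_subgroup] by blast
  moreover have "x \<in> carrier G" using subgroup.mem_carrier[OF hall_part_subgroup xy(1)] .
  moreover have "y \<in> carrier G" using subgroup.mem_carrier[OF hall_part_subgroup xy(2)] .
  ultimately show "d \<otimes> a \<otimes> inv d \<in> A" unfolding xy(3) by (simp add: word_simps)
qed

text \<open>A meets Hall \<pi>'-subgroups trivially, so |A \<inter> H| = |A| for every Hall
  \<pi>-subgroup H. Then A equals its own \<pi>-part, which \<open>P\<close> normalizes.\<close>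

lemma sp_pi_subgroup:
  assumes A: "sp A" and p: "pi_number \<pi> (card A)"
  shows "hall H \<Longrightarrow> A \<subseteq> H" "normalizes G P A"
proof -
  note As = spD[OF A]
  have sub: "A \<subseteq> H" if H: "hall H" for H
  proof -
    obtain K where K: "hall' K" using hall'_exists .
    have "A \<inter> K = {\<one>}" using pi_subgroups_Int[OF As hallD'(1)[OF K] p hallD'(2)[OF K]] .
    then have "card (A \<inter> H) = card A" using sp_card_mult(1)[OF A H K] by simp
    then show ?thesis using finsub[OF As] by (metis card_subset_eq inf.cobounded1 inf.orderI)
  qed
  then show "hall H \<Longrightarrow> A \<subseteq> H" .
  obtain H where H: "hall H" using hall_exists .
  have "hall_part \<pi> G A = A" using hall_part_le[OF As] hall_le_part[OF H, of A] sub[OF H] by blast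
  then show "normalizes G P A" using P_normalizes_part[OF A] by simp
qed

text \<open>Here AH = H = HA for a Hall \<pi>-subgroup H, while a Hall \<pi>'-subgroup lies in
  \<open>P\<close> and normalizes A. This criterion recognizes images and graphs of operator
  isomorphisms as members of the lattice.\<close>

lemma pi_subgroup_sp:
  assumes A: "subgroup A G" and H: "\<And>H. hall H \<Longrightarrow> A \<subseteq> H" and nrm: "normalizes G P A"
  shows "sp A" "pi_number \<pi> (card A)"
proof -
  show "sp A"
  proof (rule spI[OF A])
    show "A <#> H = H <#> A" if "hall H" for H
    proof -
      note Hs = hallD(1)[OF that]
      have "A <#> H \<subseteq> H" "H <#> A \<subseteq> H" using set_mult_subset_subgroup[OF Hs] H[OF that] by blast+
      moreover have "H \<subseteq> A <#> H" "H \<subseteq> H <#> A"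
        using subset_set_mult_right[OF A] subset_set_mult_left[OF A] subgroup.subset[OF Hs] by blast+
      ultimately show ?thesis by blast
    qed
    show "A <#> K = K <#> A" if "hall' K" for K
      using normalizes_permutable[OF hallD'(1)[OF that] A] normalizes_mono[OF nrm hall_le_join[OF that]] by simp
  qed
  obtain H where "hall H" using hall_exists .
  then show "pi_number \<pi> (card A)"
    using H card_subgroup_dvd[OF A hallD(1)] hallD(2) pi_number_dvd by blast
qed

text \<open>If x = h k lies in \<open>Q\<close>, then so does k = h^-1 x. As an element of a Hall
  \<pi>'-subgroup k also lies in \<open>P\<close>, hence in \<open>D\<close>.\<close>

lemma hall_D: assumes H: "hall H" shows "H <#> D = Q"
proof
  note Hs = hallD(1)[OF H]
  show "H <#> D \<subseteq> Q" using set_mult_subset_subgroup[OF hall_join_subgroup] hall_le_join[OF H] by blast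
  obtain K where K: "hall' K" using hall'_exists .
  show "Q \<subseteq> H <#> D"
  proof
    fix x assume x: "x \<in> Q"
    have "x \<in> H <#> K" using x hall_set_mult[OF H K] subgroup.mem_carrier[OF hall_join_subgroup] by blast
    then obtain h k where hk: "h \<in> H" "k \<in> K" "x = h \<otimes> k" unfolding mem_set_mult by blast
    have "k = inv h \<otimes> x"
      using hk subgroup.mem_carrier[OF Hs hk(1)] subgroup.mem_carrier[OF hallD'(1)[OF K] hk(2)]
      by (simp add: word_simps)
    moreover have "inv h \<in> Q" using subgroup.m_inv_closed[OF Hs hk(1)] hall_le_join[OF H] by blast
    ultimately have "k \<in> Q" using subgroup.m_closed[OF hall_join_subgroup] x by metis
    then have "k \<in> D" using hk(2) hall_le_join[OF K] by blast
    then show "x \<in> H <#> D" using hk unfolding mem_set_mult by blast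
  qed
qed

text \<open>A absorbs \<open>D\<close>, so AH = A D H = A \<open>Q\<close>, and \<open>Q\<close> is
  normal. Thus every subgroup over \<open>D\<close> belongs to the lattice, which supplies the
  members for the proof that G/D is cyclic.\<close>

lemma above_D_perm:
  assumes A: "subgroup A G" and DA: "D \<subseteq> A" and H: "hall H"
  shows "A <#> H = H <#> A"
proof -
  note Hs = hallD(1)[OF H] and Ds = normal_imp_subgroup[OF D_normal]
  note sub = subgroup.subset[OF A] subgroup.subset[OF Hs] subgroup.subset[OF Ds]
  have HD: "H <#> D = D <#> H"
    using normalizes_permutable[OF Hs Ds normalizes_mono[OF normal_normalizes[OF D_normal] sub(2)]] .
  have AD: "A <#> D = A" "D <#> A = A"
    using set_mult_subset_subgroup[OF A] DA subset_set_mult_left[OF Ds sub(1)] subset_set_mult_right[OF Ds sub(1)]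
    by blast+
  have "A <#> H = A <#> (D <#> H)" using set_mult_assoc[OF sub(1,3,2)] unfolding AD(1) .
  also have "\<dots> = A <#> Q" unfolding HD[symmetric] hall_D[OF H] ..
  also have "\<dots> = Q <#> A"
    using normalizes_permutable[OF A hall_join_subgroup normalizes_mono[OF normal_normalizes[OF Q_normal] sub(1)]] .
  also have "\<dots> = H <#> A" using set_mult_assoc[OF sub(2,3,1)] unfolding hall_D[OF H] AD(2) .
  finally show ?thesis .
qed

lemma sp_Int:
  assumes A: "sp A" and B: "sp B"
  shows "sp (A \<inter> B)"
proof (rule spI)
  show "subgroup (A \<inter> B) G" using subgroups_Inter_pair[OF spD[OF A] spD[OF B]] .
  show "(A \<inter> B) <#> H = H <#> (A \<inter> B)" if "hall H" for H using sp_Int_perm[OF A B that] .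
  show "(A \<inter> B) <#> H = H <#> (A \<inter> B)" if "hall' H" for H
    by (rule hall_full.sp_Int_perm[OF dual _ _ that]) (simp_all add: A B sp_dual)
qed

lemma above_D_sp:
  assumes A: "subgroup A G" and DA: "D \<subseteq> A"
  shows "sp A"
proof (rule spI[OF A])
  show "A <#> H = H <#> A" if "hall H" for H using above_D_perm[OF A DA that] .
  show "A <#> H = H <#> A" if "hall' H" for H
    by (rule hall_full.above_D_perm[OF dual A _ that]) (use DA in auto)
qed

end

section \<open>Residuals\<close>

context group
begin

lemma pi_subgroup_iff:
  "finite (carrier G) \<Longrightarrow> pi_subgroup \<tau> G N \<longleftrightarrow> subgroup N G \<and> pi_number \<tau> (card N)"
  unfolding pi_subgroup_def using pi_group_subgroup_iff by blast

lemma normal_set_mult_normal: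
  assumes A: "A \<lhd> G" and B: "B \<lhd> G"
  shows "A <#> B \<lhd> G"
  unfolding normal_iff_normalizes
proof
  show s: "subgroup (A <#> B) G" using set_mult_normal_subgroup[OF normal_imp_subgroup[OF A] B] .
  show "normalizes G (carrier G) (A <#> B)"
  proof (rule normalizesI)
    fix x y assume x: "x \<in> carrier G" and "y \<in> A <#> B"
    then obtain a b where ab: "a \<in> A" "b \<in> B" "y = a \<otimes> b" unfolding mem_set_mult by blast
    have "a \<in> carrier G" "b \<in> carrier G"
      using ab subgroup.mem_carrier[OF normal_imp_subgroup[OF A]] subgroup.mem_carrier[OF normal_imp_subgroup[OF B]]
      by blast+
    then have "x \<otimes> y \<otimes> inv x = (x \<otimes> a \<otimes> inv x) \<otimes> (x \<otimes> b \<otimes> inv x)"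
      using x ab(3) by (simp add: word_simps)
    then show "x \<otimes> y \<otimes> inv x \<in> A <#> B"
      using set_multI[OF normalizesD[OF normal_normalizes[OF A] x ab(1)] normalizesD[OF normal_normalizes[OF B] x ab(2)]]
      by metis
  qed
qed

text \<open>\<open>GREATEST\<close> is meaningful only if a largest element exists. A normal
  \<tau>-subgroup A of maximal order is one: for any other N the product A N is a normal
  \<tau>-subgroup, so it equals A.\<close>

lemma pi_core:
  assumes fin: "finite (carrier G)"
  shows "pi_core \<tau> G \<lhd> G" "pi_number \<tau> (card (pi_core \<tau> G))"
    "\<And>N. N \<lhd> G \<Longrightarrow> pi_number \<tau> (card N) \<Longrightarrow> N \<subseteq> pi_core \<tau> G"
proof -
  let ?S = "{N. N \<lhd> G \<and> pi_number \<tau> (card N)}"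
  have S: "N \<lhd> G \<and> pi_subgroup \<tau> G N \<longleftrightarrow> N \<in> ?S" for N
    using pi_subgroup_iff[OF fin] normal_imp_subgroup by blast
  have "?S \<subseteq> Pow (carrier G)" using normal_imp_subgroup subgroup.subset by blast
  then have finS: "finite ?S" using fin finite_subset by blast
  have "{\<one>} \<in> ?S" using one_is_normal by simp
  then have "Max (card ` ?S) \<in> card ` ?S" using finS by (intro Max_in finite_imageI) blast+
  then obtain A where A1: "A \<in> ?S" "Max (card ` ?S) = card A" by (elim imageE) (rule that)
  note A = A1(1)
  have Amax: "card N \<le> card A" if "N \<in> ?S" for N
    unfolding A1(2)[symmetric] by (rule Max_ge[OF finite_imageI[OF finS] imageI[OF that]])
  have As: "subgroup A G" using A normal_imp_subgroup by blast
  have max: "N \<subseteq> A" if N: "N \<in> ?S" for N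
  proof -
    have Ns: "subgroup N G" using N normal_imp_subgroup by blast
    have "card (A <#> N) * card (A \<inter> N) = card A * card N" using card_set_mult[OF As Ns fin] .
    then have "pi_number \<tau> (card (A <#> N) * card (A \<inter> N))" using A N by (simp add: pi_number_mult)
    then have "A <#> N \<in> ?S" using normal_set_mult_normal A N pi_number_mult by blast
    then have "card (A <#> N) \<le> card A" by (rule Amax)
    moreover have "A \<subseteq> A <#> N" using subset_set_mult_left[OF Ns subgroup.subset[OF As]] .
    moreover have "finite (A <#> N)"
      using set_mult_closed[OF subgroup.subset[OF As] subgroup.subset[OF Ns]] fin finite_subset by blast
    ultimately have "A <#> N = A" by (metis card_seteq)
    then show ?thesis using subset_set_mult_right[OF As subgroup.subset[OF Ns]] by argo
  qed
  have eq: "pi_core \<tau> G = A"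
    unfolding pi_core_def by (rule Greatest_equality) (use A S max in blast)+
  show "pi_core \<tau> G \<lhd> G" "pi_number \<tau> (card (pi_core \<tau> G))"
    "\<And>N. N \<lhd> G \<Longrightarrow> pi_number \<tau> (card N) \<Longrightarrow> N \<subseteq> pi_core \<tau> G"
    unfolding eq using A max by blast+
qed

text \<open>The cores contain every normal \<pi>- and \<pi>'-subgroup, so any covering pair may
  replace them. They meet trivially by orders, hence commute elementwise, and multiplication is then
  an injective homomorphism.\<close>

lemma pi_decomposable_iff:
  assumes fin: "finite (carrier G)" and primes: "\<pi> \<subseteq> {p. Factorial_Ring.prime p}"
  shows "pi_decomposable \<pi> G \<longleftrightarrow> (\<exists>A B. A \<lhd> G \<and> B \<lhd> G \<and> pi_number \<pi> (card A) \<and>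
    pi_number (compl_primes \<pi>) (card B) \<and> A <#> B = carrier G)"
proof
  let ?A = "pi_core \<pi> G" and ?B = "pi_core (compl_primes \<pi>) G"
  note A = pi_core[OF fin, where \<tau> = \<pi>] and B = pi_core[OF fin, where \<tau> = "compl_primes \<pi>"]
  note As = normal_imp_subgroup[OF A(1)] and Bs = normal_imp_subgroup[OF B(1)]
  assume "pi_decomposable \<pi> G"
  then have "(\<lambda>(x, y). x \<otimes> y) ` (?A \<times> ?B) = carrier G"
    unfolding pi_decomposable_def iso_def bij_betw_def by simp
  moreover have "(\<lambda>(x, y). x \<otimes> y) ` (?A \<times> ?B) = ?A <#> ?B" by (auto simp: set_mult_def)
  ultimately show "\<exists>A B. A \<lhd> G \<and> B \<lhd> G \<and> pi_number \<pi> (card A) \<and>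
    pi_number (compl_primes \<pi>) (card B) \<and> A <#> B = carrier G" using A B by metis
next
  let ?A = "pi_core \<pi> G" and ?B = "pi_core (compl_primes \<pi>) G"
  note A = pi_core[OF fin, where \<tau> = \<pi>] and B = pi_core[OF fin, where \<tau> = "compl_primes \<pi>"]
  note As = normal_imp_subgroup[OF A(1)] and Bs = normal_imp_subgroup[OF B(1)]
  interpret A: subgroup ?A G by (rule As)
  interpret B: subgroup ?B G by (rule Bs)
  assume "\<exists>A B. A \<lhd> G \<and> B \<lhd> G \<and> pi_number \<pi> (card A) \<and>
    pi_number (compl_primes \<pi>) (card B) \<and> A <#> B = carrier G"
  then have "carrier G \<subseteq> ?A <#> ?B" using A(3) B(3) by (metis mono_set_mult)
  then have img: "(\<lambda>(x, y). x \<otimes> y) ` (?A \<times> ?B) = carrier G"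
    by (auto simp: set_mult_def)
  have int: "?A \<inter> ?B = {\<one>}"
  proof -
    have s: "subgroup (?A \<inter> ?B) G" using subgroups_Inter_pair[OF As Bs] .
    have "card (?A \<inter> ?B) = 1"
      using pi_number_eq_1[OF pi_number_dvd[OF card_subgroup_dvd[OF s As] A(2)]
          pi_number_dvd[OF card_subgroup_dvd[OF s Bs] B(2)]] by blast
    then show ?thesis using subgroup.one_closed[OF s] by (metis card_1_singletonE singletonD)
  qed
  have comm: "x \<otimes> y = y \<otimes> x" if x: "x \<in> ?A" and y: "y \<in> ?B" for x y
  proof -
    have xc: "x \<in> carrier G" "y \<in> carrier G" using x y by auto
    have "x \<otimes> y \<otimes> inv x \<otimes> inv y \<in> ?B"
      using normalizesD[OF normal_normalizes[OF B(1)] xc(1) y] y by simp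
    moreover have "x \<otimes> (y \<otimes> inv x \<otimes> inv y) \<in> ?A"
      using normalizesD[OF normal_normalizes[OF A(1)] xc(2), of "inv x"] x by simp
    ultimately have "x \<otimes> y \<otimes> inv x \<otimes> inv y \<in> ?A \<inter> ?B" using xc by (simp add: m_assoc)
    then have "x \<otimes> y \<otimes> inv (y \<otimes> x) = \<one>" using int xc by (simp add: word_simps)
    then have "x \<otimes> y \<otimes> inv (y \<otimes> x) \<otimes> (y \<otimes> x) = \<one> \<otimes> (y \<otimes> x)" by simp
    then show ?thesis using xc by (simp add: word_simps)
  qed
  have inj: "inj_on (\<lambda>(x, y). x \<otimes> y) (?A \<times> ?B)"
  proof (rule inj_onI, clarify)
    fix a b c d assume m: "a \<in> ?A" "b \<in> ?B" "c \<in> ?A" "d \<in> ?B" and eq: "a \<otimes> b = c \<otimes> d"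
    have carr: "a \<in> carrier G" "b \<in> carrier G" "c \<in> carrier G" "d \<in> carrier G" using m by auto
    have "inv c \<otimes> a = inv c \<otimes> (a \<otimes> b) \<otimes> inv b" using carr by (simp add: word_simps)
    also have "\<dots> = d \<otimes> inv b" unfolding eq using carr by (simp add: word_simps)
    finally have e: "inv c \<otimes> a = d \<otimes> inv b" .
    have "inv c \<otimes> a \<in> ?A" using m by simp
    moreover have "inv c \<otimes> a \<in> ?B" unfolding e using m by simp
    ultimately have 1: "inv c \<otimes> a = \<one>" using int by blast
    have "c \<otimes> (inv c \<otimes> a) = c" unfolding 1 using carr by simp
    moreover have "(d \<otimes> inv b) \<otimes> b = b" using 1 carr unfolding e by simp
    ultimately show "a = c \<and> b = d" using carr by (simp add: word_simps)
  qed
  have "(\<lambda>(x, y). x \<otimes> y) \<in> hom (G\<lparr>carrier := ?A\<rparr> \<times>\<times> G\<lparr>carrier := ?B\<rparr>) G"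
  proof (rule homI)
    fix u v assume "u \<in> carrier (G\<lparr>carrier := ?A\<rparr> \<times>\<times> G\<lparr>carrier := ?B\<rparr>)"
      "v \<in> carrier (G\<lparr>carrier := ?A\<rparr> \<times>\<times> G\<lparr>carrier := ?B\<rparr>)"
    then obtain a b c d where uv: "u = (a, b)" "v = (c, d)" and m: "a \<in> ?A" "b \<in> ?B" "c \<in> ?A" "d \<in> ?B"
      by auto
    have carr: "a \<in> carrier G" "b \<in> carrier G" "c \<in> carrier G" "d \<in> carrier G" using m by auto
    have "(a \<otimes> c) \<otimes> (b \<otimes> d) = a \<otimes> (c \<otimes> b) \<otimes> d" using carr by (simp add: m_assoc)
    also have "\<dots> = (a \<otimes> b) \<otimes> (c \<otimes> d)" unfolding comm[OF m(3,2)] using carr by (simp add: m_assoc)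
    finally show "(case u \<otimes>\<^bsub>G\<lparr>carrier := ?A\<rparr> \<times>\<times> G\<lparr>carrier := ?B\<rparr>\<^esub> v of (x, y) \<Rightarrow> x \<otimes> y) =
        (case u of (x, y) \<Rightarrow> x \<otimes> y) \<otimes> (case v of (x, y) \<Rightarrow> x \<otimes> y)" using uv by simp
  qed auto
  then show "pi_decomposable \<pi> G"
    unfolding pi_decomposable_def iso_def bij_betw_def using inj img by simp
qed

end

context hall_full
begin

text \<open>If the index is a \<pi>-number, comparing \<pi>'-parts of |G| and |N| gives |N \<inter>
  K| = |K| for each Hall \<pi>'-subgroup K. Conversely |G : N| divides |G : K|. This identifies
  \<open>P\<close> with O^\<pi>(G).\<close>

lemma normal_index_iff:
  assumes N: "N \<lhd> G"
  shows "pi_number \<pi> (card (carrier G) div card N) \<longleftrightarrow> P \<subseteq> N"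
proof
  have Ns: "subgroup N G" using N normal_imp_subgroup by blast
  obtain H where H: "hall H" using hall_exists .
  assume idx: "pi_number \<pi> (card (carrier G) div card N)"
  have "K \<subseteq> N" if K: "hall' K" for K
  proof -
    have NH: "subgroup (N \<inter> H) G" and NK: "subgroup (N \<inter> K) G"
      using subgroups_Inter_pair[OF Ns] hallD(1)[OF H] hallD'(1)[OF K] by blast+
    have pNH: "pi_number \<pi> (card (N \<inter> H))"
      using pi_number_dvd[OF card_subgroup_dvd[OF NH hallD(1)[OF H]] hallD(2)[OF H]] by blast
    have pNK: "pi_number \<pi>' (card (N \<inter> K))"
      using pi_number_dvd[OF card_subgroup_dvd[OF NK hallD'(1)[OF K]] hallD'(2)[OF K]] by blast
    have eq: "card H * card K = ((card (carrier G) div card N) * card (N \<inter> H)) * card (N \<inter> K)"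
      using hall_card_mult[OF H K] sp_card_mult(1)[OF sp_normal[OF N] H K]
        card_mult_index[OF Ns subgroup_self subgroup.subset[OF Ns]] by (metis mult.assoc mult.commute)
    have "pi_number \<pi> ((card (carrier G) div card N) * card (N \<inter> H))" using idx pNH by (simp add: pi_number_mult)
    then have "card K = card (N \<inter> K)"
      using pi_factor_unique(2)[OF hallD(2)[OF H] hallD'(2)[OF K] _ pNK eq] by blast
    then have "N \<inter> K = K" using finsub[OF hallD'(1)[OF K]] by (metis card_subset_eq inf_le2)
    then show ?thesis by blast
  qed
  then show "P \<subseteq> N" unfolding hall_join_def by (intro generate_subgroup_incl[OF _ Ns]) blast
next
  have Ns: "subgroup N G" using N normal_imp_subgroup by blast
  obtain K where K: "hall' K" using hall'_exists .
  note Ks = hallD'(1)[OF K]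
  assume "P \<subseteq> N"
  then have KN: "K \<subseteq> N" using hall_le_join[OF K] by blast
  have "card K * (card N div card K) * (card (carrier G) div card N) = card K * (card (carrier G) div card K)"
    using card_mult_index[OF Ks Ns KN] card_mult_index[OF Ns subgroup_self subgroup.subset[OF Ns]]
      card_mult_index[OF Ks subgroup_self subgroup.subset[OF Ks]] by metis
  then have "(card N div card K) * (card (carrier G) div card N) = card (carrier G) div card K"
    using cpos[OF Ks] by (simp add: mult.assoc)
  then show "pi_number \<pi> (card (carrier G) div card N)" using hallD'(3)[OF K] pi_number_mult by metis
qed

lemma normal_index_iff': "N \<lhd> G \<Longrightarrow> pi_number \<pi>' (card (carrier G) div card N) \<longleftrightarrow> Q \<subseteq> N"
  using hall_full.normal_index_iff[OF dual] by simp

lemma pi_residual_eq: "pi_residual \<pi> G = P"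
  unfolding pi_residual_def
proof (rule Least_equality)
  show "P \<lhd> G \<and> pi_group \<pi> (G Mod P)"
    using P_normal normal_index_iff[OF P_normal] pi_group_factor_iff[OF P_normal fin] by blast
  show "P \<subseteq> N" if "N \<lhd> G \<and> pi_group \<pi> (G Mod N)" for N
    using that normal_index_iff pi_group_factor_iff[OF _ fin] by blast
qed

lemma PQ_eq: "P <#> Q = carrier G" "Q <#> P = carrier G"
proof -
  obtain H where H: "hall H" using hall_exists .
  obtain K where K: "hall' K" using hall'_exists .
  have "carrier G \<subseteq> Q <#> P"
    using mono_set_mult[OF hall_le_join[OF H] hall_le_join[OF K]] hall_set_mult[OF H K] by blast
  moreover have "Q <#> P \<subseteq> carrier G"
    using set_mult_closed hall_join_subgroup subgroup.subset by metis
  ultimately show 1: "Q <#> P = carrier G" by blast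
  show "P <#> Q = carrier G"
    using normalizes_permutable[OF hall_join_subgroup hall_join_subgroup
        normalizes_mono[OF normal_normalizes[OF P_normal] subgroup.subset[OF hall_join_subgroup]]] 1 by metis
qed

text \<open>If G/N is a product of normal subgroups A and B of \<pi>- and \<pi>'-order, their
  preimages have \<pi>'- and \<pi>-index, so they contain \<open>Q\<close> and \<open>P\<close>. The
  preimages intersect in N.\<close>

lemma D_le_iff:
  assumes N: "N \<lhd> G" and dec: "pi_decomposable \<pi> (G Mod N)"
  shows "D \<subseteq> N"
proof -
  let ?f = "\<lambda>x. N #> x" and ?M = "G Mod N"
  have Ns: "subgroup N G" using N normal_imp_subgroup by blast
  interpret f: group_hom G ?M ?f using quotient_hom(1)[OF N] .
  note surj = quotient_hom(2)[OF N] and ker = quotient_hom(3)[OF N]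
  have finM: "finite (carrier ?M)" using fin surj by (metis finite_imageI)
  obtain A B where AB: "A \<lhd> ?M" "B \<lhd> ?M" "pi_number \<pi> (card A)" "pi_number \<pi>' (card B)"
      "A <#>\<^bsub>?M\<^esub> B = carrier ?M"
    using dec f.H.pi_decomposable_iff[OF finM primes] by blast
  note As = normal_imp_subgroup[OF AB(1)] and Bs = normal_imp_subgroup[OF AB(2)]
  have sA: "subgroup (A \<inter> B) ?M" using f.H.subgroups_Inter_pair[OF As Bs] .
  have int: "card (A \<inter> B) = 1"
    using pi_number_eq_1[OF pi_number_dvd[OF f.H.card_subgroup_dvd[OF sA As] AB(3)]
          pi_number_dvd[OF f.H.card_subgroup_dvd[OF sA Bs] AB(4)]] by blast
  have cM: "card (carrier ?M) = card A * card B"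
    using f.H.card_set_mult[OF As Bs finM] int AB(5) by simp
  have pre: "{x \<in> carrier G. ?f x \<in> C} \<lhd> G" if C: "C \<lhd> ?M" for C
    unfolding normal_iff_normalizes
  proof
    show "subgroup {x \<in> carrier G. ?f x \<in> C} G" using f.subgroup_preimage[OF normal_imp_subgroup[OF C]] .
    show "normalizes G (carrier G) {x \<in> carrier G. ?f x \<in> C}"
      using normalizesD[OF f.H.normal_normalizes[OF C]] by (intro normalizesI) simp
  qed
  have cpre: "card {x \<in> carrier G. ?f x \<in> C} = card N * card C" if "C \<subseteq> carrier ?M" for C
    using f.card_preimage[OF fin, of C] that unfolding ker surj .
  have "{x \<in> carrier G. ?f x \<in> carrier ?M} = carrier G" using f.hom_closed by blast
  then have cG: "card (carrier G) = card N * (card A * card B)"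
    using cpre[OF subset_refl] unfolding cM by argo
  have "card (carrier G) div card {x \<in> carrier G. ?f x \<in> A} = card B"
    unfolding cpre[OF subgroup.subset[OF As]] cG
    using cpos[OF Ns] f.H.card_subgroup_pos[OF As finM] by simp
  then have "Q \<subseteq> {x \<in> carrier G. ?f x \<in> A}" using normal_index_iff'[OF pre[OF AB(1)]] AB(4) by simp
  moreover have "card (carrier G) div card {x \<in> carrier G. ?f x \<in> B} = card A"
    unfolding cpre[OF subgroup.subset[OF Bs]] cG
    using cpos[OF Ns] f.H.card_subgroup_pos[OF Bs finM] by (simp add: mult.left_commute[of "card N"])
  then have "P \<subseteq> {x \<in> carrier G. ?f x \<in> B}" using normal_index_iff[OF pre[OF AB(2)]] AB(3) by simp
  ultimately have "D \<subseteq> {x \<in> carrier G. ?f x \<in> A \<inter> B}" by blast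
  also have "A \<inter> B = {\<one>\<^bsub>?M\<^esub>}" using int subgroup.one_closed[OF sA] by (metis card_1_singletonE singletonD)
  finally have "D \<subseteq> kernel G ?M ?f" unfolding kernel_def by blast
  then show ?thesis unfolding ker .
qed

text \<open>Because G = \<open>Q\<close> \<open>P\<close>, the image of \<open>Q\<close> in G/D has
  order |G : P|, a \<pi>-number, and the image of \<open>P\<close> has order |G : Q|, a
  \<pi>'-number.\<close>

lemma D_decomposable: "pi_decomposable \<pi> (G Mod D)"
proof -
  let ?f = "\<lambda>x. D #> x" and ?M = "G Mod D"
  note N = D_normal
  have Ds: "subgroup D G" using N normal_imp_subgroup by blast
  interpret f: group_hom G ?M ?f using quotient_hom(1)[OF N] .
  note surj = quotient_hom(2)[OF N] and ker = quotient_hom(3)[OF N]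
  have finM: "finite (carrier ?M)" using fin surj by (metis finite_imageI)
  have cimg: "card X = card D * card (?f ` X)" if X: "subgroup X G" "D \<subseteq> X" for X
  proof -
    have "{x \<in> carrier G. ?f x \<in> ?f ` X} = X"
    proof (intro equalityI subsetI)
      fix x assume "x \<in> {x \<in> carrier G. ?f x \<in> ?f ` X}"
      then obtain y where y: "x \<in> carrier G" "y \<in> X" "?f x = ?f y" by blast
      have yc: "y \<in> carrier G" using subgroup.mem_carrier[OF X(1) y(2)] .
      have "x \<otimes> inv y \<in> X" using rcos_eq_iff[OF Ds y(1) yc] y(3) X(2) by blast
      then have "x \<otimes> inv y \<otimes> y \<in> X" using subgroup.m_closed[OF X(1)] y(2) by blast
      then show "x \<in> X" using y(1) yc by (simp add: word_simps)
    qed (use subgroup.subset[OF X(1)] in blast)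
    then show ?thesis
      using f.card_preimage[OF fin, of "?f ` X"] image_mono[OF subgroup.subset[OF X(1)], of ?f] unfolding ker by argo
  qed
  have Pn: "?f ` P \<lhd> ?M" and Qn: "?f ` Q \<lhd> ?M"
    using normal.surj_hom_normal_subgroup[OF _ f.group_hom_axioms surj] P_normal Q_normal by blast+
  have cPQ: "card (carrier G) * card D = card P * card Q"
    using card_set_mult[OF hall_join_subgroup hall_join_subgroup fin, of \<pi>' \<pi>] unfolding PQ_eq .
  have P0: "card P > 0" and Q0: "card Q > 0" and D0: "card D > 0" 
    using cpos[OF hall_join_subgroup] cpos[OF Ds] by blast+
  have cP: "card P = card D * card (?f ` P)" and cQ: "card Q = card D * card (?f ` Q)"
    using cimg[OF hall_join_subgroup] by blast+
  have GP: "card (carrier G) = card P * card (?f ` Q)"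
    using cPQ D0 unfolding cQ by (simp add: mult.left_commute)
  then have "card (carrier G) div card P = card (?f ` Q)" using P0 by simp
  then have 1: "pi_number \<pi> (card (?f ` Q))" using normal_index_iff[OF P_normal] by simp
  have GQ: "card (carrier G) = card Q * card (?f ` P)"
    using cPQ D0 unfolding cP by (simp add: mult.left_commute mult.commute)
  then have "card (carrier G) div card Q = card (?f ` P)" using Q0 by simp
  then have 2: "pi_number \<pi>' (card (?f ` P))" using normal_index_iff'[OF Q_normal] by simp
  have "?f ` Q <#>\<^bsub>?M\<^esub> ?f ` P = ?f ` (Q <#> P)"
    using set_mult_hom[OF f.homh subgroup.subset[OF hall_join_subgroup] subgroup.subset[OF hall_join_subgroup]] by metis
  then have "?f ` Q <#>\<^bsub>?M\<^esub> ?f ` P = carrier ?M" unfolding PQ_eq surj .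
  then show ?thesis using f.H.pi_decomposable_iff[OF finM primes] Pn Qn 1 2 by blast
qed

lemma decomposable_residual_eq: "pi_decomposable_residual \<pi> G = D"
  unfolding pi_decomposable_residual_def
  by (rule Least_equality) (use D_normal D_decomposable D_le_iff in blast)+

end

section \<open>Quotients\<close>

locale hall_quot = hall_full +
  fixes R assumes R: "R \<lhd> G"
begin

abbreviation "f \<equiv> \<lambda>x. R #> x"
abbreviation "Gq \<equiv> G Mod R"
abbreviation "pre B \<equiv> {x \<in> carrier G. f x \<in> B}"

sublocale f: group_hom G Gq f using quotient_hom(1)[OF R] .

lemma surj: "f ` carrier G = carrier Gq" using quotient_hom(2)[OF R] .

lemma ker: "kernel G Gq f = R" using quotient_hom(3)[OF R] .

lemma Rs: "subgroup R G" using R normal_imp_subgroup by blast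

lemma finq: "finite (carrier Gq)" using fin surj by (metis finite_imageI)

lemma f_eq_iff: "x \<in> carrier G \<Longrightarrow> y \<in> carrier G \<Longrightarrow> f x = f y \<longleftrightarrow> x \<otimes> inv y \<in> R"
  using rcos_eq_iff[OF Rs] .

lemma pre_img:
  assumes H: "subgroup H G"
  shows "pre (f ` H) = H <#> R"
proof (intro equalityI subsetI)
  fix x assume "x \<in> pre (f ` H)"
  then obtain h where h: "x \<in> carrier G" "h \<in> H" "f h = f x" by force
  have hc: "h \<in> carrier G" using subgroup.mem_carrier[OF H h(2)] .
  have "h \<otimes> inv x \<in> R" using f_eq_iff[OF hc h(1)] h(3) by blast
  then have "inv h \<otimes> inv (h \<otimes> inv x) \<otimes> h \<in> R"
    using normalizesD_inv[OF normal_normalizes[OF R] subgroup_self hc] subgroup.m_inv_closed[OF Rs] by blast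
  then have "inv h \<otimes> x \<in> R" using hc h(1) by (simp add: word_simps)
  then have "h \<otimes> (inv h \<otimes> x) \<in> H <#> R" using h(2) by (intro set_multI)
  then show "x \<in> H <#> R" using hc h(1) by (simp add: word_simps)
next
  fix x assume "x \<in> H <#> R"
  then obtain h r where hr: "h \<in> H" "r \<in> R" "x = h \<otimes> r" unfolding mem_set_mult by blast
  have c: "h \<in> carrier G" "r \<in> carrier G"
    using subgroup.mem_carrier[OF H hr(1)] subgroup.mem_carrier[OF Rs hr(2)] .
  have "f x = f h"
    using f_eq_iff[of x h] hr c normalizesD[OF normal_normalizes[OF R] c(1) hr(2)] by simp
  then show "x \<in> pre (f ` H)" using hr c by simp
qed

lemma card_pre: "B \<subseteq> carrier Gq \<Longrightarrow> card (pre B) = card R * card B"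
  using f.card_preimage[OF fin, of B] unfolding ker surj .

lemma subgroup_img: "subgroup H G \<Longrightarrow> subgroup (f ` H) Gq"
  by (rule f.subgroup_img_is_subgroup)

lemma card_img:
  assumes H: "subgroup H G"
  shows "card H = card (f ` H) * card (H \<inter> R)"
proof -
  have "card R * card (f ` H) * card (H \<inter> R) = card H * card R"
    using card_set_mult[OF H Rs fin] card_pre[OF subgroup.subset[OF subgroup_img[OF H]]]
    unfolding pre_img[OF H] by argo
  then show ?thesis using cpos[OF Rs] by simp
qed

lemma index_img:
  assumes B: "subgroup B Gq" and H: "subgroup H G" and HB: "f ` H \<subseteq> B"
  shows "card B div card (f ` H) dvd card (pre B) div card H"
proof -
  note Bs = f.subgroup_preimage[OF B] and Hq = subgroup_img[OF H]
  note Ls = f.subgroup_preimage[OF Hq]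
  have HL: "H \<subseteq> pre (f ` H)" using subgroup.subset[OF H] by blast
  have LB: "pre (f ` H) \<subseteq> pre B" using HB by blast
  have 1: "card (f ` H) * (card B div card (f ` H)) = card B"
    using f.H.card_mult_index[OF Hq B HB] .
  have 2: "card H * (card (pre (f ` H)) div card H) = card (pre (f ` H))"
    using card_mult_index[OF H Ls HL] .
  have 3: "card H * (card (pre B) div card H) = card (pre B)"
    using card_mult_index[OF H Bs] HL LB by blast
  have 4: "card (pre B) = card (pre (f ` H)) * (card B div card (f ` H))"
    unfolding card_pre[OF subgroup.subset[OF B]] card_pre[OF subgroup.subset[OF Hq]]
    using 1 by (metis mult.assoc)
  have 5: "card H * (card (pre B) div card H) = card H * ((card (pre (f ` H)) div card H) * (card B div card (f ` H)))"
    unfolding 3 mult.assoc[symmetric] 2 by (rule 4)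
  have "card H \<noteq> 0" using cpos[OF H] by simp
  then have "card (pre B) div card H = (card (pre (f ` H)) div card H) * (card B div card (f ` H))"
    using 5 by (rule iffD1[OF mult_left_cancel])
  then show ?thesis by (rule dvdI[OF trans[OF _ mult.commute]])
qed

text \<open>A Hall subgroup of M is the image of a Hall subgroup of the preimage of M. This is why
  \<open>hall_ex\<close> ranges over all subgroups.\<close>

lemma quotient_hall_full: "hall_full Gq \<pi>"
proof (intro hall_full.intro f.H.is_group hall_full_axioms.intro finq primes)
  fix M \<tau> assume M: "subgroup M Gq" and \<tau>: "\<tau> = \<pi> \<or> \<tau> = \<pi>'"
  obtain H where H: "subgroup H G" "H \<subseteq> pre M" "pi_number \<tau> (card H)"
      "pi_number (compl_primes \<tau>) (card (pre M) div card H)"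
    using hall_ex[OF f.subgroup_preimage[OF M] \<tau>] by blast
  have sub: "f ` H \<subseteq> M" using H(2) by blast
  have "pi_number \<tau> (card (f ` H))" using H(3) card_img[OF H(1)] pi_number_mult by metis
  moreover have "pi_number (compl_primes \<tau>) (card M div card (f ` H))"
    using pi_number_dvd[OF index_img[OF M H(1) sub] H(4)] .
  ultimately show "\<exists>H. subgroup H Gq \<and> H \<subseteq> M \<and> pi_number \<tau> (card H) \<and>
      pi_number (compl_primes \<tau>) (card M div card H)"
    using subgroup_img[OF H(1)] sub by blast
qed

sublocale q: hall_full Gq \<pi> by (rule quotient_hall_full)

lemma hall_img:
  assumes H: "hall H"
  shows "q.hall (f ` H)"
proof -
  note Hs = hallD(1)[OF H]
  have "pi_number \<pi> (card (f ` H))" using hallD(2)[OF H] card_img[OF Hs] pi_number_mult by metis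
  moreover have "pre (carrier Gq) = carrier G" using f.hom_closed by blast
  then have "pi_number \<pi>' (card (carrier Gq) div card (f ` H))"
    using pi_number_dvd[OF index_img[OF f.H.subgroup_self Hs] ] hallD(3)[OF H]
      subgroup.subset[OF subgroup_img[OF Hs]] by metis
  ultimately show ?thesis using f.H.hall_subgroup_iff[OF finq] subgroup_img[OF Hs] by blast
qed

text \<open>Take a Hall \<pi>-subgroup H of the preimage of B. The index of its image in B is both a
  \<pi>- and a \<pi>'-number, so the image is B; and since B has \<pi>'-index, H is a Hall subgroup
  of G itself.\<close>

lemma hall_lift:
  assumes B: "q.hall B"
  obtains H where "hall H" "f ` H = B"
proof -
  note Bs = q.hallD(1)[OF B]
  note preB = f.subgroup_preimage[OF Bs]
  obtain H where H: "subgroup H G" "H \<subseteq> pre B" "pi_number \<pi> (card H)"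
      "pi_number \<pi>' (card (pre B) div card H)"
    using hall_ex[OF preB] by blast
  have sub: "f ` H \<subseteq> B" using H(2) by blast
  have "pi_number \<pi>' (card B div card (f ` H))" using pi_number_dvd[OF index_img[OF Bs H(1) sub] H(4)] .
  moreover have idx: "card (f ` H) * (card B div card (f ` H)) = card B"
    using f.H.card_mult_index[OF subgroup_img[OF H(1)] Bs sub] .
  moreover have "pi_number \<pi> (card B div card (f ` H))"
    using q.hallD(2)[OF B] idx pi_number_mult by metis
  ultimately have "card B div card (f ` H) = 1" using pi_number_eq_1 by blast
  then have "card (f ` H) = card B" using idx by simp
  then have eq: "f ` H = B" using sub q.finsub[OF Bs] by (metis card_subset_eq)
  have idxB: "card B * (card (carrier Gq) div card B) = card (carrier Gq)"
    using f.H.card_mult_index[OF Bs f.H.subgroup_self subgroup.subset[OF Bs]] .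
  have preG: "pre (carrier Gq) = carrier G" using f.hom_closed by blast
  have "card (carrier G) = card R * card (carrier Gq)" using card_pre[OF subset_refl] unfolding preG .
  also have "\<dots> = card (pre B) * (card (carrier Gq) div card B)"
    unfolding card_pre[OF subgroup.subset[OF Bs]] using idxB by (metis mult.assoc)
  also have "\<dots> = card H * ((card (pre B) div card H) * (card (carrier Gq) div card B))"
    unfolding mult.assoc[symmetric] card_mult_index[OF H(1) preB H(2)] ..
  finally have e: "card (carrier G) = card H * ((card (pre B) div card H) * (card (carrier Gq) div card B))" .
  have "card H \<noteq> 0" using cpos[OF H(1)] by simp
  then have "card (carrier G) div card H = (card (pre B) div card H) * (card (carrier Gq) div card B)"
    using e nonzero_mult_div_cancel_left by metis
  then have "pi_number \<pi>' (card (carrier G) div card H)" using H(4) q.hallD(3)[OF B] by (simp add: pi_number_mult)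
  then have "hall H" using hall_subgroup_iff[OF fin] H by blast
  then show thesis using that eq by blast
qed

lemma img_mult: "A \<subseteq> carrier G \<Longrightarrow> B \<subseteq> carrier G \<Longrightarrow> f ` A <#>\<^bsub>Gq\<^esub> f ` B = f ` (A <#> B)"
  using set_mult_hom[OF f.homh] by metis

lemma pre_perm:
  assumes A: "subgroup A Gq" and H: "subgroup H G" 
    and perm: "A <#>\<^bsub>Gq\<^esub> f ` H = f ` H <#>\<^bsub>Gq\<^esub> A"
  shows "pre A <#> H = H <#> pre A"
proof (rule permutable_if_subset[OF f.subgroup_preimage[OF A] H])
  show "pre A <#> H \<subseteq> H <#> pre A"
  proof
    fix x assume "x \<in> pre A <#> H"
    then obtain a h where ah: "a \<in> pre A" "h \<in> H" "x = a \<otimes> h" unfolding mem_set_mult by blast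
    have c: "a \<in> carrier G" "h \<in> carrier G" using ah subgroup.mem_carrier[OF H ah(2)] by blast+
    have "f x = f a \<otimes>\<^bsub>Gq\<^esub> f h" using ah(3) c by simp
    then have "f x \<in> A <#>\<^bsub>Gq\<^esub> f ` H" using ah unfolding mem_set_mult by blast
    then obtain h' b where hb: "h' \<in> H" "b \<in> A" "f x = f h' \<otimes>\<^bsub>Gq\<^esub> b"
      unfolding perm unfolding mem_set_mult by blast
    have h'c: "h' \<in> carrier G" using subgroup.mem_carrier[OF H hb(1)] .
    have bc: "b \<in> carrier Gq" using subgroup.mem_carrier[OF A hb(2)] .
    have xc: "x \<in> carrier G" using ah(3) c by simp
    have "f (inv h' \<otimes> x) = inv\<^bsub>Gq\<^esub> (f h') \<otimes>\<^bsub>Gq\<^esub> f x" using h'c xc by simp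
    also have "\<dots> = b" unfolding hb(3) using h'c bc by (intro f.H.inv_mult_cancel) simp_all
    finally have "inv h' \<otimes> x \<in> pre A" using hb(2) h'c xc by simp
    then have "h' \<otimes> (inv h' \<otimes> x) \<in> H <#> pre A" using hb(1) by (intro set_multI)
    then show "x \<in> H <#> pre A" using h'c xc by (simp add: mult_inv_cancel)
  qed
qed

lemma image_pi_normalizes:
  assumes nrm: "normalizes G X U" and X: "X \<subseteq> carrier G" and U: "U \<subseteq> carrier G"
  shows "normalizes Gq (f ` X) (f ` U)"
proof (rule normalizesI, clarify)
  fix x u assume xu: "x \<in> X" "u \<in> U"
  have c: "x \<in> carrier G" "u \<in> carrier G" using xu X U by blast+
  have "f x \<otimes>\<^bsub>Gq\<^esub> f u \<otimes>\<^bsub>Gq\<^esub> inv\<^bsub>Gq\<^esub> (f x) = f (x \<otimes> u \<otimes> inv x)" using c by simp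
  then show "f x \<otimes>\<^bsub>Gq\<^esub> f u \<otimes>\<^bsub>Gq\<^esub> inv\<^bsub>Gq\<^esub> (f x) \<in> f ` U"
    using normalizesD[OF nrm xu] by (metis imageI)
qed

end

lemma (in hall_quot) dual_quot: "hall_quot G \<pi>' R"
  using dual R by (simp add: hall_quot_def hall_quot_axioms_def)

context hall_quot
begin

lemma sp_pre:
  assumes A: "q.sp A"
  shows "sp (pre A)"
proof (rule spI)
  interpret d: hall_quot G \<pi>' R by (rule dual_quot)
  note As = q.spD[OF A]
  show "subgroup (pre A) G" using f.subgroup_preimage[OF As] .
  show "pre A <#> H = H <#> pre A" if "hall H" for H
    using pre_perm[OF As hallD(1)[OF that] q.sp_perm[OF A hall_img[OF that]]] .
  show "pre A <#> K = K <#> pre A" if "hall' K" for K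
    using pre_perm[OF As hallD'(1)[OF that] q.sp_perm'[OF A d.hall_img[OF that]]] .
qed

text \<open>U only has to be a \<pi>-group modulo R, which is expressed by containment in every H R.
  By lifting Hall subgroups its image lies in all Hall \<pi>-subgroups of the factor group and is
  normalized by all Hall \<pi>'-subgroups.\<close>

lemma sp_img_pi:
  assumes U: "subgroup U G" and UH: "\<And>H. hall H \<Longrightarrow> U \<subseteq> H <#> R" and nrm: "normalizes G P U"
  shows "q.sp (f ` U)" "pi_number \<pi> (card (f ` U))"
proof -
  interpret d: hall_quot G \<pi>' R by (rule dual_quot)
  have sub: "f ` U \<subseteq> B" if B: "q.hall B" for B
  proof -
    obtain H where H: "hall H" "f ` H = B" using hall_lift[OF B] .
    have "U \<subseteq> pre (f ` H)" unfolding pre_img[OF hallD(1)[OF H(1)]] using UH[OF H(1)] .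
    then show ?thesis unfolding H(2) by blast
  qed
  have "normalizes Gq (\<Union>{K. q.hall' K}) (f ` U)"
  proof -
    have "normalizes Gq B (f ` U)" if B: "q.hall' B" for B
    proof -
      obtain K where K: "hall' K" "f ` K = B" using d.hall_lift[OF B] .
      show ?thesis
        using image_pi_normalizes[OF normalizes_mono[OF nrm hall_le_join[OF K(1)]]
            subgroup.subset[OF hallD'(1)[OF K(1)]] subgroup.subset[OF U]] unfolding K(2) .
    qed
    then show ?thesis unfolding normalizes_def by blast
  qed
  then have "normalizes Gq q.P (f ` U)"
    unfolding hall_join_def
    by (rule f.H.normalizes_generate_left[OF subgroup_img[OF U] finq q.hall_Union_subset])
  then show "q.sp (f ` U)" "pi_number \<pi> (card (f ` U))"
    using q.pi_subgroup_sp[OF subgroup_img[OF U] sub] by blast+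
qed

end

section \<open>Distributive lattices\<close>

lemma (in group) generate_eq_set_mult:
  assumes A: "subgroup A G" and B: "subgroup B G" and perm: "A <#> B = B <#> A"
  shows "generate G (A \<union> B) = A <#> B"
proof
  show "generate G (A \<union> B) \<subseteq> A <#> B"
    using subset_set_mult_left[OF B subgroup.subset[OF A]] subset_set_mult_right[OF A subgroup.subset[OF B]]
    by (intro generate_subgroup_incl[OF _ subgroup_set_mult[OF A B perm]]) blast
  show "A <#> B \<subseteq> generate G (A \<union> B)"
    using generate_is_subgroup[OF Un_least[OF subgroup.subset[OF A] subgroup.subset[OF B]]]
    by (rule set_mult_subset_subgroup) (auto intro: generate.incl)
qed

lemma (in group) exists_maximal_subgroup:
  assumes fin: "finite (carrier G)" and A: "subgroup A G" "A \<noteq> carrier G"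
  shows "\<exists>M. subgroup M G \<and> A \<subseteq> M \<and> M \<noteq> carrier G \<and>
    (\<forall>L. subgroup L G \<longrightarrow> M \<subseteq> L \<longrightarrow> L \<noteq> carrier G \<longrightarrow> L = M)"
proof -
  let ?S = "{M. subgroup M G \<and> A \<subseteq> M \<and> M \<noteq> carrier G}"
  have "?S \<subseteq> Pow (carrier G)" using subgroup.subset by blast
  then have finS: "finite ?S" using fin finite_subset by blast
  have ne: "?S \<noteq> {}" using A by blast
  obtain M where M: "M \<in> ?S" "\<forall>L\<in>?S. M \<subseteq> L \<longrightarrow> M = L"
    using finite_has_maximal[OF finS ne] by (elim bexE) (rule that)
  have "L = M" if "subgroup L G" "M \<subseteq> L" "L \<noteq> carrier G" for L
  proof -
    have "L \<in> ?S" using that M(1) by blast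
    then show ?thesis using M(2) that(2) by blast
  qed
  then show ?thesis using M(1) by blast
qed

section \<open>Consequences of distributivity\<close>

context hall_full
begin

text \<open>Only the nontrivial half of the distributive law; the other inclusion is
  \<open>generate_meets_subset\<close>. In \<open>product_dist\<close> below joins are replaced by
  products, the form that passes easily to factor groups.\<close>

definition "join_dist \<longleftrightarrow> (\<forall>A B C. sp A \<longrightarrow> sp B \<longrightarrow> sp C \<longrightarrow>
  A \<inter> generate G (B \<union> C) \<subseteq> generate G ((A \<inter> B) \<union> (A \<inter> C)))"
definition "all_permute \<longleftrightarrow> (\<forall>A B. sp A \<longrightarrow> sp B \<longrightarrow> A <#> B = B <#> A)"
definition "product_dist \<longleftrightarrow> (\<forall>A B C. sp A \<longrightarrow> sp B \<longrightarrow> sp C \<longrightarrow>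
  A \<inter> (B <#> C) \<subseteq> (A \<inter> B) <#> (A \<inter> C))"
definition "comm_mod_D \<longleftrightarrow> (\<forall>x\<in>carrier G. \<forall>y\<in>carrier G. x \<otimes> y \<otimes> inv x \<otimes> inv y \<in> D)"

lemma hall_quotI: "R \<lhd> G \<Longrightarrow> hall_quot G \<pi> R"
  by (intro hall_quot.intro hall_quot_axioms.intro hall_full_axioms)

lemma Ds: "subgroup D G" using D_normal normal_imp_subgroup by blast

text \<open>An element x outside all maximal subgroups over D generates G modulo D. That the minimal
  x is such an element follows from the meet-primeness of maximal subgroups.\<close>

lemma dist_cyclic:
  assumes join_dist: join_dist
  shows "cyclic_group (G Mod D)"
proof -
  define Mx where "Mx = {M. subgroup M G \<and> D \<subseteq> M \<and> M \<noteq> carrier G \<and>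
    (\<forall>L. subgroup L G \<longrightarrow> M \<subseteq> L \<longrightarrow> L \<noteq> carrier G \<longrightarrow> L = M)}"
  have Mx: "subgroup M G" "D \<subseteq> M" "M \<noteq> carrier G" "M \<subseteq> carrier G" if "M \<in> Mx" for M
    using that subgroup.subset[of M G] unfolding Mx_def by blast+
  have Mx_max: "L = M" if "M \<in> Mx" "subgroup L G" "M \<subseteq> L" "L \<noteq> carrier G" for L M
    using that unfolding Mx_def by blast
  have "Mx \<subseteq> Pow (carrier G)" using Mx(4) by blast
  then have finMx: "finite Mx" using fin finite_subset by blast
  \<comment> \<open>If M contained neither X nor Y, then M and X would generate G, and by
    distributivity Y would be generated by Y \<inter> M and Y \<inter> X, both of which lie in
    M.\<close>
  have meet_prime: "X \<subseteq> M \<or> Y \<subseteq> M"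
    if M: "M \<in> Mx" and X: "subgroup X G" "D \<subseteq> X" and Y: "subgroup Y G" "D \<subseteq> Y" and XY: "X \<inter> Y \<subseteq> M" for M X Y
  proof (rule ccontr)
    assume no: "\<not> (X \<subseteq> M \<or> Y \<subseteq> M)"
    let ?J = "generate G (M \<union> X)"
    have inc: "M \<union> X \<subseteq> ?J" by (auto intro: generate.incl)
    have J: "subgroup ?J G"
      using generate_is_subgroup[OF Un_least[OF subgroup.subset[OF Mx(1)[OF M]] subgroup.subset[OF X(1)]]] .
    have "?J = carrier G"
    proof (rule ccontr)
      assume "?J \<noteq> carrier G"
      then have "?J = M" using Mx_max[OF M J] inc by blast
      then show False using no inc by blast
    qed
    then have "Y \<subseteq> Y \<inter> ?J" using subgroup.subset[OF Y(1)] by blast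
    also have "\<dots> \<subseteq> generate G ((Y \<inter> M) \<union> (Y \<inter> X))"
      using join_dist above_D_sp[OF Y] above_D_sp[OF Mx(1,2)[OF M]] above_D_sp[OF X] unfolding join_dist_def by blast
    also have "\<dots> \<subseteq> M" using XY by (intro generate_subgroup_incl[OF _ Mx(1)[OF M]]) blast
    finally show False using no by blast
  qed
  \<comment> \<open>Intersecting with \<open>carrier G\<close> gives the empty family its proper
    meaning, because \<open>\<Inter>{}\<close> is the whole type.\<close>
  have Inter_prime: "M \<in> F" if "finite F" "F \<subseteq> Mx" "carrier G \<inter> \<Inter>F \<subseteq> M" "M \<in> Mx" for F M
    using that
  proof (induction F rule: finite_induct)
    case empty
    then show ?case using Mx(3,4) by blast
  next
    case (insert N F)
    have N: "N \<in> Mx" and F: "F \<subseteq> Mx" using insert by auto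
    have "carrier G \<inter> \<Inter>F = \<Inter>(insert (carrier G) F)" by blast
    moreover have "subgroup (\<Inter>(insert (carrier G) F)) G"
      by (rule subgroups_Inter) (use F Mx(1) subgroup_self in auto)
    ultimately have s: "subgroup (carrier G \<inter> \<Inter>F) G" by argo
    have Dle: "D \<subseteq> carrier G \<inter> \<Inter>F" using F Mx(2) subgroup.subset[OF Ds] by blast
    have "N \<inter> (carrier G \<inter> \<Inter>F) \<subseteq> M" using insert.prems(2) by blast
    then have "N \<subseteq> M \<or> carrier G \<inter> \<Inter>F \<subseteq> M"
      using meet_prime[OF insert.prems(3) Mx(1,2)[OF N] s Dle] by blast
    then show ?case
    proof
      assume "N \<subseteq> M"
      then have "M = N" using Mx_max[OF N Mx(1)[OF insert.prems(3)]] Mx(3)[OF insert.prems(3)] by blast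
      then show ?thesis by blast
    next
      assume "carrier G \<inter> \<Inter>F \<subseteq> M"
      then show ?thesis using insert.IH F insert.prems(3) by blast
    qed
  qed
  define c where "c x = card {M \<in> Mx. x \<in> M}" for x
  obtain x where x: "x \<in> carrier G" "\<And>y. y \<in> carrier G \<Longrightarrow> c x \<le> c y"
    using ex_has_least_nat[of "\<lambda>x. x \<in> carrier G" \<one> c] by blast
  have none: "x \<notin> M" if M: "M \<in> Mx" for M
  proof
    assume xM: "x \<in> M"
    let ?F = "{N \<in> Mx. x \<notin> N}"
    \<comment> \<open>M is not in \<open>?F\<close>, so it does not contain the intersection, which
      yields y. The product x y avoids M and every maximal subgroup that x avoids, so it lies in
      strictly fewer of them than x.\<close>
    have "\<not> carrier G \<inter> \<Inter>?F \<subseteq> M"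
      using Inter_prime[of ?F M] finMx M xM by auto
    then obtain y where y: "y \<in> carrier G" "\<And>N. N \<in> Mx \<Longrightarrow> x \<notin> N \<Longrightarrow> y \<in> N" "y \<notin> M" by blast
    have xy: "x \<otimes> y \<in> carrier G" using x y by simp
    have "x \<otimes> y \<notin> N" if N: "N \<in> Mx" "x \<notin> N" for N
    proof
      assume "x \<otimes> y \<in> N"
      then have "x \<otimes> y \<otimes> inv y \<in> N"
        using subgroup.m_closed[OF Mx(1)[OF N(1)]] subgroup.m_inv_closed[OF Mx(1)[OF N(1)]] y(2)[OF N] by blast
      then show False using x(1) y(1) N(2) by (simp add: word_simps)
    qed
    moreover have "x \<otimes> y \<notin> M"
    proof
      assume "x \<otimes> y \<in> M"
      then have "inv x \<otimes> (x \<otimes> y) \<in> M"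
        using subgroup.m_closed[OF Mx(1)[OF M]] subgroup.m_inv_closed[OF Mx(1)[OF M] xM] by blast
      then show False using x(1) y(1,3) by (simp add: word_simps)
    qed
    ultimately have "{N \<in> Mx. x \<otimes> y \<in> N} \<subset> {N \<in> Mx. x \<in> N}" using M xM by blast
    then have "c (x \<otimes> y) < c x" unfolding c_def using finMx by (intro psubset_card_mono) auto
    then show False using x(2)[OF xy] by simp
  qed
  interpret hall_quot G \<pi> D by (rule hall_quotI[OF D_normal])
  let ?C = "generate Gq {f x}"
  have fx: "f x \<in> carrier Gq" using x(1) by simp
  have C: "subgroup ?C Gq" using f.H.generate_is_subgroup[of "{f x}"] fx by blast
  have preC: "subgroup (pre ?C) G" using f.subgroup_preimage[OF C] .
  have "D \<subseteq> pre ?C"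
  proof
    fix d assume "d \<in> D"
    then have "d \<in> kernel G Gq f" unfolding ker .
    then show "d \<in> pre ?C" using generate.one[of Gq "{f x}"] unfolding kernel_def by simp
  qed
  moreover have "x \<in> pre ?C" using x(1) by (auto intro: generate.incl)
  ultimately have Dx: "D \<subseteq> pre ?C" "x \<in> pre ?C" by blast+
  have "pre ?C = carrier G"
  proof (rule ccontr)
    assume ne: "pre ?C \<noteq> carrier G"
    obtain M where M: "subgroup M G \<and> pre ?C \<subseteq> M \<and> M \<noteq> carrier G \<and>
        (\<forall>L. subgroup L G \<longrightarrow> M \<subseteq> L \<longrightarrow> L \<noteq> carrier G \<longrightarrow> L = M)"
      using exists_maximal_subgroup[OF fin preC ne] by (elim exE) (rule that)
    then have "M \<in> Mx" unfolding Mx_def using Dx(1) by blast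
    then show False using none M Dx(2) by blast
  qed
  then have "f ` pre ?C = carrier Gq" using surj by argo
  moreover have "f ` pre ?C \<subseteq> ?C" by blast
  ultimately have "carrier Gq \<subseteq> ?C" by argo
  then have "carrier Gq = ?C" using subgroup.subset[OF C] by blast
  moreover have "generate Gq {f x} = range (\<lambda>n::int. f x [^]\<^bsub>Gq\<^esub> n)"
    using f.H.carrier_subgroup_generated_by_singleton[OF fx] fx by (simp add: carrier_subgroup_generated)
  ultimately show ?thesis unfolding f.H.cyclic_group using fx by blast
qed

lemma cyclic_comm:
  assumes "cyclic_group (G Mod D)"
  shows comm_mod_D
  unfolding comm_mod_D_def
proof (intro ballI)
  interpret hall_quot G \<pi> D by (rule hall_quotI[OF D_normal])
  interpret c: comm_group Gq using f.H.cyclic_imp_abelian_group[OF assms] .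
  fix x y assume xy: "x \<in> carrier G" "y \<in> carrier G"
  have "f (x \<otimes> y) = f x \<otimes>\<^bsub>Gq\<^esub> f y" using xy by (rule f.hom_mult)
  also have "\<dots> = f y \<otimes>\<^bsub>Gq\<^esub> f x" using c.m_comm xy by simp
  also have "\<dots> = f (y \<otimes> x)" using xy by (metis f.hom_mult)
  finally have "x \<otimes> y \<otimes> inv (y \<otimes> x) \<in> D" using f_eq_iff[of "x \<otimes> y" "y \<otimes> x"] xy by blast
  then show "x \<otimes> y \<otimes> inv x \<otimes> inv y \<in> D" using xy by (simp add: word_simps)
qed

lemma above_D_normal:
  assumes comm: comm_mod_D and A: "subgroup A G" "D \<subseteq> A"
  shows "A \<lhd> G"
  unfolding normal_iff_normalizes
proof
  show "normalizes G (carrier G) A"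
  proof (rule normalizesI)
    fix x a assume xa: "x \<in> carrier G" "a \<in> A"
    have ac: "a \<in> carrier G" using subgroup.mem_carrier[OF A(1) xa(2)] .
    have "x \<otimes> a \<otimes> inv x \<otimes> inv a \<in> A" using comm A(2) xa(1) ac unfolding comm_mod_D_def by blast
    then have "x \<otimes> a \<otimes> inv x \<otimes> inv a \<otimes> a \<in> A" using subgroup.m_closed[OF A(1)] xa(2) by blast
    then show "x \<otimes> a \<otimes> inv x \<in> A" using xa(1) ac by (simp add: word_simps)
  qed
qed (rule A)

lemma D_Int_normalizes: "sp A \<Longrightarrow> normalizes G D (D \<inter> A)"
  using D_normalizes[of A] normal_normalizes[OF D_normal] subgroup.subset[OF Ds]
  unfolding normalizes_def by blast

lemma D_Int_set_mult_comm:
  assumes A: "sp A" and B: "sp B"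
  shows "(D \<inter> A) <#> (D \<inter> B) = (D \<inter> B) <#> (D \<inter> A)"
  by (rule normalizes_permutable[OF subgroups_Inter_pair[OF Ds spD[OF A]] subgroups_Inter_pair[OF Ds spD[OF B]]
      normalizes_mono[OF D_Int_normalizes[OF B]]]) blast

text \<open>AD is normal because G/D is abelian, so an element of the join J of A and B is b e a
  with e in D. Then e lies in D \<inter> J, which is contained in (D \<inter> B)(D \<inter> A), and
  its two factors are absorbed by b and a.\<close>

lemma D_dist_permute:
  assumes comm: comm_mod_D
    and join_dist: "\<And>A B. sp A \<Longrightarrow> sp B \<Longrightarrow> D \<inter> generate G (A \<union> B) \<subseteq> generate G ((D \<inter> A) \<union> (D \<inter> B))"
  shows all_permute
  unfolding all_permute_def
proof (intro allI impI)
  fix A B assume A: "sp A" and B: "sp B"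
  note As = spD[OF A] and Bs = spD[OF B]
  note sub = subgroup.subset[OF As] subgroup.subset[OF Bs]
  let ?J = "generate G (A \<union> B)"
  have J: "subgroup ?J G" using generate_is_subgroup[OF Un_least[OF sub]] .
  have inc: "A \<subseteq> ?J" "B \<subseteq> ?J" by (auto intro: generate.incl)
  note DA = subgroups_Inter_pair[OF Ds As] and DB = subgroups_Inter_pair[OF Ds Bs]
  have JD: "D \<inter> ?J \<subseteq> (D \<inter> B) <#> (D \<inter> A)"
    using join_dist[OF A B] generate_eq_set_mult[OF DA DB D_Int_set_mult_comm[OF A B]]
    unfolding D_Int_set_mult_comm[OF A B] by argo
  have AD: "subgroup (A <#> D) G" using set_mult_normal_subgroup[OF As D_normal] .
  have "D \<subseteq> A <#> D" using subset_set_mult_right[OF As subgroup.subset[OF Ds]] .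
  then have ADn: "A <#> D \<lhd> G" using above_D_normal[OF comm AD] by blast
  have BAD: "subgroup (B <#> (A <#> D)) G" using set_mult_normal_subgroup[OF Bs ADn] .
  have "A \<subseteq> A <#> D" using subset_set_mult_left[OF Ds sub(1)] .
  then have "A \<subseteq> B <#> (A <#> D)" using subset_set_mult_right[OF Bs subgroup.subset[OF AD]] by blast
  moreover have "B \<subseteq> B <#> (A <#> D)" using subset_set_mult_left[OF AD sub(2)] .
  ultimately have JBAD: "?J \<subseteq> B <#> (A <#> D)" by (intro generate_subgroup_incl[OF _ BAD]) blast
  have "?J \<subseteq> B <#> A"
  proof
    fix x assume x: "x \<in> ?J"
    then have "x \<in> B <#> (A <#> D)" using JBAD by blast
    then obtain b y where by': "b \<in> B" "y \<in> A <#> D" "x = b \<otimes> y" by (rule set_multE)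
    obtain a d where ad: "a \<in> A" "d \<in> D" "y = a \<otimes> d" using by'(2) by (rule set_multE)
    have c: "a \<in> carrier G" "b \<in> carrier G" "d \<in> carrier G"
      using ad by' sub subgroup.mem_carrier[OF Ds] by blast+
    define e where "e = a \<otimes> d \<otimes> inv a"
    have eD: "e \<in> D" unfolding e_def using normalizesD[OF normal_normalizes[OF D_normal] c(1) ad(2)] .
    have ec: "e \<in> carrier G" unfolding e_def using c by simp
    have xe: "x = b \<otimes> (e \<otimes> a)" unfolding by'(3) ad(3) e_def using c by (simp add: word_simps)
    then have "e = inv b \<otimes> x \<otimes> inv a" using c ec by (simp add: word_simps)
    moreover have "inv b \<in> ?J" "inv a \<in> ?J"
      using subgroup.m_inv_closed[OF J] inc by' ad by blast+
    ultimately have "e \<in> ?J" using x subgroup.m_closed[OF J] by metis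
    then have "e \<in> (D \<inter> B) <#> (D \<inter> A)" using eD JD by blast
    then obtain b' a' where "b' \<in> D \<inter> B" "a' \<in> D \<inter> A" and e': "e = b' \<otimes> a'" by (rule set_multE)
    then have ba': "b' \<in> B" "a' \<in> A" "e = b' \<otimes> a'" by blast+
    have c': "a' \<in> carrier G" "b' \<in> carrier G" using ba' sub by blast+
    have "x = (b \<otimes> b') \<otimes> (a' \<otimes> a)" unfolding xe ba'(3) using c c' by (simp add: m_assoc)
    moreover have "b \<otimes> b' \<in> B" "a' \<otimes> a \<in> A"
      using subgroup.m_closed[OF Bs by'(1) ba'(1)] subgroup.m_closed[OF As ba'(2) ad(1)] .
    ultimately show "x \<in> B <#> A" unfolding mem_set_mult by blast
  qed
  moreover have "A <#> B \<subseteq> ?J" using set_mult_subset_subgroup[OF J inc] .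
  ultimately show "A <#> B = B <#> A" by (intro permutable_if_subset[OF As Bs]) blast
qed

lemma dist_imp:
  assumes join_dist
  shows comm_mod_D all_permute product_dist
proof -
  show comm: comm_mod_D using cyclic_comm[OF dist_cyclic[OF assms]] .
  show perm: all_permute
    by (rule D_dist_permute[OF comm]) (use assms sp_normal[OF D_normal] in \<open>unfold join_dist_def, blast\<close>)
  show product_dist
    unfolding product_dist_def
  proof (intro allI impI)
    fix A B C assume s: "sp A" "sp B" "sp C"
    have p: "B <#> C = C <#> B" "(A \<inter> B) <#> (A \<inter> C) = (A \<inter> C) <#> (A \<inter> B)"
      using perm s sp_Int unfolding all_permute_def by blast+
    show "A \<inter> (B <#> C) \<subseteq> (A \<inter> B) <#> (A \<inter> C)"
      using assms s generate_eq_set_mult[OF spD[OF s(2)] spD[OF s(3)] p(1)]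
        generate_eq_set_mult[OF spD[OF sp_Int[OF s(1,2)]] spD[OF sp_Int[OF s(1,3)]] p(2)]
      unfolding join_dist_def by metis
  qed
qed

lemma product_dist_imp_dist:
  assumes perm: all_permute and pd: product_dist
  shows join_dist
  unfolding join_dist_def
proof (intro allI impI)
  fix A B C assume s: "sp A" "sp B" "sp C"
  have p: "B <#> C = C <#> B" "(A \<inter> B) <#> (A \<inter> C) = (A \<inter> C) <#> (A \<inter> B)"
    using perm s sp_Int unfolding all_permute_def by blast+
  show "A \<inter> generate G (B \<union> C) \<subseteq> generate G ((A \<inter> B) \<union> (A \<inter> C))"
    using pd s generate_eq_set_mult[OF spD[OF s(2)] spD[OF s(3)] p(1)]
      generate_eq_set_mult[OF spD[OF sp_Int[OF s(1,2)]] spD[OF sp_Int[OF s(1,3)]] p(2)]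
    unfolding product_dist_def by metis
qed

end

text \<open>Preimages of members are members. A product of lifts of b and c lies in the full
  preimage of A as soon as b c lies in A, so the law in G can be applied to it and pushed
  down.\<close>

lemma (in hall_quot) quotient_perm_dist:
  assumes perm: all_permute and pd: product_dist
  shows "q.all_permute" "q.product_dist"
proof -
  have im: "f ` pre A = A" if "q.sp A" for A
    using subgroup.subset[OF q.spD[OF that]] surj by (auto simp: image_iff) (metis imageE subsetD)
  show "q.all_permute"
    unfolding q.all_permute_def
  proof (intro allI impI)
    fix A B assume s: "q.sp A" "q.sp B"
    have "pre A <#> pre B = pre B <#> pre A"
      using perm sp_pre[OF s(1)] sp_pre[OF s(2)] unfolding all_permute_def by blast
    then have "f ` pre A <#>\<^bsub>Gq\<^esub> f ` pre B = f ` pre B <#>\<^bsub>Gq\<^esub> f ` pre A"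
      using img_mult[of "pre A" "pre B"] img_mult[of "pre B" "pre A"] by force
    then show "A <#>\<^bsub>Gq\<^esub> B = B <#>\<^bsub>Gq\<^esub> A" unfolding im[OF s(1)] im[OF s(2)] .
  qed
  show "q.product_dist"
    unfolding q.product_dist_def
  proof (intro allI impI subsetI)
    fix A B C X assume s: "q.sp A" "q.sp B" "q.sp C" and X: "X \<in> A \<inter> (B <#>\<^bsub>Gq\<^esub> C)"
    obtain b c where bc: "b \<in> B" "c \<in> C" "X = b \<otimes>\<^bsub>Gq\<^esub> c" using IntD2[OF X] by (rule set_multE)
    obtain y z where yz: "y \<in> pre B" "z \<in> pre C" "b = f y" "c = f z"
    proof -
      have "b \<in> f ` pre B" "c \<in> f ` pre C" using bc(1,2) unfolding im[OF s(2)] im[OF s(3)] .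
      then show ?thesis using that by blast
    qed
    have Xyz: "X = f (y \<otimes> z)" using yz bc(3) by simp
    have "y \<otimes> z \<in> pre A" using Xyz X yz by simp
    moreover have "y \<otimes> z \<in> pre B <#> pre C" using yz by (intro set_multI)
    ultimately have "y \<otimes> z \<in> (pre A \<inter> pre B) <#> (pre A \<inter> pre C)"
      using pd sp_pre[OF s(1)] sp_pre[OF s(2)] sp_pre[OF s(3)] unfolding product_dist_def by blast
    then obtain u v where uv: "u \<in> pre A \<inter> pre B" "v \<in> pre A \<inter> pre C" "y \<otimes> z = u \<otimes> v"
      by (rule set_multE)
    have "X = f u \<otimes>\<^bsub>Gq\<^esub> f v" unfolding Xyz uv(3) using uv(1,2) by simp
    moreover have "f u \<in> A \<inter> B" "f v \<in> A \<inter> C" using uv(1,2) by blast+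
    ultimately show "X \<in> (A \<inter> B) <#>\<^bsub>Gq\<^esub> (A \<inter> C)" using set_multI[where G = Gq] by metis
  qed
qed

section \<open>Operator isomorphic sections\<close>

context group
begin

abbreviation "cm x y \<equiv> x \<otimes> y \<otimes> inv x \<otimes> inv y"

text \<open>Instance of [p m, y] = p [m, y] p^-1 [p, y]; the next lemma uses the analogous identity
  in the second argument.\<close>

lemma commutator_mult_left:
  assumes M: "subgroup M G" and X: "subgroup X G" and nrm: "normalizes G X M"
    and c: "cm p y \<in> M" "cm m y \<in> M" and p: "p \<in> X" "m \<in> carrier G" "y \<in> carrier G"
  shows "cm (p \<otimes> m) y \<in> M"
proof -
  have pc: "p \<in> carrier G" using subgroup.mem_carrier[OF X p(1)] .
  have "(p \<otimes> cm m y \<otimes> inv p) \<otimes> cm p y \<in> M"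
    using subgroup.m_closed[OF M normalizesD[OF nrm p(1) c(2)] c(1)] .
  then show ?thesis using pc p(2,3) by (simp add: word_simps)
qed

lemma commutator_mult_right:
  assumes M: "subgroup M G" and Y: "subgroup Y G" and nrm: "normalizes G Y M"
    and c: "cm x q \<in> M" "cm x n \<in> M" and q: "q \<in> Y" "n \<in> carrier G" "x \<in> carrier G"
  shows "cm x (q \<otimes> n) \<in> M"
proof -
  have qc: "q \<in> carrier G" using subgroup.mem_carrier[OF Y q(1)] .
  have "cm x q \<otimes> (q \<otimes> cm x n \<otimes> inv q) \<in> M"
    using subgroup.m_closed[OF M c(1) normalizesD[OF nrm q(1) c(2)]] .
  then show ?thesis using qc q(2,3) by (simp add: word_simps)
qed

lemma commutator_in_left:
  assumes X: "subgroup X G" and nrm: "normalizes G Y X" and x: "x \<in> X" and y: "y \<in> Y" "y \<in> carrier G"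
  shows "cm x y \<in> X"
proof -
  have xc: "x \<in> carrier G" using subgroup.mem_carrier[OF X x] .
  have "x \<otimes> (y \<otimes> inv x \<otimes> inv y) \<in> X"
    using subgroup.m_closed[OF X x normalizesD[OF nrm y(1) subgroup.m_inv_closed[OF X x]]] .
  then show ?thesis using xc y by (simp add: word_simps)
qed

lemma commutator_in_right:
  assumes Y: "subgroup Y G" and nrm: "normalizes G X Y" and x: "x \<in> X" and y: "y \<in> Y"
  shows "cm x y \<in> Y"
  using subgroup.m_closed[OF Y normalizesD[OF nrm x y] subgroup.m_inv_closed[OF Y y]] .

end

lemma (in hall_full) sp_set_mult:
  assumes perm: all_permute and A: "sp A" and B: "sp B"
  shows "sp (A <#> B)"
proof -
  have "A <#> B = B <#> A" using perm A B unfolding all_permute_def by blast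
  then show ?thesis using sp_join[OF A B] generate_eq_set_mult[OF spD[OF A] spD[OF B]] by simp
qed

text \<open>An operator isomorphism from H/K to L/K, encoded as a relation on elements:
  \<open>r x y\<close> means that the coset of x is mapped to the coset of y. Inverting the
  isomorphism then just exchanges the arguments (\<open>sym\<close>), and images of subgroups need
  no cosets.\<close>

locale section_rel = hall_full +
  fixes K H L :: "'a set" and r :: "'a \<Rightarrow> 'a \<Rightarrow> bool"
  assumes K: "sp K" and H: "sp H" and L: "sp L"
    and pH: "pi_number \<pi> (card H)" and pL: "pi_number \<pi> (card L)"
    and KH: "K \<subseteq> H" and KL: "K \<subseteq> L"
    and nKH: "normalizes G H K" and nKL: "normalizes G L K"
    and r_dom: "r x y \<Longrightarrow> x \<in> H \<and> y \<in> L"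
    and r_left: "x \<in> H \<Longrightarrow> \<exists>y. r x y" and r_right: "y \<in> L \<Longrightarrow> \<exists>x. r x y"
    and r_mult: "r x y \<Longrightarrow> r x' y' \<Longrightarrow> r (x \<otimes> x') (y \<otimes> y')"
    and r_inv: "r x y \<Longrightarrow> r (inv x) (inv y)"
    and r_K: "r x y \<Longrightarrow> x \<in> K \<longleftrightarrow> y \<in> K"
    and r_KK: "x \<in> K \<Longrightarrow> y \<in> K \<Longrightarrow> r x y"
    and r_op: "a \<in> P \<Longrightarrow> r x y \<Longrightarrow> r (a \<otimes> x \<otimes> inv a) (a \<otimes> y \<otimes> inv a)"
begin

lemma sym: "section_rel G \<pi> K L H (\<lambda>x y. r y x)"
  by (intro section_rel.intro section_rel_axioms.intro hall_full_axioms K H L pH pL KH KL nKH nKL)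
    (use r_dom r_left r_right r_mult r_inv r_K r_KK r_op in blast)+

definition "img X = {y. \<exists>x\<in>X. r x y}"
definition "mem X \<longleftrightarrow> sp X \<and> K \<subseteq> X \<and> X \<subseteq> H"

lemma Hs: "subgroup H G" and Ls: "subgroup L G" and Ks: "subgroup K G"
  using spD H L K by blast+

lemma r_diff:
  assumes "r x y" "r x' y'"
  shows "x \<otimes> inv x' \<in> K \<longleftrightarrow> y \<otimes> inv y' \<in> K"
  using r_K[OF r_mult[OF assms(1) r_inv[OF assms(2)]]] .

lemma img_subset: "img X \<subseteq> L"
  unfolding img_def using r_dom by blast

lemma mem_pi: "mem X \<Longrightarrow> pi_number \<pi> (card X)"
  unfolding mem_def using pi_number_dvd[OF card_subgroup_dvd[OF spD Hs] pH] by blast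

lemma img_props:
  assumes X: "mem X"
  shows "sp (img X)" "K \<subseteq> img X"
proof -
  have Xs: "subgroup X G" and sX: "sp X" and KX: "K \<subseteq> X" and XH: "X \<subseteq> H"
    using X spD unfolding mem_def by blast+
  have sub: "subgroup (img X) G"
  proof
    show "img X \<subseteq> carrier G" using img_subset subgroup.subset[OF Ls] by blast
    show "\<one> \<in> img X"
      unfolding img_def using r_KK[of \<one> \<one>] subgroup.one_closed[OF Ks] subgroup.one_closed[OF Xs] by blast
    fix y assume "y \<in> img X"
    then obtain x where x: "x \<in> X" "r x y" unfolding img_def by blast
    show "inv y \<in> img X" unfolding img_def using r_inv[OF x(2)] subgroup.m_inv_closed[OF Xs x(1)] by blast
    fix y' assume "y' \<in> img X"
    then obtain x' where x': "x' \<in> X" "r x' y'" unfolding img_def by blast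
    show "y \<otimes> y' \<in> img X"
      unfolding img_def using r_mult[OF x(2) x'(2)] subgroup.m_closed[OF Xs x(1) x'(1)] by blast
  qed
  have "normalizes G P (img X)"
  proof (rule normalizesI)
    fix a y assume a: "a \<in> P" and "y \<in> img X"
    then obtain x where x: "x \<in> X" "r x y" unfolding img_def by blast
    have "a \<otimes> x \<otimes> inv a \<in> X" using normalizesD[OF sp_pi_subgroup(2)[OF sX mem_pi[OF X]] a x(1)] .
    then show "a \<otimes> y \<otimes> inv a \<in> img X" unfolding img_def using r_op[OF a x(2)] by blast
  qed
  moreover have "img X \<subseteq> S" if "hall S" for S
    using img_subset sp_pi_subgroup(1)[OF L pL that] by blast
  ultimately show "sp (img X)" using pi_subgroup_sp(1)[OF sub] by blast
  show "K \<subseteq> img X"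
    unfolding img_def using r_KK KX subgroup.one_closed[OF Ks] by blast
qed

lemma img_pre:
  assumes X: "subgroup X G" "K \<subseteq> X" "X \<subseteq> H" and x: "r x y" "y \<in> img X"
  shows "x \<in> X"
proof -
  obtain x' where x': "x' \<in> X" "r x' y" using x(2) unfolding img_def by blast
  have yc: "y \<in> carrier G" using r_dom[OF x(1)] subgroup.mem_carrier[OF Ls] by blast
  have xc: "x \<in> carrier G" "x' \<in> carrier G"
    using r_dom[OF x(1)] r_dom[OF x'(2)] subgroup.mem_carrier[OF Hs] by blast+
  have "y \<otimes> inv y \<in> K" using yc subgroup.one_closed[OF Ks] by simp
  then have "x \<otimes> inv x' \<in> X" using r_diff[OF x(1) x'(2)] X(2) by blast
  then have "x \<otimes> inv x' \<otimes> x' \<in> X" using subgroup.m_closed[OF X(1)] x'(1) by blast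
  then show ?thesis using xc by (simp add: word_simps)
qed

definition "pimg Z = {x. \<exists>z\<in>Z. r x z}"

lemma pimg_mem:
  assumes Z: "sp Z" "K \<subseteq> Z" "Z \<subseteq> L"
  shows "mem (pimg Z)" "img (pimg Z) = Z"
proof -
  interpret sym: section_rel G \<pi> K L H "\<lambda>x y. r y x" by (rule sym)
  have e: "sym.img Z = pimg Z" unfolding sym.img_def pimg_def ..
  have "sym.mem Z" using Z unfolding sym.mem_def by blast
  then show "mem (pimg Z)"
    using sym.img_props[of Z] sym.img_subset[of Z] unfolding e mem_def by blast
  have Zs: "subgroup Z G" using Z spD by blast
  show "img (pimg Z) = Z"
  proof
    show "Z \<subseteq> img (pimg Z)" using r_right Z(3) unfolding img_def pimg_def by blast
    show "img (pimg Z) \<subseteq> Z"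
    proof
      fix y assume "y \<in> img (pimg Z)"
      then obtain x z where x: "r x y" "z \<in> Z" "r x z" unfolding img_def pimg_def by blast
      then have "x \<in> sym.img Z" unfolding e pimg_def by blast
      then show "y \<in> Z" using sym.img_pre[OF Zs Z(2,3) x(1)] by blast
    qed
  qed
qed

lemma img_mono: "X \<subseteq> Y \<Longrightarrow> img X \<subseteq> img Y"
  unfolding img_def by blast

text \<open>X is a minimal member moved by the isomorphism, Y its image and \<open>M = X \<inter> Y\<close>. As all proper members of
  X are fixed, conjugates of M in X stay inside Y, so M is normal in X, and dually in Y. The commutators of
  X and Y lie in M, hence the graph T of the isomorphism over M is a subgroup with \<open>X \<subseteq> T Y\<close> and
  \<open>X \<inter> T = X \<inter> Y = M\<close>.\<close>

lemma img_step:
  assumes perm: all_permute and pd: product_dist and comm: comm_mod_D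
    and X: "mem X" and IH: "\<And>Z. mem Z \<Longrightarrow> Z \<subset> X \<Longrightarrow> img Z = Z"
  shows "img X = X"
proof (rule ccontr)
  assume ne: "img X \<noteq> X"
  define Y where "Y = img X"
  have sX: "sp X" and KX: "K \<subseteq> X" and XH: "X \<subseteq> H" using X unfolding mem_def by blast+
  have sY: "sp Y" and KY: "K \<subseteq> Y" and YL: "Y \<subseteq> L"
    unfolding Y_def using img_props[OF X] img_subset by blast+
  have Xs: "subgroup X G" and Ys: "subgroup Y G" using sX sY spD by blast+
  have pX: "pi_number \<pi> (card X)" using mem_pi[OF X] .
  have pY: "pi_number \<pi> (card Y)"
    using pi_number_dvd[OF card_subgroup_dvd[OF Ys Ls YL] pL] .
  have nPX: "normalizes G P X" and nPY: "normalizes G P Y"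
    using sp_pi_subgroup(2)[OF sX pX] sp_pi_subgroup(2)[OF sY pY] .
  have Ps: "subgroup P G" using hall_join_subgroup .
  note carrX = subgroup.mem_carrier[OF Xs] and carrY = subgroup.mem_carrier[OF Ys]
  have pimg_X: "pimg Z \<subseteq> X" if "Z \<subseteq> Y" for Z
    using img_pre[OF Xs KX XH] that unfolding pimg_def Y_def by blast
  \<comment> \<open>If X lay inside its image Y, the inverse image W of X would be contained in X.
    It is not X, so it is a proper member and therefore fixed; but its image is X.\<close>
  have notsub: "\<not> X \<subseteq> Y"
  proof
    assume XY: "X \<subseteq> Y"
    have W: "mem (pimg X)" "img (pimg X) = X" using pimg_mem[OF sX KX] XY YL by blast+
    have "pimg X \<noteq> X" using W(2) ne by metis
    then have "pimg X \<subset> X" using pimg_X[OF XY] by blast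
    then have "img (pimg X) = pimg X" using IH[OF W(1)] by blast
    then show False using W(2) \<open>pimg X \<noteq> X\<close> by metis
  qed
  define M where "M = X \<inter> Y"
  have sM: "sp M" unfolding M_def using sp_Int[OF sX sY] .
  have Ms: "subgroup M G" using spD[OF sM] .
  have MX: "M \<subset> X" unfolding M_def using notsub by blast
  have memM: "mem M" unfolding mem_def M_def using sM M_def KX KY XH by blast
  have imgM: "img M = M" using IH[OF memM MX] .
  have KM: "K \<subseteq> M" unfolding M_def using KX KY by blast
  have nXM: "normalizes G X M"
  proof (rule normalizesI)
    fix v m assume v: "v \<in> X" and m: "m \<in> M"
    have vc: "v \<in> carrier G" using carrX[OF v] .
    have "K \<subseteq> conjg v M"
    proof
      fix k assume k: "k \<in> K"
      have "inv v \<otimes> k \<otimes> v \<in> K" using normalizesD_inv[OF nKH Hs _ k] v XH by blast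
      moreover have "k = v \<otimes> (inv v \<otimes> k \<otimes> v) \<otimes> inv v"
        using vc subgroup.mem_carrier[OF Ks k] by (simp add: word_simps)
      ultimately show "k \<in> conjg v M" unfolding conjg_def using KM by blast
    qed
    moreover have sub: "conjg v M \<subseteq> X"
      unfolding conjg_def using v MX subgroup.m_closed[OF Xs] subgroup.m_inv_closed[OF Xs] by blast
    moreover have "card (conjg v M) < card X"
      unfolding conjg_card[OF subgroup.subset[OF Ms] vc] by (rule psubset_card_mono[OF finsub[OF Xs] MX])
    moreover have "sp (conjg v M)" using sp_conjg[OF sM vc] .
    ultimately have "mem (conjg v M)" "conjg v M \<subset> X" unfolding mem_def using XH by auto
    then have "img (conjg v M) = conjg v M" by (rule IH)
    then have "conjg v M \<subseteq> Y" unfolding Y_def using img_mono[OF sub] by argo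
    moreover have "v \<otimes> m \<otimes> inv v \<in> conjg v M" unfolding conjg_def by (rule imageI[OF m])
    ultimately have "v \<otimes> m \<otimes> inv v \<in> X \<inter> Y" using sub by blast
    then show "v \<otimes> m \<otimes> inv v \<in> M" unfolding M_def .
  qed
  have nYM: "normalizes G Y M"
  proof (rule normalizesI)
    fix v m assume v: "v \<in> Y" and "m \<in> M"
    then have "m \<in> img M" using imgM by simp
    then obtain m' where m': "m' \<in> M" "r m' m" unfolding img_def by blast
    obtain u where u: "u \<in> X" "r u v" using v unfolding Y_def img_def by blast
    have "u \<otimes> m' \<otimes> inv u \<in> M" using normalizesD[OF nXM u(1) m'(1)] .
    moreover have "r (u \<otimes> m' \<otimes> inv u) (v \<otimes> m \<otimes> inv v)"
      using r_mult[OF r_mult[OF u(2) m'(2)] r_inv[OF u(2)]] .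
    ultimately have "v \<otimes> m \<otimes> inv v \<in> img M" unfolding img_def by blast
    then show "v \<otimes> m \<otimes> inv v \<in> M" unfolding imgM .
  qed
  have sP: "sp P" using sp_normal[OF P_normal] .
  have ZM: "sp ((A \<inter> P) <#> M)" "A \<inter> P \<subseteq> (A \<inter> P) <#> M" "M \<subseteq> (A \<inter> P) <#> M"
      "(A \<inter> P) <#> M \<subseteq> A" if A: "sp A" "M \<subseteq> A" for A
  proof -
    have sAP: "sp (A \<inter> P)" using sp_Int[OF A(1) sP] .
    show "sp ((A \<inter> P) <#> M)" using sp_set_mult[OF perm sAP sM] .
    show "A \<inter> P \<subseteq> (A \<inter> P) <#> M" using subset_set_mult_left[OF Ms subgroup.subset[OF spD[OF sAP]]] .
    show "M \<subseteq> (A \<inter> P) <#> M" using subset_set_mult_right[OF spD[OF sAP] subgroup.subset[OF Ms]] .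
    show "(A \<inter> P) <#> M \<subseteq> A" using set_mult_subset_subgroup[OF spD[OF A(1)]] A(2) by blast
  qed
  have MXs: "M \<subseteq> X" and MYs: "M \<subseteq> Y" unfolding M_def by blast+
  \<comment> \<open>(X \<inter> P) M is a member between M and X. It is either all of X or a proper
    member, hence fixed and inside Y, which puts X \<inter> P into M. The same alternative holds for
    Y through inverse images.\<close>
  have XP: "X \<inter> P \<subseteq> M \<or> X = (X \<inter> P) <#> M"
  proof (cases "X = (X \<inter> P) <#> M")
    case False
    let ?Z = "(X \<inter> P) <#> M"
    have "mem ?Z" unfolding mem_def using ZM[OF sX MXs] KM XH by blast
    moreover have "?Z \<subset> X" using ZM(4)[OF sX MXs] False by blast
    ultimately have "?Z \<subseteq> Y" using IH[of ?Z] img_mono[of ?Z X] unfolding Y_def by blast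
    then show ?thesis using ZM(2)[OF sX MXs] unfolding M_def by blast
  qed blast
  have YP: "Y \<inter> P \<subseteq> M \<or> Y = (Y \<inter> P) <#> M"
  proof (cases "Y = (Y \<inter> P) <#> M")
    case False
    let ?Z = "(Y \<inter> P) <#> M"
    have KZ: "K \<subseteq> ?Z" using ZM(3)[OF sY MYs] KM by blast
    have ZY: "?Z \<subseteq> Y" using ZM(4)[OF sY MYs] .
    have W: "mem (pimg ?Z)" "img (pimg ?Z) = ?Z"
      using pimg_mem[OF ZM(1)[OF sY MYs] KZ] ZY YL by blast+
    have "pimg ?Z \<noteq> X" using W(2) False unfolding Y_def by metis
    then have "pimg ?Z \<subset> X" using pimg_X[OF ZY] by blast
    then have "?Z \<subseteq> X" using IH[OF W(1)] W(2) by blast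
    then show ?thesis using ZM(2)[OF sY MYs] unfolding M_def by blast
  qed blast
  note PnX = normalizes_mono[OF normal_normalizes[OF P_normal] subgroup.subset[OF Xs]]
  note PnY = normalizes_mono[OF normal_normalizes[OF P_normal] subgroup.subset[OF Ys]]
  have cPP: "cm p q \<in> M" if "p \<in> X \<inter> P" "q \<in> Y \<inter> P" for p q
    using that commutator_in_left[OF Xs nPX _ _ carrY, of p q] commutator_in_right[OF Ys nPY, of p q]
    unfolding M_def by blast
  have cPY: "cm p y \<in> Y \<inter> P" if "p \<in> X \<inter> P" "y \<in> Y" for p y
    using that commutator_in_left[OF Ps PnY _ _ carrY, of p y] commutator_in_right[OF Ys nPY, of p y] by blast
  have cXP: "cm x q \<in> X \<inter> P" if "x \<in> X" "q \<in> Y \<inter> P" for x q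
    using that commutator_in_left[OF Xs nPX _ _ carrY, of x q] commutator_in_right[OF Ps PnX, of x q] by blast
  have cMY: "cm m y \<in> M" if "m \<in> M" "y \<in> Y" for m y
    using that commutator_in_left[OF Ms nYM _ _ carrY, of m y] by blast
  have cXM: "cm x m \<in> M" if "x \<in> X" "m \<in> M" for x m
    using that commutator_in_right[OF Ms nXM, of x m] by blast
  have ext_l: "cm x y \<in> M" if "X = (X \<inter> P) <#> M" "x \<in> X" "y \<in> Y" "\<And>p. p \<in> X \<inter> P \<Longrightarrow> cm p y \<in> M" for x y
  proof -
    have "x \<in> (X \<inter> P) <#> M" using that(1,2) by argo
    then obtain p m where pm: "p \<in> X \<inter> P" "m \<in> M" "x = p \<otimes> m" by (rule set_multE)
    show ?thesis unfolding pm(3)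
      by (rule commutator_mult_left[OF Ms Xs nXM that(4)[OF pm(1)] cMY[OF pm(2) that(3)]])
        (use pm subgroup.mem_carrier[OF Ms] carrY that(3) in blast)+
  qed
  have ext_r: "cm x y \<in> M" if "Y = (Y \<inter> P) <#> M" "x \<in> X" "y \<in> Y" "\<And>q. q \<in> Y \<inter> P \<Longrightarrow> cm x q \<in> M" for x y
  proof -
    have "y \<in> (Y \<inter> P) <#> M" using that(1,3) by argo
    then obtain q m where qm: "q \<in> Y \<inter> P" "m \<in> M" "y = q \<otimes> m" by (rule set_multE)
    show ?thesis unfolding qm(3)
      by (rule commutator_mult_right[OF Ms Ys nYM that(4)[OF qm(1)] cXM[OF that(2) qm(2)]])
        (use qm subgroup.mem_carrier[OF Ms] carrX that(2) in blast)+
  qed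
  \<comment> \<open>If X = (X \<inter> P) M, commutators reduce to those with elements of
    \<open>P\<close>, which normalizes both X and Y; likewise for Y. In the remaining case [x, y]
    lies in D, hence in \<open>P\<close> \<inter> X Y, and the distributive law places it in
    (\<open>P\<close> \<inter> X)(\<open>P\<close> \<inter> Y), which is inside M.\<close>
  have commM: "cm x y \<in> M" if xy: "x \<in> X" "y \<in> Y" for x y
  proof (cases "X = (X \<inter> P) <#> M")
    case XT: True
    show ?thesis
    proof (cases "Y = (Y \<inter> P) <#> M")
      case True
      show ?thesis
      proof (rule ext_l[OF XT xy])
        fix p assume p: "p \<in> X \<inter> P"
        then have "p \<in> X" by blast
        then show "cm p y \<in> M" using ext_r[OF True _ xy(2)] cPP[OF p] by blast
      qed
    next
      case False
      then have YM: "Y \<inter> P \<subseteq> M" using YP by blast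
      show ?thesis by (rule ext_l[OF XT xy]) (use cPY[OF _ xy(2)] YM in blast)
    qed
  next
    case False
    then have XM: "X \<inter> P \<subseteq> M" using XP by blast
    show ?thesis
    proof (cases "Y = (Y \<inter> P) <#> M")
      case True
      show ?thesis by (rule ext_r[OF True xy]) (use cXP[OF xy(1)] XM in blast)
    next
      case False
      then have YM: "Y \<inter> P \<subseteq> M" using YP by blast
      have XYs: "subgroup (X <#> Y) G" using spD[OF sp_set_mult[OF perm sX sY]] .
      have "x \<in> X <#> Y" "y \<in> X <#> Y"
        using xy subset_set_mult_left[OF Ys subgroup.subset[OF Xs]]
          subset_set_mult_right[OF Xs subgroup.subset[OF Ys]] by blast+
      then have "cm x y \<in> X <#> Y"
        using subgroup.m_closed[OF XYs] subgroup.m_inv_closed[OF XYs] by blast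
      moreover have "cm x y \<in> P" using comm carrX[OF xy(1)] carrY[OF xy(2)] unfolding comm_mod_D_def by blast
      ultimately have "cm x y \<in> (P \<inter> X) <#> (P \<inter> Y)" using pd sP sX sY unfolding product_dist_def by blast
      moreover have "(P \<inter> X) <#> (P \<inter> Y) \<subseteq> M"
        using XM YM by (intro set_mult_subset_subgroup[OF Ms]) blast+
      ultimately show ?thesis by blast
    qed
  qed
  \<comment> \<open>The factor z makes \<open>T\<close> a union of cosets of M. Modulo M the groups
    X and Y commute and meet trivially, and \<open>T\<close> is a diagonal of their direct
    product.\<close>
  define T where "T = {g. \<exists>x y z. r x y \<and> x \<in> X \<and> z \<in> M \<and> g = x \<otimes> y \<otimes> z}"
  have r_Y: "y \<in> Y" if "r x y" "x \<in> X" for x y using that unfolding Y_def img_def by blast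
  have Ts: "subgroup T G"
  proof
    show "T \<subseteq> carrier G"
      using carrX carrY r_Y subgroup.mem_carrier[OF Ms] unfolding T_def by blast
    have "r \<one> \<one>" using r_KK subgroup.one_closed[OF Ks] by blast
    then show "\<one> \<in> T" unfolding T_def
      using subgroup.one_closed[OF Xs] subgroup.one_closed[OF Ms]
      by (intro CollectI exI[of _ \<one>]) simp
    fix g assume "g \<in> T"
    then obtain x y z where g: "r x y" "x \<in> X" "z \<in> M" "g = x \<otimes> y \<otimes> z" unfolding T_def by blast
    have yY: "y \<in> Y" using r_Y[OF g(1,2)] .
    have c: "x \<in> carrier G" "y \<in> carrier G" "z \<in> carrier G"
      using carrX[OF g(2)] carrY[OF yY] subgroup.mem_carrier[OF Ms g(3)] .
    have wY: "y \<otimes> z \<in> Y" using subgroup.m_closed[OF Ys yY] g(3) MYs by blast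
    show "inv g \<in> T"
    proof -
      have d: "inv (cm x (y \<otimes> z)) \<in> M" using subgroup.m_inv_closed[OF Ms commM[OF g(2) wY]] .
      have e: "y \<otimes> inv z \<otimes> inv y \<in> M" using normalizesD[OF nYM yY subgroup.m_inv_closed[OF Ms g(3)]] .
      have "inv g = inv x \<otimes> inv y \<otimes> ((y \<otimes> inv z \<otimes> inv y) \<otimes> inv (cm x (y \<otimes> z)))"
        unfolding g(4) using c by (simp add: word_simps)
      then show ?thesis unfolding T_def
        using r_inv[OF g(1)] subgroup.m_inv_closed[OF Xs g(2)] subgroup.m_closed[OF Ms e d] by blast
    qed
    fix g' assume "g' \<in> T"
    then obtain x' y' z' where g': "r x' y'" "x' \<in> X" "z' \<in> M" "g' = x' \<otimes> y' \<otimes> z'" unfolding T_def by blast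
    have yY': "y' \<in> Y" using r_Y[OF g'(1,2)] .
    have c': "x' \<in> carrier G" "y' \<in> carrier G" "z' \<in> carrier G"
      using carrX[OF g'(2)] carrY[OF yY'] subgroup.mem_carrier[OF Ms g'(3)] .
    show "g \<otimes> g' \<in> T"
    proof -
      \<comment> \<open>The error in M that arises when x' is moved to the left across y z.\<close>
      let ?d = "inv (cm (inv x') (inv (y \<otimes> z)))"
      have d: "?d \<in> M"
        using subgroup.m_inv_closed[OF Ms commM[OF subgroup.m_inv_closed[OF Xs g'(2)] subgroup.m_inv_closed[OF Ys wY]]] .
      have e: "inv y' \<otimes> (z \<otimes> ?d) \<otimes> y' \<in> M"
        using normalizesD_inv[OF nYM Ys yY' subgroup.m_closed[OF Ms g(3) d]] .
      have "g \<otimes> g' = (x \<otimes> x') \<otimes> (y \<otimes> y') \<otimes> ((inv y' \<otimes> (z \<otimes> ?d) \<otimes> y') \<otimes> z')"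
        unfolding g(4) g'(4) using c c' by (simp add: word_simps)
      then show ?thesis unfolding T_def
        using r_mult[OF g(1) g'(1)] subgroup.m_closed[OF Xs g(2) g'(2)] subgroup.m_closed[OF Ms e g'(3)] by blast
    qed
  qed
  have nPT: "normalizes G P T"
  proof (rule normalizesI)
    fix a g assume a: "a \<in> P" and "g \<in> T"
    then obtain x y z where g: "r x y" "x \<in> X" "z \<in> M" "g = x \<otimes> y \<otimes> z" unfolding T_def by blast
    have c: "x \<in> carrier G" "y \<in> carrier G" "z \<in> carrier G" "a \<in> carrier G"
      using carrX[OF g(2)] carrY[OF r_Y[OF g(1,2)]] subgroup.mem_carrier[OF Ms g(3)]
        subgroup.mem_carrier[OF Ps a] .
    have "a \<otimes> z \<otimes> inv a \<in> M"
      using normalizesD[OF nPX a] normalizesD[OF nPY a] g(3) unfolding M_def by blast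
    moreover have "a \<otimes> g \<otimes> inv a = (a \<otimes> x \<otimes> inv a) \<otimes> (a \<otimes> y \<otimes> inv a) \<otimes> (a \<otimes> z \<otimes> inv a)"
      unfolding g(4) using c by (simp add: word_simps)
    ultimately show "a \<otimes> g \<otimes> inv a \<in> T" unfolding T_def
      using r_op[OF a g(1)] normalizesD[OF nPX a g(2)] by blast
  qed
  have "T \<subseteq> S" if S: "hall S" for S
  proof -
    have "X \<subseteq> S" "Y \<subseteq> S" using sp_pi_subgroup(1)[OF sX pX S] sp_pi_subgroup(1)[OF sY pY S] .
    moreover note m = subgroup.m_closed[OF hallD(1)[OF S]]
    moreover have "x \<otimes> y \<otimes> z \<in> S" if "r x y" "x \<in> X" "z \<in> M" for x y z
      using m[OF m] \<open>X \<subseteq> S\<close> \<open>Y \<subseteq> S\<close> r_Y[OF that(1,2)] that(2,3) MXs by blast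
    ultimately show ?thesis unfolding T_def by blast
  qed
  then have sT: "sp T" using pi_subgroup_sp(1)[OF Ts _ nPT] by blast
  have TX: "X \<inter> T \<subseteq> M"
  proof
    fix g assume gXT: "g \<in> X \<inter> T"
    then obtain x y z where g: "r x y" "x \<in> X" "z \<in> M" "g = x \<otimes> y \<otimes> z" unfolding T_def by blast
    have yY: "y \<in> Y" using r_Y[OF g(1,2)] .
    have c: "x \<in> carrier G" "y \<in> carrier G" "z \<in> carrier G"
      using carrX[OF g(2)] carrY[OF yY] subgroup.mem_carrier[OF Ms g(3)] .
    have "y = inv x \<otimes> g \<otimes> inv z" unfolding g(4) using c by (simp add: word_simps)
    moreover have "inv x \<otimes> g \<otimes> inv z \<in> X"
      using subgroup.m_closed[OF Xs subgroup.m_closed[OF Xs subgroup.m_inv_closed[OF Xs g(2)] IntD1[OF gXT]]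
          subgroup.m_inv_closed[OF Xs subsetD[OF MXs g(3)]]] .
    ultimately have "y \<in> X" by simp
    then have yM: "y \<in> M" unfolding M_def using yY by (rule IntI)
    then have "y \<in> img M" unfolding imgM .
    then have xM: "x \<in> M" using img_pre[OF Ms KM _ g(1)] MXs XH by blast
    show "g \<in> M" unfolding g(4) using subgroup.m_closed[OF Ms subgroup.m_closed[OF Ms xM yM] g(3)] .
  qed
  have "X \<subseteq> T <#> Y"
  proof
    fix x assume x: "x \<in> X"
    obtain y where y: "r x y" using r_left x XH by blast
    have yY: "y \<in> Y" using r_Y[OF y x] .
    have "x \<otimes> y \<otimes> \<one> \<in> T" unfolding T_def using y x subgroup.one_closed[OF Ms] by blast
    moreover have "x = (x \<otimes> y \<otimes> \<one>) \<otimes> inv y" using carrX[OF x] carrY[OF yY] by (simp add: word_simps)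
    ultimately show "x \<in> T <#> Y" using subgroup.m_inv_closed[OF Ys yY] unfolding mem_set_mult by blast
  qed
  then have "X \<subseteq> (X \<inter> T) <#> (X \<inter> Y)" using pd sX sT sY unfolding product_dist_def by blast
  also have "\<dots> \<subseteq> M" using TX by (intro set_mult_subset_subgroup[OF Ms]) (auto simp: M_def)
  finally show False using MX by blast
qed

text \<open>Induction on the order shows that every member between K and H is fixed. H itself is one
  of them, and its image is L.\<close>

lemma sections_eq:
  assumes perm: all_permute and pd: product_dist and comm: comm_mod_D
  shows "H = L"
proof -
  have "img X = X" if "mem X" for X
    using that
  proof (induction "card X" arbitrary: X rule: less_induct)
    case less
    have "finite X" using less.prems finsub spD unfolding mem_def by blast
    then show ?case
      using less by (intro img_step[OF perm pd comm less.prems] less.hyps psubset_card_mono) blast+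
  qed
  moreover have "mem H" using H KH unfolding mem_def by blast
  ultimately have "img H = H" by blast
  moreover have "img H = L" using img_subset r_right r_dom unfolding img_def by blast
  ultimately show ?thesis by metis
qed

end

lemma (in group) normal_in_subgroup:
  assumes H: "subgroup H G" and K: "K \<lhd> G\<lparr>carrier := H\<rparr>"
  shows "subgroup K G" "K \<subseteq> H" "normalizes G H K"
proof -
  interpret GH: group "G\<lparr>carrier := H\<rparr>" using subgroup.subgroup_is_group[OF H is_group] .
  show "subgroup K G" using incl_subgroup[OF H normal_imp_subgroup[OF K]] .
  show "K \<subseteq> H" using subgroup.subset[OF normal_imp_subgroup[OF K]] by simp
  show "normalizes G H K"
    using GH.normal_normalizes[OF K] m_inv_consistent[OF H] unfolding normalizes_def by simp
qed

lemma (in group) normal_in_subgroupI: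
  assumes H: "subgroup H G" and K: "subgroup K G" "K \<subseteq> H" and nrm: "normalizes G H K"
  shows "K \<lhd> G\<lparr>carrier := H\<rparr>"
proof -
  interpret GH: group "G\<lparr>carrier := H\<rparr>" using subgroup.subgroup_is_group[OF H is_group] .
  show ?thesis unfolding GH.normal_iff_normalizes
    using subgroup_incl[OF K(1) H K(2)] nrm m_inv_consistent[OF H] unfolding normalizes_def by simp
qed

section \<open>Operator isomorphisms from distributivity, and from complements\<close>

context hall_full
begin

lemma sections_coincide:
  assumes perm: all_permute and pd: product_dist and comm: comm_mod_D
  shows "isomorphic_sections_coincide \<pi> \<pi> G"
  unfolding isomorphic_sections_coincide_def
proof (intro allI impI, elim conjE)
  fix K H L
  assume s: "\<forall>X\<in>{K, H, L}. sp X \<and> pi_subgroup \<pi> G X"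
    and nKH: "K \<lhd> G\<lparr>carrier := H\<rparr>" and nKL: "K \<lhd> G\<lparr>carrier := L\<rparr>"
    and op: "operator_isomorphic G (pi_residual \<pi> G) K H L"
  have K: "sp K" and H: "sp H" and L: "sp L" using s by auto
  have pH: "pi_number \<pi> (card H)" and pL: "pi_number \<pi> (card L)"
    using s pi_subgroup_iff[OF fin] by auto
  note Hs = spD[OF H] and Ls = spD[OF L]
  note KH = normal_in_subgroup[OF Hs nKH] and KL = normal_in_subgroup[OF Ls nKL]
  let ?H = "G\<lparr>carrier := H\<rparr>" and ?L = "G\<lparr>carrier := L\<rparr>"
  obtain \<phi> where \<phi>: "\<phi> \<in> iso (?H Mod K) (?L Mod K)"
    and \<phi>_op: "\<And>a h l. a \<in> P \<Longrightarrow> h \<in> H \<Longrightarrow> l \<in> L \<Longrightarrow> \<phi> (K #> h) = K #> l \<Longrightarrow>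
          \<phi> (K #> (inv a \<otimes> h \<otimes> a)) = K #> (inv a \<otimes> l \<otimes> a)"
    using op unfolding operator_isomorphic_def pi_residual_eq by blast
  interpret H: group ?H using subgroup.subgroup_is_group[OF Hs is_group] .
  interpret L: group ?L using subgroup.subgroup_is_group[OF Ls is_group] .
  interpret fH: group_hom ?H "?H Mod K" "\<lambda>x. K #>\<^bsub>?H\<^esub> x" using H.quotient_hom(1)[OF nKH] .
  interpret fL: group_hom ?L "?L Mod K" "\<lambda>x. K #>\<^bsub>?L\<^esub> x" using L.quotient_hom(1)[OF nKL] .
  interpret \<phi>: group_hom "?H Mod K" "?L Mod K" \<phi>
    by (intro group_hom.intro group_hom_axioms.intro fH.H.is_group fL.H.is_group) (use \<phi> iso_imp_homomorphism in blast)
  have cos: "K #>\<^bsub>?H\<^esub> x = K #> x" "K #>\<^bsub>?L\<^esub> x = K #> x" for x by (simp_all add: r_coset_def)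
  have bij: "bij_betw \<phi> (carrier (?H Mod K)) (carrier (?L Mod K))" using \<phi> by (simp add: iso_def)
  have surjH: "(\<lambda>x. K #> x) ` H = carrier (?H Mod K)" using H.quotient_hom(2)[OF nKH] unfolding cos by simp
  have surjL: "(\<lambda>x. K #> x) ` L = carrier (?L Mod K)" using L.quotient_hom(2)[OF nKL] unfolding cos by simp
  have one: "\<one>\<^bsub>?H Mod K\<^esub> = K" "\<one>\<^bsub>?L Mod K\<^esub> = K" by simp_all
  have inK: "K #> x = K \<longleftrightarrow> x \<in> K" if "x \<in> carrier G" for x
    using rcos_eq_iff[OF KH(1) that one_closed] that subgroup.subset[OF KH(1)] by simp
  define r where "r x y \<longleftrightarrow> x \<in> H \<and> y \<in> L \<and> \<phi> (K #> x) = K #> y" for x y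
  interpret section_rel G \<pi> K H L r
  proof (intro section_rel.intro section_rel_axioms.intro hall_full_axioms K H L pH pL KH(2,3) KL(2,3))
    show "x \<in> H \<and> y \<in> L" if "r x y" for x y using that unfolding r_def by blast
    show "\<exists>y. r x y" if x: "x \<in> H" for x
    proof -
      have "\<phi> (K #> x) \<in> carrier (?L Mod K)" using bij x surjH unfolding bij_betw_def by blast
      then show ?thesis using x unfolding r_def surjL[symmetric] by blast
    qed
    show "\<exists>x. r x y" if y: "y \<in> L" for y
    proof -
      have "K #> y \<in> \<phi> ` carrier (?H Mod K)" using bij y surjL unfolding bij_betw_def by blast
      then obtain x where "x \<in> H" "K #> y = \<phi> (K #> x)" unfolding surjH[symmetric] by blast
      then show ?thesis using y unfolding r_def by metis
    qed
    show "r (x \<otimes> x') (y \<otimes> y')" if r: "r x y" "r x' y'" for x y x' y'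
    proof -
      have m: "x \<in> H" "x' \<in> H" "y \<in> L" "y' \<in> L" and e: "\<phi> (K #> x) = K #> y" "\<phi> (K #> x') = K #> y'"
        using r unfolding r_def by blast+
      have c: "K #> x \<in> carrier (?H Mod K)" "K #> x' \<in> carrier (?H Mod K)" using m surjH by blast+
      have "\<phi> (K #> (x \<otimes> x')) = \<phi> ((K #> x) \<otimes>\<^bsub>?H Mod K\<^esub> (K #> x'))"
        using fH.hom_mult[of x x'] m unfolding cos by simp
      also have "\<dots> = (K #> y) \<otimes>\<^bsub>?L Mod K\<^esub> (K #> y')" using \<phi>.hom_mult[OF c] unfolding e .
      also have "\<dots> = K #> (y \<otimes> y')" using fL.hom_mult[of y y'] m unfolding cos by simp
      finally show ?thesis unfolding r_def
        using m subgroup.m_closed[OF Hs] subgroup.m_closed[OF Ls] by blast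
    qed
    show "r (inv x) (inv y)" if r: "r x y" for x y
    proof -
      have m: "x \<in> H" "y \<in> L" and e: "\<phi> (K #> x) = K #> y" using r unfolding r_def by blast+
      have c: "K #> x \<in> carrier (?H Mod K)" using m surjH by blast
      have "\<phi> (K #> inv x) = \<phi> (inv\<^bsub>?H Mod K\<^esub> (K #> x))"
        using fH.hom_inv[of x] m m_inv_consistent[OF Hs m(1)] unfolding cos by simp
      also have "\<dots> = inv\<^bsub>?L Mod K\<^esub> (K #> y)" using \<phi>.hom_inv[OF c] unfolding e .
      also have "\<dots> = K #> inv y"
        using fL.hom_inv[of y] m m_inv_consistent[OF Ls m(2)] unfolding cos by simp
      finally show ?thesis unfolding r_def
        using m subgroup.m_inv_closed[OF Hs] subgroup.m_inv_closed[OF Ls] by blast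
    qed
    have \<phi>K: "\<phi> K = K" using \<phi>.hom_one unfolding one .
    show "x \<in> K \<longleftrightarrow> y \<in> K" if r: "r x y" for x y
    proof -
      have m: "x \<in> H" "y \<in> L" and e: "\<phi> (K #> x) = K #> y" using r unfolding r_def by blast+
      have mc: "x \<in> carrier G" "y \<in> carrier G"
        using subgroup.mem_carrier[OF Hs m(1)] subgroup.mem_carrier[OF Ls m(2)] .
      have "K #> x \<in> carrier (?H Mod K)" using m(1) unfolding surjH[symmetric] by (rule imageI)
      moreover have "K \<in> carrier (?H Mod K)" using fH.H.one_closed unfolding one .
      ultimately have "\<phi> (K #> x) = \<phi> K \<longleftrightarrow> K #> x = K"
        by (rule inj_on_eq_iff[OF bij_betw_imp_inj_on[OF bij]])
      then show ?thesis unfolding e \<phi>K inK[OF mc(1)] inK[OF mc(2)] by blast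
    qed
    show "r x y" if m: "x \<in> K" "y \<in> K" for x y
    proof -
      have "K #> x = K" "K #> y = K"
        using inK[OF subgroup.mem_carrier[OF KH(1) m(1)]] inK[OF subgroup.mem_carrier[OF KH(1) m(2)]] m by blast+
      then show ?thesis unfolding r_def using subsetD[OF KH(2) m(1)] subsetD[OF KL(2) m(2)] \<phi>K by simp
    qed
    show "r (a \<otimes> x \<otimes> inv a) (a \<otimes> y \<otimes> inv a)" if a: "a \<in> P" and r: "r x y" for a x y
    proof -
      have m: "x \<in> H" "y \<in> L" and e: "\<phi> (K #> x) = K #> y" using r unfolding r_def by blast+
      have "a \<otimes> x \<otimes> inv a \<in> H" "a \<otimes> y \<otimes> inv a \<in> L"
        using normalizesD[OF sp_pi_subgroup(2)[OF H pH] a m(1)] normalizesD[OF sp_pi_subgroup(2)[OF L pL] a m(2)] .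
      \<comment> \<open>\<open>operator_isomorphic\<close> conjugates as a^-1 h a while the relation
        uses a x a^-1, so the hypothesis is applied to \<open>inv a\<close>.\<close>
      moreover have "inv a \<in> P" using subgroup.m_inv_closed[OF hall_join_subgroup a] .
      then have "\<phi> (K #> (inv (inv a) \<otimes> x \<otimes> inv a)) = K #> (inv (inv a) \<otimes> y \<otimes> inv a)"
        using \<phi>_op m e by blast
      moreover have "inv (inv a) = a" using subgroup.mem_carrier[OF hall_join_subgroup a] by simp
      ultimately show ?thesis unfolding r_def by simp
    qed
  qed
  show "H = L" using sections_eq[OF perm pd comm] .
qed

text \<open>X/K and Y/K with K = X \<inter> Z are both isomorphic to the common factor XZ/Z = YZ/Z.
  The composite sends the coset of x to that of y when x^-1 y lies in Z, and it respects the
  operators because \<open>P\<close> normalizes the \<pi>-member Z.\<close>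

lemma sections_cancel:
  assumes coinc: "isomorphic_sections_coincide \<pi> \<pi> G"
    and X: "sp X" "pi_number \<pi> (card X)" and Y: "sp Y" "pi_number \<pi> (card Y)" and Z: "sp Z" "pi_number \<pi> (card Z)"
    and int: "X \<inter> Z = Y \<inter> Z" and prod: "X <#> Z = Y <#> Z"
    and nX: "normalizes G X Z" and nY: "normalizes G Y Z"
  shows "X = Y"
proof -
  define K where "K = X \<inter> Z"
  have K': "K = Y \<inter> Z" unfolding K_def int ..
  note Xs = spD[OF X(1)] and Ys = spD[OF Y(1)] and Zs = spD[OF Z(1)]
  have sK: "sp K" unfolding K_def using sp_Int[OF X(1) Z(1)] .
  note Ks = spD[OF sK]
  have pK: "pi_number \<pi> (card K)"
    using pi_number_dvd[OF card_subgroup_dvd[OF Ks Xs] X(2)] unfolding K_def by blast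
  have KX: "K \<subseteq> X" and KY: "K \<subseteq> Y" and KZ: "K \<subseteq> Z" using K_def K' by blast+
  have conj_closed: "x \<otimes> y \<otimes> inv x \<in> A" if "subgroup A G" "x \<in> A" "y \<in> A" for A x y
    using subgroup.m_closed[OF that(1) subgroup.m_closed[OF that(1,2,3)] subgroup.m_inv_closed[OF that(1,2)]] .
  have nXK: "normalizes G X K"
    using normalizesD[OF nX] conj_closed[OF Xs] unfolding normalizes_def K_def by blast
  have nYK: "normalizes G Y K"
    using normalizesD[OF nY] conj_closed[OF Ys] unfolding normalizes_def K' by blast
  have KnX: "K \<lhd> G\<lparr>carrier := X\<rparr>" using normal_in_subgroupI[OF Xs Ks KX nXK] .
  have KnY: "K \<lhd> G\<lparr>carrier := Y\<rparr>" using normal_in_subgroupI[OF Ys Ks KY nYK] .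
  let ?X = "G\<lparr>carrier := X\<rparr>" and ?Y = "G\<lparr>carrier := Y\<rparr>"
  interpret GX: group ?X using subgroup.subgroup_is_group[OF Xs is_group] .
  interpret GY: group ?Y using subgroup.subgroup_is_group[OF Ys is_group] .
  interpret fX: group_hom ?X "?X Mod K" "\<lambda>x. K #>\<^bsub>?X\<^esub> x" using GX.quotient_hom(1)[OF KnX] .
  interpret fY: group_hom ?Y "?Y Mod K" "\<lambda>x. K #>\<^bsub>?Y\<^esub> x" using GY.quotient_hom(1)[OF KnY] .
  have cos: "K #>\<^bsub>?X\<^esub> x = K #> x" "K #>\<^bsub>?Y\<^esub> x = K #> x" for x by (simp_all add: r_coset_def)
  have surjX: "(\<lambda>x. K #> x) ` X = carrier (?X Mod K)" using GX.quotient_hom(2)[OF KnX] unfolding cos by simp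
  have surjY: "(\<lambda>x. K #> x) ` Y = carrier (?Y Mod K)" using GY.quotient_hom(2)[OF KnY] unfolding cos by simp
  note cX = subgroup.mem_carrier[OF Xs] and cY = subgroup.mem_carrier[OF Ys] and cZ = subgroup.mem_carrier[OF Zs]
    and cK = subgroup.mem_carrier[OF Ks]
  have ex_Y: "\<exists>y\<in>Y. inv x \<otimes> y \<in> Z" if x: "x \<in> X" for x
  proof -
    have "x \<in> Y <#> Z" using subset_set_mult_left[OF Zs subgroup.subset[OF Xs]] x unfolding prod by blast
    then obtain y z where yz: "y \<in> Y" "z \<in> Z" "x = y \<otimes> z" by (rule set_multE)
    have "inv x \<otimes> y = inv z" unfolding yz(3) using cY[OF yz(1)] cZ[OF yz(2)] by (simp add: word_simps)
    then show ?thesis using yz subgroup.m_inv_closed[OF Zs] by metis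
  qed
  have ex_X: "\<exists>x\<in>X. inv x \<otimes> y \<in> Z" if y: "y \<in> Y" for y
  proof -
    have "y \<in> X <#> Z" using subset_set_mult_left[OF Zs subgroup.subset[OF Ys]] y unfolding prod by blast
    then obtain x z where xz: "x \<in> X" "z \<in> Z" "y = x \<otimes> z" by (rule set_multE)
    have "inv x \<otimes> y = z" unfolding xz(3) using cX[OF xz(1)] cZ[OF xz(2)] by (simp add: word_simps)
    then show ?thesis using xz by metis
  qed
  have K_eq: "K #> x = K #> y \<longleftrightarrow> x \<otimes> inv y \<in> K" if "x \<in> carrier G" "y \<in> carrier G" for x y
    using rcos_eq_iff[OF Ks that] .
  \<comment> \<open>The chosen y depends on the coset alone, as the representative x is bound
    inside; \<open>\<phi>_iff\<close> shows that neither choice matters.\<close>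
  define \<phi> where "\<phi> C = K #> (SOME y. y \<in> Y \<and> (\<exists>x\<in>X. C = K #> x \<and> inv x \<otimes> y \<in> Z))" for C
  have \<phi>_iff: "\<phi> (K #> x) = K #> y \<longleftrightarrow> inv x \<otimes> y \<in> Z" if x: "x \<in> X" and y: "y \<in> Y" for x y
  proof -
    let ?p = "\<lambda>y. y \<in> Y \<and> (\<exists>x'\<in>X. K #> x = K #> x' \<and> inv x' \<otimes> y \<in> Z)"
    define y0 where "y0 = (SOME y. ?p y)"
    have "\<exists>y. ?p y" using ex_Y[OF x] x by blast
    then have "?p y0" unfolding y0_def by (rule someI_ex)
    then obtain x' where x': "y0 \<in> Y" "x' \<in> X" "K #> x = K #> x'" "inv x' \<otimes> y0 \<in> Z" by blast
    have \<phi>x: "\<phi> (K #> x) = K #> y0" unfolding \<phi>_def y0_def ..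
    have c: "x \<in> carrier G" "y \<in> carrier G" "x' \<in> carrier G" "y0 \<in> carrier G"
      using cX[OF x] cY[OF y] cX[OF x'(2)] cY[OF x'(1)] .
    have xK: "x \<otimes> inv x' \<in> K" using K_eq[OF c(1,3)] x'(3) by blast
    have xx: "inv x \<otimes> x' \<in> K"
    proof -
      have "inv x \<otimes> inv (x \<otimes> inv x') \<otimes> x \<in> K"
        using normalizesD_inv[OF nXK Xs x] subgroup.m_inv_closed[OF Ks xK] by blast
      then show ?thesis using c by (simp add: word_simps)
    qed
    have xy0: "inv x \<otimes> y0 \<in> Z"
    proof -
      have "(inv x \<otimes> x') \<otimes> (inv x' \<otimes> y0) \<in> Z" using subgroup.m_closed[OF Zs] xx KZ x'(4) by blast
      then show ?thesis using c by (simp add: word_simps)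
    qed
    show ?thesis
    proof
      assume "\<phi> (K #> x) = K #> y"
      then have "y0 \<otimes> inv y \<in> K" unfolding \<phi>x using K_eq[OF c(4,2)] by blast
      then have "inv y0 \<otimes> inv (y0 \<otimes> inv y) \<otimes> y0 \<in> Z"
        using normalizesD_inv[OF nYK Ys x'(1)] subgroup.m_inv_closed[OF Ks] KZ by blast
      then have "inv y0 \<otimes> y \<in> Z" using c by (simp add: word_simps)
      then have "(inv x \<otimes> y0) \<otimes> (inv y0 \<otimes> y) \<in> Z" using subgroup.m_closed[OF Zs xy0] by blast
      then show "inv x \<otimes> y \<in> Z" using c by (simp add: word_simps)
    next
      assume "inv x \<otimes> y \<in> Z"
      then have "inv (inv x \<otimes> y0) \<otimes> (inv x \<otimes> y) \<in> Z"
        using subgroup.m_closed[OF Zs subgroup.m_inv_closed[OF Zs xy0]] by blast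
      then have "inv y0 \<otimes> y \<in> Z" using c by (simp add: word_simps)
      moreover have "inv y0 \<otimes> y \<in> Y" using subgroup.m_closed[OF Ys subgroup.m_inv_closed[OF Ys x'(1)] y] .
      ultimately have "inv y0 \<otimes> y \<in> K" unfolding K' by blast
      then have "y0 \<otimes> inv (inv y0 \<otimes> y) \<otimes> inv y0 \<in> K"
        using normalizesD[OF nYK x'(1)] subgroup.m_inv_closed[OF Ks] by blast
      then have "y0 \<otimes> inv y \<in> K" using c by (simp add: word_simps)
      then show "\<phi> (K #> x) = K #> y" unfolding \<phi>x using K_eq[OF c(4,2)] by blast
    qed
  qed
  have \<phi>_ex: "\<exists>y\<in>Y. \<phi> (K #> x) = K #> y \<and> inv x \<otimes> y \<in> Z" if "x \<in> X" for x
    using ex_Y[OF that] \<phi>_iff[OF that] by blast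
  have hom: "\<phi> \<in> hom (?X Mod K) (?Y Mod K)"
  proof (rule homI)
    fix C assume "C \<in> carrier (?X Mod K)"
    then obtain x where "x \<in> X" "C = K #> x" unfolding surjX[symmetric] by blast
    then show "\<phi> C \<in> carrier (?Y Mod K)" using \<phi>_ex unfolding surjY[symmetric] by blast
  next
    fix C C' assume "C \<in> carrier (?X Mod K)" "C' \<in> carrier (?X Mod K)"
    then obtain x x' where x: "x \<in> X" "C = K #> x" "x' \<in> X" "C' = K #> x'" unfolding surjX[symmetric] by blast
    obtain y where y: "y \<in> Y" "\<phi> C = K #> y" "inv x \<otimes> y \<in> Z" using \<phi>_ex[OF x(1)] unfolding x(2) by blast
    obtain y' where y': "y' \<in> Y" "\<phi> C' = K #> y'" "inv x' \<otimes> y' \<in> Z" using \<phi>_ex[OF x(3)] unfolding x(4) by blast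
    have c: "x \<in> carrier G" "y \<in> carrier G" "x' \<in> carrier G" "y' \<in> carrier G"
      using cX[OF x(1)] cY[OF y(1)] cX[OF x(3)] cY[OF y'(1)] .
    have "(inv x' \<otimes> y') \<otimes> (inv y' \<otimes> (inv x \<otimes> y) \<otimes> y') \<in> Z"
      using subgroup.m_closed[OF Zs y'(3) normalizesD_inv[OF nY Ys y'(1) y(3)]] .
    then have "inv (x \<otimes> x') \<otimes> (y \<otimes> y') \<in> Z" using c by (simp add: word_simps)
    then have e: "\<phi> (K #> (x \<otimes> x')) = K #> (y \<otimes> y')"
      using \<phi>_iff[OF subgroup.m_closed[OF Xs x(1,3)] subgroup.m_closed[OF Ys y(1) y'(1)]] by blast
    have "C \<otimes>\<^bsub>?X Mod K\<^esub> C' = K #> (x \<otimes> x')" using fX.hom_mult[of x x'] x unfolding cos by simp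
    moreover have "\<phi> C \<otimes>\<^bsub>?Y Mod K\<^esub> \<phi> C' = K #> (y \<otimes> y')"
      using fY.hom_mult[of y y'] y(1) y'(1) unfolding cos y(2) y'(2) by simp
    ultimately show "\<phi> (C \<otimes>\<^bsub>?X Mod K\<^esub> C') = \<phi> C \<otimes>\<^bsub>?Y Mod K\<^esub> \<phi> C'" using e by metis
  qed
  have "bij_betw \<phi> (carrier (?X Mod K)) (carrier (?Y Mod K))"
    unfolding bij_betw_def
  proof
    show "inj_on \<phi> (carrier (?X Mod K))"
    proof (rule inj_onI)
      fix C C' assume C: "C \<in> carrier (?X Mod K)" "C' \<in> carrier (?X Mod K)" and eq: "\<phi> C = \<phi> C'"
      then obtain x x' where x: "x \<in> X" "C = K #> x" "x' \<in> X" "C' = K #> x'" unfolding surjX[symmetric] by blast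
      obtain y where y: "y \<in> Y" "\<phi> C = K #> y" "inv x \<otimes> y \<in> Z" using \<phi>_ex[OF x(1)] unfolding x(2) by blast
      have c: "x \<in> carrier G" "y \<in> carrier G" "x' \<in> carrier G"
        using cX[OF x(1)] cY[OF y(1)] cX[OF x(3)] .
      have "\<phi> (K #> x') = K #> y" using eq y(2) unfolding x(4) by metis
      then have "inv x' \<otimes> y \<in> Z" using \<phi>_iff[OF x(3) y(1)] by blast
      then have "(inv x \<otimes> y) \<otimes> inv (inv x' \<otimes> y) \<in> Z"
        using subgroup.m_closed[OF Zs y(3) subgroup.m_inv_closed[OF Zs]] by blast
      then have "inv x \<otimes> x' \<in> Z" using c by (simp add: word_simps)
      moreover have "inv x \<otimes> x' \<in> X" using subgroup.m_closed[OF Xs subgroup.m_inv_closed[OF Xs x(1)] x(3)] .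
      ultimately have "inv x \<otimes> x' \<in> K" unfolding K_def by blast
      then have "x \<otimes> inv (inv x \<otimes> x') \<otimes> inv x \<in> K"
        using normalizesD[OF nXK x(1)] subgroup.m_inv_closed[OF Ks] by blast
      then have "x \<otimes> inv x' \<in> K" using c by (simp add: word_simps)
      then show "C = C'" unfolding x(2,4) using K_eq[OF c(1,3)] by blast
    qed
    show "\<phi> ` carrier (?X Mod K) = carrier (?Y Mod K)"
    proof
      show "\<phi> ` carrier (?X Mod K) \<subseteq> carrier (?Y Mod K)" using hom unfolding hom_def by blast
      show "carrier (?Y Mod K) \<subseteq> \<phi> ` carrier (?X Mod K)"
      proof
        fix C assume "C \<in> carrier (?Y Mod K)"
        then obtain y where y: "y \<in> Y" "C = K #> y" unfolding surjY[symmetric] by blast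
        obtain x where x: "x \<in> X" "inv x \<otimes> y \<in> Z" using ex_X[OF y(1)] by blast
        have "\<phi> (K #> x) = C" using \<phi>_iff[OF x(1) y(1)] x(2) y(2) by blast
        moreover have "K #> x \<in> carrier (?X Mod K)" using x(1) unfolding surjX[symmetric] by blast
        ultimately show "C \<in> \<phi> ` carrier (?X Mod K)" by blast
      qed
    qed
  qed
  then have iso: "\<phi> \<in> iso (?X Mod K) (?Y Mod K)" using hom unfolding iso_def by blast
  have "operator_isomorphic G (pi_residual \<pi> G) K X Y"
    unfolding operator_isomorphic_def pi_residual_eq
  proof (intro bexI[OF _ iso] ballI impI)
    fix a x y assume a: "a \<in> P" and x: "x \<in> X" and y: "y \<in> Y" and e: "\<phi> (K #> x) = K #> y"
    have Ps: "subgroup P G" by (rule hall_join_subgroup)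
    note nP = sp_pi_subgroup(2)
    have ac: "a \<in> carrier G" using subgroup.mem_carrier[OF Ps a] .
    have "inv x \<otimes> y \<in> Z" using \<phi>_iff[OF x y] e by blast
    then have "inv a \<otimes> (inv x \<otimes> y) \<otimes> a \<in> Z" using normalizesD_inv[OF nP[OF Z] Ps a] by blast
    then have "inv (inv a \<otimes> x \<otimes> a) \<otimes> (inv a \<otimes> y \<otimes> a) \<in> Z"
      using ac cX[OF x] cY[OF y] by (simp add: word_simps)
    then show "\<phi> (K #> (inv a \<otimes> x \<otimes> a)) = K #> (inv a \<otimes> y \<otimes> a)"
      using \<phi>_iff[OF normalizesD_inv[OF nP[OF X] Ps a x] normalizesD_inv[OF nP[OF Y] Ps a y]] by blast
  qed
  moreover have "\<forall>A\<in>{K, X, Y}. sp A \<and> pi_subgroup \<pi> G A"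
    using sK X Y pK Ks Xs Ys pi_subgroup_iff[OF fin] by blast
  ultimately show ?thesis
    using coinc KnX KnY unfolding isomorphic_sections_coincide_def by blast
qed

end

section \<open>Diamonds below the residual\<close>

context hall_full
begin

lemma part_inv_normalizes:
  assumes A: "subgroup A G" and N: "N \<subseteq> carrier G" and nrm: "normalizes G N A"
  shows "normalizes G N (hall_part \<pi>' G A)"
  unfolding hall_part_def
proof (rule normalizes_generate_right[OF hall_part_Union_subset N])
  fix n x assume n: "n \<in> N" and "x \<in> \<Union> {A \<inter> K |K. hall' K}"
  then obtain K where K: "hall' K" "x \<in> A" "x \<in> K" by blast
  have nc: "n \<in> carrier G" using n N by blast
  have "n \<otimes> x \<otimes> inv n \<in> conjg n K" unfolding conjg_def using K(3) by (rule imageI)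
  moreover have "n \<otimes> x \<otimes> inv n \<in> A" using normalizesD[OF nrm n K(2)] .
  ultimately show "n \<otimes> x \<otimes> inv n \<in> generate G (\<Union> {A \<inter> K |K. hall' K})"
    using hall_le_part[OF hall'_conjg[OF K(1) nc], of A] unfolding hall_part_def by blast
qed

text \<open>Split both sides of |AC| |A \<inter> C| = |A| |C| into \<pi>- and \<pi>'-parts. The
  \<pi>-parts say that (A \<inter> H)(C \<inter> H) has the same order as AC \<inter> H, in which it
  is contained.\<close>

lemma prod_Int_hall:
  assumes A: "sp A" and C: "sp C" and AC: "sp (A <#> C)" and H: "hall H"
  shows "(A <#> C) \<inter> H \<subseteq> (A \<inter> H) <#> (C \<inter> H)"
proof -
  note As = spD[OF A] and Cs = spD[OF C] and Js = spD[OF AC] and Hs = hallD(1)[OF H]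
  obtain K where K: "hall' K" using hall'_exists .
  note Ks = hallD'(1)[OF K]
  have sI: "sp (A \<inter> C)" using sp_Int[OF A C] .
  let ?J = "A <#> C" and ?I = "A \<inter> C"
  have HJ: "subgroup (X \<inter> H) G" "pi_number \<pi> (card (X \<inter> H))" "card (X \<inter> H) > 0" if "sp X" for X
  proof -
    show s: "subgroup (X \<inter> H) G" using subgroups_Inter_pair[OF spD[OF that] Hs] .
    show "pi_number \<pi> (card (X \<inter> H))"
      using pi_number_dvd[OF card_subgroup_dvd[OF s Hs] hallD(2)[OF H]] by blast
    show "card (X \<inter> H) > 0" using cpos[OF s] .
  qed
  have KJ: "pi_number \<pi>' (card (X \<inter> K))" if "sp X" for X
    using pi_number_dvd[OF card_subgroup_dvd[OF subgroups_Inter_pair[OF spD[OF that] Ks] Ks] hallD'(2)[OF K]] by blast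
  have "card ?J * card ?I = card A * card C" using card_set_mult[OF As Cs fin] .
  then have "(card (?J \<inter> H) * card (?J \<inter> K)) * (card (?I \<inter> H) * card (?I \<inter> K))
      = (card (A \<inter> H) * card (A \<inter> K)) * (card (C \<inter> H) * card (C \<inter> K))"
    unfolding sp_card_mult(1)[OF AC H K, symmetric] sp_card_mult(1)[OF sI H K, symmetric]
      sp_card_mult(1)[OF A H K, symmetric] sp_card_mult(1)[OF C H K, symmetric] .
  then have "(card (?J \<inter> H) * card (?I \<inter> H)) * (card (?J \<inter> K) * card (?I \<inter> K))
      = (card (A \<inter> H) * card (C \<inter> H)) * (card (A \<inter> K) * card (C \<inter> K))" by (simp only: ac_simps)
  then have e: "card (?J \<inter> H) * card (?I \<inter> H) = card (A \<inter> H) * card (C \<inter> H)"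
    by (rule pi_factor_unique(1)[where \<tau> = \<pi>, rotated 4]) (use HJ(2) KJ A C AC sI in \<open>simp_all add: pi_number_mult\<close>)
  have "A \<inter> H \<inter> (C \<inter> H) = ?I \<inter> H" by blast
  then have "card ((A \<inter> H) <#> (C \<inter> H)) * card (?I \<inter> H) = card (A \<inter> H) * card (C \<inter> H)"
    using card_set_mult[OF HJ(1)[OF A] HJ(1)[OF C] fin] by argo
  then have "card ((A \<inter> H) <#> (C \<inter> H)) * card (?I \<inter> H) = card (?J \<inter> H) * card (?I \<inter> H)"
    using e by argo
  then have c: "card ((A \<inter> H) <#> (C \<inter> H)) = card (?J \<inter> H)" using HJ(3)[OF sI] by simp
  have "(A \<inter> H) <#> (C \<inter> H) \<subseteq> H" using set_mult_subset_subgroup[OF Hs] by blast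
  moreover have "(A \<inter> H) <#> (C \<inter> H) \<subseteq> ?J" by (rule mono_set_mult) blast+
  ultimately have "(A \<inter> H) <#> (C \<inter> H) \<subseteq> ?J \<inter> H" by blast
  then have "(A \<inter> H) <#> (C \<inter> H) = ?J \<inter> H" using c finsub[OF HJ(1)[OF AC]] by (metis card_subset_eq)
  then show ?thesis by blast
qed

text \<open>\<open>P\<close> normalizes the \<pi>-part of C, so for A inside \<open>P\<close> the
  product of the two parts is a subgroup. It contains every AC \<inter> H by
  \<open>prod_Int_hall\<close>.\<close>

lemma prod_part:
  assumes A: "sp A" and C: "sp C" and AC: "sp (A <#> C)" and AP: "A \<subseteq> P"
  shows "hall_part \<pi> G (A <#> C) = hall_part \<pi> G A <#> hall_part \<pi> G C"
proof
  note As = spD[OF A] and Cs = spD[OF C]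
  have nrm: "normalizes G (hall_part \<pi> G A) (hall_part \<pi> G C)"
    using normalizes_mono[OF P_normalizes_part[OF C]] hall_part_le[OF As] AP by blast
  have s: "subgroup (hall_part \<pi> G A <#> hall_part \<pi> G C) G"
    using subgroup_set_mult[OF hall_part_subgroup hall_part_subgroup
        normalizes_permutable[OF hall_part_subgroup hall_part_subgroup nrm]] .
  show "hall_part \<pi> G (A <#> C) \<subseteq> hall_part \<pi> G A <#> hall_part \<pi> G C"
    unfolding hall_part_def[of _ _ "A <#> C"]
  proof (rule generate_subgroup_incl[OF _ s])
    show "\<Union> {(A <#> C) \<inter> H |H. hall H} \<subseteq> hall_part \<pi> G A <#> hall_part \<pi> G C"
    proof
      fix x assume "x \<in> \<Union> {(A <#> C) \<inter> H |H. hall H}"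
      then obtain H where H: "hall H" "x \<in> (A <#> C) \<inter> H" by blast
      have "x \<in> (A \<inter> H) <#> (C \<inter> H)" using prod_Int_hall[OF A C AC H(1)] H(2) by blast
      then show "x \<in> hall_part \<pi> G A <#> hall_part \<pi> G C"
        using mono_set_mult[OF hall_le_part[OF H(1)] hall_le_part[OF H(1)]] by blast
    qed
  qed
  have "hall_part \<pi> G A \<subseteq> hall_part \<pi> G (A <#> C)" "hall_part \<pi> G C \<subseteq> hall_part \<pi> G (A <#> C)"
    using hall_part_mono subset_set_mult_left[OF Cs subgroup.subset[OF As]]
      subset_set_mult_right[OF As subgroup.subset[OF Cs]] by blast+
  then show "hall_part \<pi> G A <#> hall_part \<pi> G C \<subseteq> hall_part \<pi> G (A <#> C)"
    by (rule set_mult_subset_subgroup[OF hall_part_subgroup])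
qed

text \<open>X/I is abelian, so T = (X \<inter> H) I is normal in X. Its index is a \<pi>'-number, so
  T contains the intersections of X with all Hall \<pi>-subgroups and hence the \<pi>-part of X. By
  |T| = |X \<inter> H| |I \<inter> K| the subgroup T meets K only in I \<inter> K.\<close>

lemma abelian_part_Int:
  assumes X: "sp X" and I: "sp I" and IX: "I \<subseteq> X" and comm: "\<And>a b. a \<in> X \<Longrightarrow> b \<in> X \<Longrightarrow> cm a b \<in> I"
    and K: "hall' K"
  shows "hall_part \<pi> G X \<inter> K \<subseteq> I"
proof -
  note Xs = spD[OF X] and Is = spD[OF I] and Ks = hallD'(1)[OF K]
  obtain H where H: "hall H" using hall_exists .
  note Hs = hallD(1)[OF H]
  note XH = subgroups_Inter_pair[OF Xs Hs] and IK = subgroups_Inter_pair[OF Is Ks] and IH = subgroups_Inter_pair[OF Is Hs]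
  have nXI: "normalizes G X I"
  proof (rule normalizesI)
    fix x i assume x: "x \<in> X" and i: "i \<in> I"
    have "cm x i \<otimes> i \<in> I" using subgroup.m_closed[OF Is comm[OF x] i] i IX by blast
    then show "x \<otimes> i \<otimes> inv x \<in> I"
      using subgroup.mem_carrier[OF Xs x] subgroup.mem_carrier[OF Is i] by (simp add: word_simps)
  qed
  let ?T = "(X \<inter> H) <#> I"
  have perm: "(X \<inter> H) <#> I = I <#> (X \<inter> H)"
    by (rule normalizes_permutable[OF XH Is normalizes_mono[OF nXI]]) blast
  have Ts: "subgroup ?T G" using subgroup_set_mult[OF XH Is perm] .
  have TX: "?T \<subseteq> X" using IX by (intro set_mult_subset_subgroup[OF Xs]) blast+
  have XHT: "X \<inter> H \<subseteq> ?T" using subset_set_mult_left[OF Is subgroup.subset[OF XH]] .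
  have IT: "I \<subseteq> ?T" using subset_set_mult_right[OF XH subgroup.subset[OF Is]] .
  have nXT: "normalizes G X ?T"
  proof (rule normalizesI)
    fix x t assume x: "x \<in> X" and t: "t \<in> ?T"
    have "cm x t \<otimes> t \<in> ?T" using subgroup.m_closed[OF Ts _ t] comm[OF x] t TX IT by blast
    then show "x \<otimes> t \<otimes> inv x \<in> ?T"
      using subgroup.mem_carrier[OF Xs x] subgroup.mem_carrier[OF Ts t] by (simp add: word_simps)
  qed
  have idxT: "pi_number \<pi>' (card X div card ?T)"
  proof -
    have "card (X \<inter> H) * (card ?T div card (X \<inter> H)) * (card X div card ?T) = card (X \<inter> H) * card (X \<inter> K)"
      using card_mult_index[OF XH Ts XHT] card_mult_index[OF Ts Xs TX] sp_card_mult(1)[OF X H K] by argo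
    then have "(card ?T div card (X \<inter> H)) * (card X div card ?T) = card (X \<inter> K)"
      using cpos[OF XH] by (simp add: mult.assoc)
    moreover have "pi_number \<pi>' (card (X \<inter> K))"
      using pi_number_dvd[OF card_subgroup_dvd[OF subgroups_Inter_pair[OF Xs Ks] Ks] hallD'(2)[OF K]] by blast
    ultimately show ?thesis using pi_number_mult by metis
  qed
  have part_T: "hall_part \<pi> G X \<subseteq> ?T"
    unfolding hall_part_def
  proof (rule generate_subgroup_incl[OF _ Ts], clarify)
    fix x H' assume H': "hall H'" and x: "x \<in> X" "x \<in> H'"
    let ?N = "X \<inter> H'"
    have Ns: "subgroup ?N G" using subgroups_Inter_pair[OF Xs hallD(1)[OF H']] .
    have TN: "subgroup (?T \<inter> ?N) G" using subgroups_Inter_pair[OF Ts Ns] .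
    have NT: "subgroup (?N <#> ?T) G"
      by (rule subgroup_set_mult[OF Ns Ts normalizes_permutable[OF Ns Ts normalizes_mono[OF nXT]]]) blast
    have NTX: "?N <#> ?T \<subseteq> X" by (rule set_mult_subset_subgroup[OF Xs Int_lower1 TX])
    \<comment> \<open>This is |NT : T|, a \<pi>-number as an index in N and at the same time a
      divisor of the \<pi>'-number |X : T|.\<close>
    define d where "d = card ?N div card (?T \<inter> ?N)"
    have iN: "card (?T \<inter> ?N) * d = card ?N" unfolding d_def using card_mult_index[OF TN Ns] by blast
    have "card (?N <#> ?T) * card (?T \<inter> ?N) = card ?N * card ?T"
      using card_set_mult[OF Ns Ts fin] by (simp only: Int_commute)
    then have "card (?T \<inter> ?N) * card (?N <#> ?T) = card (?T \<inter> ?N) * (card ?T * d)"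
      unfolding iN[symmetric] by (simp only: ac_simps)
    then have c: "card (?N <#> ?T) = card ?T * d"
      using cpos[OF TN] by simp
    have "card (?N <#> ?T) dvd card X" using card_subgroup_dvd[OF NT Xs NTX] .
    then have "card ?T * d dvd card ?T * (card X div card ?T)"
      unfolding c card_mult_index[OF Ts Xs TX] .
    then have "d dvd card X div card ?T" using cpos[OF Ts] by simp
    then have "pi_number \<pi>' d" using idxT by (rule pi_number_dvd)
    moreover have "pi_number \<pi> d"
    proof (rule pi_number_dvd)
      show "d dvd card ?N" using iN by (metis dvd_triv_right)
      show "pi_number \<pi> (card ?N)"
        using pi_number_dvd[OF card_subgroup_dvd[OF Ns hallD(1)[OF H']] hallD(2)[OF H']] by blast
    qed
    ultimately have "d = 1" using pi_number_eq_1 by blast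
    then have "card (?T \<inter> ?N) = card ?N" using iN by simp
    then have "?T \<inter> ?N = ?N" using finsub[OF Ns] by (metis card_subset_eq inf_le2)
    then show "x \<in> ?T" using x by blast
  qed
  have "?T \<inter> K \<subseteq> I"
  proof -
    have TK: "subgroup (?T \<inter> K) G" using subgroups_Inter_pair[OF Ts Ks] .
    have IKT: "I \<inter> K \<subseteq> ?T \<inter> K" using IT by blast
    have "X \<inter> H \<inter> I = I \<inter> H" using IX by blast
    then have "card ?T * card (I \<inter> H) = card (X \<inter> H) * (card (I \<inter> H) * card (I \<inter> K))"
      using card_set_mult[OF XH Is fin] sp_card_mult(1)[OF I H K] by argo
    then have "card (I \<inter> H) * card ?T = card (I \<inter> H) * (card (X \<inter> H) * card (I \<inter> K))"
      by (simp only: ac_simps)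
    then have "card ?T = card (X \<inter> H) * card (I \<inter> K)" using cpos[OF IH] by simp
    then have "card (?T \<inter> K) dvd card (X \<inter> H) * card (I \<inter> K)"
      using card_subgroup_dvd[OF TK Ts] by simp
    moreover have "coprime (card (?T \<inter> K)) (card (X \<inter> H))"
    proof -
      have "pi_number \<pi>' (card (?T \<inter> K))"
        using pi_number_dvd[OF card_subgroup_dvd[OF TK Ks] hallD'(2)[OF K]] by blast
      moreover have "pi_number \<pi> (card (X \<inter> H))"
        using pi_number_dvd[OF card_subgroup_dvd[OF XH Hs] hallD(2)[OF H]] by blast
      ultimately show ?thesis using pi_number_coprime by (metis coprime_commute)
    qed
    ultimately have "card (?T \<inter> K) dvd card (I \<inter> K)" by (simp add: coprime_dvd_mult_right_iff)
    then have "card (?T \<inter> K) \<le> card (I \<inter> K)" using cpos[OF IK] by (rule dvd_imp_le)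
    then have "I \<inter> K = ?T \<inter> K" using IKT finsub[OF TK] by (metis card_seteq)
    then show ?thesis by blast
  qed
  then show ?thesis using part_T by blast
qed

text \<open>Members below D normalize each other. Writing b = y z, the commutators [a, y] and [a, z]
  lie in X \<inter> Y and X \<inter> Z, both equal to I. So each atom of a diamond is abelian modulo
  its bottom.\<close>

lemma commutator_in_meet:
  assumes X: "sp X" "X \<subseteq> D" and Y: "sp Y" "Y \<subseteq> D" and Z: "sp Z" "Z \<subseteq> D"
    and I: "X \<inter> Y = I" "X \<inter> Z = I" and sub: "X \<subseteq> Y <#> Z" and a: "a \<in> X" "b \<in> X"
  shows "cm a b \<in> I"
proof -
  note Xs = spD[OF X(1)] and Ys = spD[OF Y(1)] and Zs = spD[OF Z(1)]
  have sI: "sp I" using sp_Int[OF X(1) Y(1)] unfolding I(1) .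
  have nrm: "normalizes G B A" if "sp A" "B \<subseteq> D" for A B
    using normalizes_mono[OF D_normalizes[OF that(1)] that(2)] .
  have "b \<in> Y <#> Z" using a sub by blast
  then obtain y z where yz: "y \<in> Y" "z \<in> Z" "b = y \<otimes> z" by (rule set_multE)
  have c: "a \<in> carrier G" "y \<in> carrier G" "z \<in> carrier G"
    using subgroup.mem_carrier[OF Xs a(1)] subgroup.mem_carrier[OF Ys yz(1)] subgroup.mem_carrier[OF Zs yz(2)] .
  have "cm a y \<in> X \<inter> Y"
    using commutator_in_left[OF Xs nrm[OF X(1) Y(2)] a(1) yz(1) c(2)]
      commutator_in_right[OF Ys nrm[OF Y(1) X(2)] a(1) yz(1)] by blast
  moreover have "cm a z \<in> X \<inter> Z"
    using commutator_in_left[OF Xs nrm[OF X(1) Z(2)] a(1) yz(2) c(3)]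
      commutator_in_right[OF Zs nrm[OF Z(1) X(2)] a(1) yz(2)] by blast
  ultimately have "cm a y \<in> I" "cm a z \<in> I" unfolding I by blast+
  then show ?thesis unfolding yz(3)
    by (rule commutator_mult_right[OF spD[OF sI] Ys nrm[OF sI Y(2)] _ _ yz(1) c(3,1)])
qed

text \<open>The \<open>\<pi>\<close>-parts of the three atoms of a sublattice \<open>M\<^sub>3\<close> below D become \<open>\<pi>\<close>-groups modulo the core
  of its bottom element, where two of them are operator isomorphic through the third.\<close>

lemma diamond_part_le:
  assumes coinc: "\<And>R. R \<lhd> G \<Longrightarrow> isomorphic_sections_coincide \<pi> \<pi> (G Mod R)"
    and perm: all_permute
    and A: "sp A" "A \<subseteq> D" and B: "sp B" "B \<subseteq> D" and C: "sp C" "C \<subseteq> D"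
    and I: "A \<inter> B = I" "A \<inter> C = I" "B \<inter> C = I"
    and le: "A \<subseteq> B <#> C" "B \<subseteq> A <#> C" "C \<subseteq> A <#> B"
  shows "hall_part \<pi> G A \<subseteq> B"
proof -
  have sI: "sp I" using sp_Int[OF A(1) B(1)] unfolding I(1) .
  note Is = spD[OF sI]
  \<comment> \<open>The core of I, that is, the largest normal subgroup of G inside I.\<close>
  define R where "R = {x \<in> carrier G. \<forall>g\<in>carrier G. g \<otimes> x \<otimes> inv g \<in> I}"
  have RI: "R \<subseteq> I"
  proof
    fix x assume "x \<in> R"
    then have "\<one> \<otimes> x \<otimes> inv \<one> \<in> I" "x \<in> carrier G" unfolding R_def by blast+
    then show "x \<in> I" by simp
  qed
  have Rn: "R \<lhd> G"
    unfolding normal_iff_normalizes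
  proof
    show "subgroup R G"
    proof
      show "R \<subseteq> carrier G" unfolding R_def by blast
      show "\<one> \<in> R" unfolding R_def using subgroup.one_closed[OF Is] by simp
      fix x assume x: "x \<in> R"
      have "g \<otimes> inv x \<otimes> inv g \<in> I" if g: "g \<in> carrier G" for g
      proof -
        have "inv (g \<otimes> x \<otimes> inv g) \<in> I" using x g subgroup.m_inv_closed[OF Is] unfolding R_def by blast
        moreover have "x \<in> carrier G" using x unfolding R_def by blast
        ultimately show ?thesis using g by (simp add: word_simps)
      qed
      then show "inv x \<in> R" using x unfolding R_def by simp
      fix y assume y: "y \<in> R"
      have "g \<otimes> (x \<otimes> y) \<otimes> inv g \<in> I" if g: "g \<in> carrier G" for g
      proof -
        have "(g \<otimes> x \<otimes> inv g) \<otimes> (g \<otimes> y \<otimes> inv g) \<in> I"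
          using x y g subgroup.m_closed[OF Is] unfolding R_def by blast
        moreover have "x \<in> carrier G" "y \<in> carrier G" using x y unfolding R_def by blast+
        ultimately show ?thesis using g by (simp add: word_simps)
      qed
      then show "x \<otimes> y \<in> R" using x y unfolding R_def by simp
    qed
    show "normalizes G (carrier G) R"
    proof (rule normalizesI)
      fix h x assume h: "h \<in> carrier G" and x: "x \<in> R"
      have xc: "x \<in> carrier G" using x unfolding R_def by blast
      have "g \<otimes> (h \<otimes> x \<otimes> inv h) \<otimes> inv g \<in> I" if g: "g \<in> carrier G" for g
      proof -
        have "g \<otimes> h \<otimes> x \<otimes> inv (g \<otimes> h) \<in> I" using x g h unfolding R_def by blast
        then show ?thesis using g h xc by (simp add: word_simps)
      qed
      then show "h \<otimes> x \<otimes> inv h \<in> R" using h xc unfolding R_def by simp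
    qed
  qed
  have DP: "D \<subseteq> P" by blast
  \<comment> \<open>The hypothesis of \<open>sp_img_pi\<close>: modulo R the \<pi>-part of X becomes
    a \<pi>-group.\<close>
  have part: "hall_part \<pi> G X \<subseteq> H <#> R" if X: "sp X" and IX: "I \<subseteq> X"
    and comm: "\<And>a b. a \<in> X \<Longrightarrow> b \<in> X \<Longrightarrow> cm a b \<in> I" and H: "hall H" for X H
  proof
    note Xs = spD[OF X]
    let ?X = "hall_part \<pi> G X"
    obtain K where K: "hall' K" using hall'_exists .
    have W: "hall_part \<pi>' G ?X \<subseteq> hall_part \<pi>' G I"
      unfolding hall_part_def[of \<pi>' _ ?X]
    proof (rule generate_subgroup_incl[OF _ hall_part_subgroup], clarify)
      fix x K assume K: "hall' K" and x: "x \<in> ?X" "x \<in> K"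
      then have "x \<in> I" using abelian_part_Int[OF X sI IX comm K] by blast
      then show "x \<in> hall_part \<pi>' G I" using hall_le_part[OF K, of I] x(2) by blast
    qed
    have nPW: "normalizes G P (hall_part \<pi>' G ?X)"
      using part_inv_normalizes[OF hall_part_subgroup subgroup.subset[OF hall_join_subgroup] P_normalizes_part[OF X]] .
    \<comment> \<open>For g = q p, conjugation by p keeps w inside the subgroup that
      \<open>W\<close> places in the \<pi>'-part of I, and conjugation by q does not leave that
      part.\<close>
    have WR: "hall_part \<pi>' G ?X \<subseteq> R"
    proof
      fix w assume w: "w \<in> hall_part \<pi>' G ?X"
      have wc: "w \<in> carrier G" using subgroup.mem_carrier[OF hall_part_subgroup w] .
      have "g \<otimes> w \<otimes> inv g \<in> I" if "g \<in> carrier G" for g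
      proof -
        have "g \<in> Q <#> P" using that unfolding PQ_eq .
        then obtain q p where qp: "q \<in> Q" "p \<in> P" "g = q \<otimes> p" by (rule set_multE)
        have c: "q \<in> carrier G" "p \<in> carrier G"
          using subgroup.mem_carrier[OF hall_join_subgroup] qp by blast+
        have "p \<otimes> w \<otimes> inv p \<in> hall_part \<pi>' G I" using normalizesD[OF nPW qp(2) w] W by blast
        then have "q \<otimes> (p \<otimes> w \<otimes> inv p) \<otimes> inv q \<in> hall_part \<pi>' G I"
          by (rule normalizesD[OF Q_normalizes_part'[OF sI] qp(1)])
        then have "q \<otimes> (p \<otimes> w \<otimes> inv p) \<otimes> inv q \<in> I" using hall_part_le[OF Is] by blast
        then show ?thesis unfolding qp(3) using c wc by (simp add: word_simps)
      qed
      then show "w \<in> R" unfolding R_def using wc by blast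
    qed
    fix x assume x: "x \<in> ?X"
    then have "x \<in> (X \<inter> H) <#> (X \<inter> K)" using hall_part_le[OF Xs] sp_card_mult(2)[OF X H K] by blast
    then obtain h k where hk: "h \<in> X \<inter> H" "k \<in> X \<inter> K" "x = h \<otimes> k" by (rule set_multE)
    have c: "h \<in> carrier G" "k \<in> carrier G" using hk subgroup.mem_carrier[OF Xs] by blast+
    have "h \<in> ?X" using hall_le_part[OF H] hk(1) by blast
    then have "inv h \<otimes> x \<in> ?X"
      using subgroup.m_closed[OF hall_part_subgroup subgroup.m_inv_closed[OF hall_part_subgroup] x] by blast
    then have "k \<in> ?X" unfolding hk(3) using c by (simp add: word_simps)
    then have "k \<in> R" using hall_le_part[OF K, of ?X] WR hk(2) by blast
    then show "x \<in> H <#> R" unfolding hk(3) using hk(1) by (intro set_multI) blast+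
  qed
  interpret hall_quot G \<pi> R by (rule hall_quotI[OF Rn])
  have perm': "X <#> Y = Y <#> X" if "sp X" "sp Y" for X Y using perm that unfolding all_permute_def by blast
  have sAC: "sp (A <#> C)" using sp_set_mult[OF perm A(1) C(1)] .
  have sBC: "sp (B <#> C)" using sp_set_mult[OF perm B(1) C(1)] .
  note As = spD[OF A(1)] and Bs = spD[OF B(1)] and Cs = spD[OF C(1)]
  have CAC: "C \<subseteq> A <#> C" "A \<subseteq> A <#> C" "B \<subseteq> B <#> C" "C \<subseteq> B <#> C"
    using subset_set_mult_right[OF As subgroup.subset[OF Cs]] subset_set_mult_left[OF Cs subgroup.subset[OF As]]
      subset_set_mult_left[OF Cs subgroup.subset[OF Bs]] subset_set_mult_right[OF Bs subgroup.subset[OF Cs]] .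
  have J: "A <#> C = B <#> C"
    using set_mult_subset_subgroup[OF spD[OF sBC] le(1) CAC(4)] set_mult_subset_subgroup[OF spD[OF sAC] le(2) CAC(1)]
    by blast
  have commA: "cm a b \<in> I" if "a \<in> A" "b \<in> A" for a b
    using commutator_in_meet[OF A B C I(1,2) le(1) that] .
  have commB: "cm a b \<in> I" if "a \<in> B" "b \<in> B" for a b
    using commutator_in_meet[OF B A C _ I(3) le(2) that] I(1) by blast
  have commC: "cm a b \<in> I" if "a \<in> C" "b \<in> C" for a b
    using commutator_in_meet[OF C A B _ _ le(3) that] I(2,3) by blast
  have IA: "I \<subseteq> A" "I \<subseteq> B" "I \<subseteq> C" using I by blast+
  let ?A = "hall_part \<pi> G A" and ?B = "hall_part \<pi> G B" and ?C = "hall_part \<pi> G C" and ?I = "hall_part \<pi> G I"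
  note s = hall_part_subgroup
  have qA: "q.sp (f ` ?A)" "pi_number \<pi> (card (f ` ?A))"
    using sp_img_pi[OF s part[OF A(1) IA(1) commA] P_normalizes_part[OF A(1)]] by blast+
  have qB: "q.sp (f ` ?B)" "pi_number \<pi> (card (f ` ?B))"
    using sp_img_pi[OF s part[OF B(1) IA(2) commB] P_normalizes_part[OF B(1)]] by blast+
  have qC: "q.sp (f ` ?C)" "pi_number \<pi> (card (f ` ?C))"
    using sp_img_pi[OF s part[OF C(1) IA(3) commC] P_normalizes_part[OF C(1)]] by blast+
  have sub: "?A \<subseteq> carrier G" "?B \<subseteq> carrier G" "?C \<subseteq> carrier G"
    using subgroup.subset[OF s] by blast+
  \<comment> \<open>Images of intersections are intersections of images here because R lies in I. If
    a and c agree modulo R, then a lies in C and hence in I. Writing a = h r replaces it by h from I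
    \<inter> H, an element of the \<pi>-part of I.\<close>
  have meet: "f ` hall_part \<pi> G X \<inter> f ` ?C \<subseteq> f ` ?I"
    if X: "sp X" "I \<subseteq> X" "X \<inter> C = I" and comm: "\<And>a b. a \<in> X \<Longrightarrow> b \<in> X \<Longrightarrow> cm a b \<in> I" for X
  proof
    fix u assume "u \<in> f ` hall_part \<pi> G X \<inter> f ` ?C"
    then obtain a c where ac: "a \<in> hall_part \<pi> G X" "c \<in> ?C" "u = f a" "f a = f c" by blast
    have carr: "a \<in> carrier G" "c \<in> carrier G"
      using subgroup.mem_carrier[OF s ac(1)] subgroup.mem_carrier[OF s ac(2)] .
    have "a \<otimes> inv c \<in> C" using f_eq_iff[OF carr] ac(4) RI IA(3) by blast
    then have "a \<otimes> inv c \<otimes> c \<in> C" using subgroup.m_closed[OF Cs] hall_part_le[OF Cs] ac(2) by blast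
    then have "a \<in> C" using carr by (simp add: word_simps)
    then have aI: "a \<in> I" using hall_part_le[OF spD[OF X(1)]] ac(1) X(3) by blast
    obtain H where H: "hall H" using hall_exists .
    have "a \<in> H <#> R" using part[OF X(1,2) comm H] ac(1) by blast
    then obtain h r where hr: "h \<in> H" "r \<in> R" "a = h \<otimes> r" by (rule set_multE)
    have c': "h \<in> carrier G" "r \<in> carrier G"
      using subgroup.mem_carrier[OF hallD(1)[OF H] hr(1)] subgroup.mem_carrier[OF Rs hr(2)] .
    have "a \<otimes> inv r \<in> I"
      using subgroup.m_closed[OF Is aI] subgroup.m_inv_closed[OF Is] RI hr(2) by blast
    then have "h \<in> I" unfolding hr(3) using c' by (simp add: word_simps)
    then have hI: "h \<in> ?I" using hall_le_part[OF H, of I] hr(1) by blast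
    have "h \<otimes> r \<otimes> inv h \<in> R" using normalizesD[OF normal_normalizes[OF Rn] c'(1) hr(2)] .
    then have "f a = f h" using f_eq_iff[OF carr(1) c'(1)] unfolding hr(3) by blast
    then show "u \<in> f ` ?I" unfolding ac(3) using hI by blast
  qed
  have IC: "f ` ?I \<subseteq> f ` ?C" "f ` ?I \<subseteq> f ` ?A" "f ` ?I \<subseteq> f ` ?B"
    using image_mono[OF hall_part_mono[OF IA(3)]] image_mono[OF hall_part_mono[OF IA(1)]]
      image_mono[OF hall_part_mono[OF IA(2)]] .
  have "f ` ?A \<inter> f ` ?C = f ` ?I"
    by (rule equalityI[OF meet[OF A(1) IA(1) I(2) commA] Int_greatest[OF IC(2,1)]])
  moreover have "f ` ?B \<inter> f ` ?C = f ` ?I"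
    by (rule equalityI[OF meet[OF B(1) IA(2) I(3) commB] Int_greatest[OF IC(3,1)]])
  ultimately have int: "f ` ?A \<inter> f ` ?C = f ` ?B \<inter> f ` ?C" by (rule trans[OF _ sym])
  have "?A <#> ?C = ?B <#> ?C"
    unfolding prod_part[OF A(1) C(1) sAC subset_trans[OF A(2) DP], symmetric]
      prod_part[OF B(1) C(1) sBC subset_trans[OF B(2) DP], symmetric] J ..
  then have prod: "f ` ?A <#>\<^bsub>Gq\<^esub> f ` ?C = f ` ?B <#>\<^bsub>Gq\<^esub> f ` ?C"
    using img_mult[OF sub(1,3)] img_mult[OF sub(2,3)] by argo
  have nP: "normalizes G (hall_part \<pi> G X) ?C" if "sp X" "X \<subseteq> D" for X
    by (rule normalizes_mono[OF P_normalizes_part[OF C(1)]]) (use hall_part_le[OF spD[OF that(1)]] that(2) in blast)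
  have eq: "f ` ?A = f ` ?B"
    by (rule q.sections_cancel[OF coinc[OF Rn] qA qB qC int prod
        image_pi_normalizes[OF nP[OF A] sub(1,3)] image_pi_normalizes[OF nP[OF B] sub(2,3)]])
  \<comment> \<open>Equality modulo R lifts to an inclusion in B, since R is contained in I and so
    in B.\<close>
  show ?thesis
  proof
    fix a assume a: "a \<in> ?A"
    then have "f a \<in> f ` ?B" unfolding eq[symmetric] by (rule imageI)
    then obtain b where b: "b \<in> ?B" "f a = f b" by blast
    have carr: "a \<in> carrier G" "b \<in> carrier G"
      using subgroup.mem_carrier[OF s a] subgroup.mem_carrier[OF s b(1)] .
    have "a \<otimes> inv b \<in> B" using f_eq_iff[OF carr] b(2) RI IA(2) by blast
    then have "a \<otimes> inv b \<otimes> b \<in> B" using subgroup.m_closed[OF Bs] hall_part_le[OF Bs] b(1) by blast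
    then show "a \<in> B" using carr by (simp add: word_simps)
  qed
qed

end

lemma sigma_permutable_compl:
  "\<pi> \<subseteq> {p. Factorial_Ring.prime p} \<Longrightarrow> sigma_permutable (compl_primes \<pi>) M = sigma_permutable \<pi> M"
  by (auto simp: sigma_permutable_def fun_eq_iff compl_compl_primes)

lemma isomorphic_sections_coincide_compl:
  "\<pi> \<subseteq> {p. Factorial_Ring.prime p} \<Longrightarrow>
    isomorphic_sections_coincide (compl_primes \<pi>) \<tau> M = isomorphic_sections_coincide \<pi> \<tau> M"
  unfolding isomorphic_sections_coincide_def by (simp only: sigma_permutable_compl)

section \<open>Distributivity below D and its extension to the whole lattice\<close>

context hall_full
begin

definition "sections_coincide_all \<longleftrightarrow> (\<forall>R. R \<lhd> G \<longrightarrow>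
  isomorphic_sections_coincide \<pi> \<pi> (G Mod R) \<and> isomorphic_sections_coincide \<pi> \<pi>' (G Mod R))"

lemma diamond_le:
  assumes coinc: sections_coincide_all and perm: all_permute
    and A: "sp A" "A \<subseteq> D" and B: "sp B" "B \<subseteq> D" and C: "sp C" "C \<subseteq> D"
    and I: "A \<inter> B = I" "A \<inter> C = I" "B \<inter> C = I"
    and le: "A \<subseteq> B <#> C" "B \<subseteq> A <#> C" "C \<subseteq> A <#> B"
  shows "A \<subseteq> B"
proof -
  interpret dual: hall_full G \<pi>' by (rule dual)
  have c1: "isomorphic_sections_coincide \<pi> \<pi> (G Mod R)" if "R \<lhd> G" for R
    using coinc that unfolding sections_coincide_all_def by blast
  have c2: "isomorphic_sections_coincide \<pi>' \<pi>' (G Mod R)" if "R \<lhd> G" for R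
    using coinc that unfolding sections_coincide_all_def isomorphic_sections_coincide_compl[OF primes] by blast
  have perm': "dual.all_permute" using perm unfolding dual.all_permute_def all_permute_def sp_dual .
  have "hall_part \<pi> G A \<subseteq> B" using diamond_part_le[OF c1 perm A B C I le] .
  moreover have "hall_part \<pi>' G A \<subseteq> B"
    by (rule dual.diamond_part_le[OF c2 perm' _ _ _ _ _ _ I le]) (use A B C in \<open>auto simp: sp_dual\<close>)
  ultimately show ?thesis
    using sp_parts[OF A(1)] subgroup.m_closed[OF spD[OF B(1)]] by blast
qed

text \<open>The subgroups \<open>m A B C\<close>, \<open>m B A C\<close> and \<open>m C A B\<close> are the atoms of the usual diamond generated
  by three elements of a modular lattice, and N is its bottom.\<close>

lemma D_product_dist:
  assumes coinc: sections_coincide_all and perm: all_permute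
    and A: "sp A" "A \<subseteq> D" and B: "sp B" "B \<subseteq> D" and C: "sp C" "C \<subseteq> D"
  shows "A \<inter> (B <#> C) \<subseteq> (A \<inter> B) <#> (A \<inter> C)"
proof -
  have perm': "X <#> Y = Y <#> X" if "sp X" "sp Y" for X Y
    using perm that unfolding all_permute_def by blast
  note mult = sp_set_mult[OF perm] and carr = subgroup.mem_carrier[OF spD]
  define m where "m X Y Z = (X \<inter> (Y <#> Z)) <#> (Y \<inter> Z)" for X Y Z
  define N where "N = ((A \<inter> B) <#> (B \<inter> C)) <#> (A \<inter> C)"
  have sN: "sp N" unfolding N_def by (intro mult sp_Int A B C)
  have sm: "sp (m X Y Z)" if "sp X" "sp Y" "sp Z" for X Y Z
    unfolding m_def by (intro mult sp_Int that)
  have m_comm: "m X Y Z = m X Z Y" if "sp X" "sp Y" "sp Z" for X Y Z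
    unfolding m_def perm'[OF that(2,3)] by (simp add: Int_commute)
  have mD: "m X Y Z \<subseteq> D" if "X \<subseteq> D" "Y \<subseteq> D" for X Y Z
    unfolding m_def by (rule set_mult_subset_subgroup[OF Ds]) (use that in blast)+
  have sub: "X \<subseteq> X <#> Y" "Y \<subseteq> X <#> Y" if "sp X" "sp Y" for X Y
    using subset_set_mult_left[OF spD[OF that(2)] subgroup.subset[OF spD[OF that(1)]]]
      subset_set_mult_right[OF spD[OF that(1)] subgroup.subset[OF spD[OF that(2)]]] .
  have parts: "X \<inter> (Y <#> Z) \<subseteq> m X Y Z" "Y \<inter> Z \<subseteq> m X Y Z" if "sp X" "sp Y" "sp Z" for X Y Z
    unfolding m_def using sub[OF sp_Int[OF that(1) mult[OF that(2,3)]] sp_Int[OF that(2,3)]] .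
  have NAB: "A \<inter> B \<subseteq> N" "B \<inter> C \<subseteq> N" "A \<inter> C \<subseteq> N"
    unfolding N_def
    using sub[OF sp_Int[OF A(1) B(1)] sp_Int[OF B(1) C(1)]]
      sub[OF mult[OF sp_Int[OF A(1) B(1)] sp_Int[OF B(1) C(1)]] sp_Int[OF A(1) C(1)]] by blast+
  have N_le: "N \<subseteq> M" if "sp M" "A \<inter> B \<subseteq> M" "B \<inter> C \<subseteq> M" "A \<inter> C \<subseteq> M" for M
    unfolding N_def by (intro set_mult_subset_subgroup[OF spD[OF that(1)]] that)
  have N_m: "N \<subseteq> m A B C" "N \<subseteq> m B A C" "N \<subseteq> m C A B"
  proof -
    show "N \<subseteq> m A B C"
      by (rule N_le[OF sm[OF A(1) B(1) C(1)]]) (use parts[OF A(1) B(1) C(1)] sub[OF B(1) C(1)] in blast)+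
    show "N \<subseteq> m B A C"
      by (rule N_le[OF sm[OF B(1) A(1) C(1)]]) (use parts[OF B(1) A(1) C(1)] sub[OF A(1) C(1)] in blast)+
    show "N \<subseteq> m C A B"
      by (rule N_le[OF sm[OF C(1) A(1) B(1)]]) (use parts[OF C(1) A(1) B(1)] sub[OF A(1) B(1)] in blast)+
  qed
  \<comment> \<open>From a u = b v one gets a v^-1 = b (v u^-1 v^-1). The left side lies in X, and
    the right side in Y because the member X below D normalizes Y. So a v^-1 is in X \<inter> Y, and
    v and u are in the other two meets.\<close>
  have meet: "m X Y Z \<inter> m Y X Z \<subseteq> N"
    if X: "sp X" "X \<subseteq> D" and Y: "sp Y" "Y \<subseteq> D" and Z: "sp Z" "Z \<subseteq> D"
      and inN: "X \<inter> Y \<subseteq> N" "Y \<inter> Z \<subseteq> N" "X \<inter> Z \<subseteq> N" for X Y Z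
  proof
    fix g assume g: "g \<in> m X Y Z \<inter> m Y X Z"
    obtain a u where au: "a \<in> X \<inter> (Y <#> Z)" "u \<in> Y \<inter> Z" "g = a \<otimes> u"
      using IntD1[OF g] unfolding m_def by (rule set_multE)
    obtain b v where bv: "b \<in> Y \<inter> (X <#> Z)" "v \<in> X \<inter> Z" "g = b \<otimes> v"
      using IntD2[OF g] unfolding m_def by (rule set_multE)
    have c: "a \<in> carrier G" "u \<in> carrier G" "b \<in> carrier G" "v \<in> carrier G"
      using au bv carr[OF X(1)] carr[OF Y(1)] by blast+
    have "a = g \<otimes> inv u" unfolding au(3) using c by (simp add: word_simps)
    then have a: "a = b \<otimes> v \<otimes> inv u" unfolding bv(3) .
    have "v \<otimes> inv u \<otimes> inv v \<in> Y"
      using normalizesD[OF D_normalizes[OF Y(1)]] bv(2) au(2) X(2) subgroup.m_inv_closed[OF spD[OF Y(1)]] by blast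
    then have "b \<otimes> (v \<otimes> inv u \<otimes> inv v) \<in> Y" using subgroup.m_closed[OF spD[OF Y(1)]] bv(1) by blast
    then have "a \<otimes> inv v \<in> Y" unfolding a using c by (simp add: word_simps)
    moreover have "a \<otimes> inv v \<in> X"
      using subgroup.m_closed[OF spD[OF X(1)]] subgroup.m_inv_closed[OF spD[OF X(1)]] au(1) bv(2) by blast
    ultimately have "a \<otimes> inv v \<in> N" using inN(1) by blast
    then have "a \<otimes> inv v \<otimes> v \<otimes> u \<in> N"
      using subgroup.m_closed[OF spD[OF sN]] inN(2,3) au(2) bv(2) by blast
    then show "g \<in> N" unfolding au(3) using c by (simp add: word_simps)
  qed
  have join: "m X Y Z \<subseteq> m Y X Z <#> m Z X Y" if X: "sp X" and Y: "sp Y" and Z: "sp Z" for X Y Z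
  proof -
    let ?J = "m Y X Z <#> m Z X Y"
    note s1 = sm[OF Y X Z] and s2 = sm[OF Z X Y]
    have J: "subgroup ?J G" using spD[OF mult[OF s1 s2]] .
    have "X \<inter> (Y <#> Z) \<subseteq> ?J"
    proof
      fix a assume a: "a \<in> X \<inter> (Y <#> Z)"
      obtain b c where bc: "b \<in> Y" "c \<in> Z" "a = b \<otimes> c" using IntD2[OF a] by (rule set_multE)
      have carr': "b \<in> carrier G" "c \<in> carrier G" using carr[OF Y bc(1)] carr[OF Z bc(2)] .
      have "a \<otimes> inv c \<in> X <#> Z" using a subgroup.m_inv_closed[OF spD[OF Z] bc(2)] by (intro set_multI) blast+
      then have "b \<in> X <#> Z" unfolding bc(3) using carr' by (simp add: word_simps)
      then have b: "b \<in> m Y X Z" using parts(1)[OF Y X Z] bc(1) by blast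
      have "inv b \<otimes> a \<in> Y <#> X" using a subgroup.m_inv_closed[OF spD[OF Y] bc(1)] by (intro set_multI) blast+
      then have "c \<in> X <#> Y" unfolding bc(3) perm'[OF X Y] using carr' by (simp add: word_simps)
      then have "c \<in> m Z X Y" using parts(1)[OF Z X Y] bc(2) by blast
      then show "a \<in> ?J" unfolding bc(3) using b by (intro set_multI)
    qed
    moreover have "Y \<inter> Z \<subseteq> ?J"
      using parts(1)[OF Y X Z] sub(2)[OF X Z] sub(1)[OF s1 s2] by blast
    ultimately show ?thesis unfolding m_def[of X] by (intro set_mult_subset_subgroup[OF J])
  qed
  let ?A = "m A B C" and ?B = "m B A C" and ?C = "m C A B"
  note sA = sm[OF A(1) B(1) C(1)] and sB = sm[OF B(1) A(1) C(1)] and sC = sm[OF C(1) A(1) B(1)]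
  have "?A \<inter> ?B = N"
    by (rule equalityI[OF meet[OF A B C NAB] Int_greatest[OF N_m(1,2)]])
  moreover have "?A \<inter> ?C = N"
  proof (rule equalityI[OF _ Int_greatest[OF N_m(1,3)]])
    have "m A C B \<inter> m C A B \<subseteq> N" by (rule meet[OF A C B]) (use NAB in blast)+
    then show "?A \<inter> ?C \<subseteq> N" unfolding m_comm[OF A(1) B(1) C(1)] .
  qed
  moreover have "?B \<inter> ?C = N"
  proof (rule equalityI[OF _ Int_greatest[OF N_m(2,3)]])
    have "m B C A \<inter> m C B A \<subseteq> N" by (rule meet[OF B C A]) (use NAB in blast)+
    then show "?B \<inter> ?C \<subseteq> N" unfolding m_comm[OF B(1) A(1) C(1)] m_comm[OF C(1) A(1) B(1)] .
  qed
  moreover have "?A \<subseteq> ?B <#> ?C" using join[OF A(1) B(1) C(1)] .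
  moreover have "?B \<subseteq> ?A <#> ?C" using join[OF B(1) A(1) C(1)] unfolding m_comm[OF C(1) A(1) B(1)] .
  moreover have "?C \<subseteq> ?A <#> ?B"
    using join[OF C(1) A(1) B(1)] unfolding m_comm[OF A(1) B(1) C(1)] m_comm[OF B(1) A(1) C(1)] .
  \<comment> \<open>The three elements form a diamond over N, and \<open>diamond_le\<close>
    collapses it: the first atom equals N.\<close>
  ultimately have AB: "?A \<subseteq> ?B" and N: "?A \<inter> ?B = N"
    using diamond_le[OF coinc perm sA mD[OF A(2) B(2)] sB mD[OF B(2) A(2)] sC mD[OF C(2) A(2)]] by blast+
  show ?thesis
  proof
    fix x assume x: "x \<in> A \<inter> (B <#> C)"
    then have "x \<in> N" using parts(1)[OF A(1) B(1) C(1)] AB N by blast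
    then obtain y v where yv: "y \<in> (A \<inter> B) <#> (B \<inter> C)" "v \<in> A \<inter> C" "x = y \<otimes> v"
      unfolding N_def by (rule set_multE)
    obtain p u where pu: "p \<in> A \<inter> B" "u \<in> B \<inter> C" "y = p \<otimes> u" using yv(1) by (rule set_multE)
    have c: "p \<in> carrier G" "u \<in> carrier G" "v \<in> carrier G"
      using pu yv(2) carr[OF A(1)] carr[OF B(1)] by blast+
    note As = spD[OF A(1)]
    have "inv p \<otimes> x \<otimes> inv v \<in> A"
      using subgroup.m_closed[OF As subgroup.m_closed[OF As subgroup.m_inv_closed[OF As IntD1[OF pu(1)]] IntD1[OF x]]
          subgroup.m_inv_closed[OF As IntD1[OF yv(2)]]] .
    \<comment> \<open>In x = p u v the outer factors and x lie in A. Hence u does too, and p u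
      belongs to A \<inter> B.\<close>
    then have "u \<in> A" unfolding yv(3) pu(3) using c by (simp add: word_simps)
    then have "p \<otimes> u \<in> A \<inter> B"
      using subgroup.m_closed[OF spD[OF sp_Int[OF A(1) B(1)]]] pu(1,2) by blast
    then show "x \<in> (A \<inter> B) <#> (A \<inter> C)" unfolding yv(3) pu(3) using yv(2) by (intro set_multI)
  qed
qed

text \<open>In a cyclic group with generator g, let b = \<open>g\<^sup>j\<close>, c = \<open>g\<^sup>k\<close> and d = gcd j k. Bezout coefficients
  u, v of j/d and k/d give \<open>b c = (b c)\<^sup>p (b c)\<^sup>q\<close> with p = u (j/d) and q = v (k/d).\<close>

lemma cyclic_mod_D_split:
  assumes cyc: "cyclic_group (G Mod D)" and b: "b \<in> carrier G" and c: "c \<in> carrier G"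
  shows "\<exists>(p::int) (q::int) (p'::int) (q'::int). p + q = 1 \<and> (b \<otimes> c) [^] p \<otimes> inv (b [^] p') \<in> D \<and>
    (b \<otimes> c) [^] q \<otimes> inv (c [^] q') \<in> D"
proof -
  interpret hall_quot G \<pi> D by (rule hall_quotI[OF D_normal])
  obtain g where g: "g \<in> carrier Gq" "carrier Gq = range (\<lambda>n::int. g [^]\<^bsub>Gq\<^esub> n)"
    using cyc unfolding f.H.cyclic_group by blast
  have "f b \<in> carrier Gq" "f c \<in> carrier Gq" using b c by simp_all
  then obtain j k :: int where jk: "f b = g [^]\<^bsub>Gq\<^esub> j" "f c = g [^]\<^bsub>Gq\<^esub> k" unfolding g(2) by blast
  have bc: "f (b \<otimes> c) = g [^]\<^bsub>Gq\<^esub> (j + k)"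
    using b c g(1) by (simp add: jk f.H.int_pow_mult)
  have fpow: "f (x [^] n) = f x [^]\<^bsub>Gq\<^esub> n" if "x \<in> carrier G" for x and n :: int
    using f.hom_int_pow[OF that] .
  have pp: "(g [^]\<^bsub>Gq\<^esub> n) [^]\<^bsub>Gq\<^esub> l = g [^]\<^bsub>Gq\<^esub> (n * l)" for n l :: int
    using f.H.int_pow_pow[OF g(1)] .
  define d where "d = gcd j k"
  obtain j' k' where j': "j = d * j'" and k': "k = d * k'" unfolding d_def by (metis dvdE gcd_dvd1 gcd_dvd2)
  \<comment> \<open>The alternative j = k = 0 is the case d = 0, in which b and c lie in D and
    cannot be divided by d; there any p and q with sum 1 serve.\<close>
  have "\<exists>u v. (j + k) * (u * j') = j * ((j' + k') * u) \<and> (j + k) * (v * k') = k * ((j' + k') * v) \<and> u * j' + v * k' = 1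
    \<or> j = 0 \<and> k = 0"
  proof (cases "d = 0")
    case True
    then show ?thesis using j' k' by simp
  next
    case False
    obtain u v where uv: "u * j + v * k = d" unfolding d_def using bezout_int by blast
    then have "d * (u * j' + v * k') = d * 1" unfolding j' k' by (simp add: algebra_simps)
    then have "u * j' + v * k' = 1" using False by simp
    moreover have "(j + k) * (u * j') = j * ((j' + k') * u)" "(j + k) * (v * k') = k * ((j' + k') * v)"
      unfolding j' k' by (simp_all add: algebra_simps)
    ultimately show ?thesis by blast
  qed
  then obtain p q p' q' :: int where pq: "p + q = 1" "(j + k) * p = j * p'" "(j + k) * q = k * q'"
    by (metis add.right_neutral add_0 mult_zero_left)
  have bcc: "b \<otimes> c \<in> carrier G" using b c by simp
  have "f ((b \<otimes> c) [^] p) = f (b [^] p')"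
    unfolding fpow[OF bcc] fpow[OF b] bc jk(1) pp pq(2) ..
  then have 1: "(b \<otimes> c) [^] p \<otimes> inv (b [^] p') \<in> D"
    by (rule iffD1[OF f_eq_iff[OF int_pow_closed[OF bcc] int_pow_closed[OF b]]])
  have "f ((b \<otimes> c) [^] q) = f (c [^] q')"
    unfolding fpow[OF bcc] fpow[OF c] bc jk(2) pp pq(3) ..
  then have "(b \<otimes> c) [^] q \<otimes> inv (c [^] q') \<in> D"
    by (rule iffD1[OF f_eq_iff[OF int_pow_closed[OF bcc] int_pow_closed[OF c]]])
  with pq(1) 1 show ?thesis by blast
qed

text \<open>For x = b c in A, split x = x^p x^q so that the factors agree modulo D with powers of b
  and of c. Meet-distributivity of D replaces them by elements of A \<inter> B and A \<inter> C up
  to elements of D. The remaining error lies in D, in A and in BC, where distributivity below D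
  applies.\<close>

lemma conditions_imp_product_dist:
  assumes coinc: sections_coincide_all and perm: all_permute and cyc: "cyclic_group (G Mod D)"
    and dist: "\<And>B C. sp B \<Longrightarrow> sp C \<Longrightarrow> D \<inter> (B <#> C) \<subseteq> (D \<inter> B) <#> (D \<inter> C)"
  shows product_dist
  unfolding product_dist_def
proof (intro allI impI subsetI)
  fix A B C x
  assume A: "sp A" and B: "sp B" and C: "sp C" and x: "x \<in> A \<inter> (B <#> C)"
  note As = spD[OF A] and Bs = spD[OF B] and Cs = spD[OF C]
  have sD: "sp D" using sp_normal[OF D_normal] .
  note mult = sp_set_mult[OF perm]
  \<comment> \<open>If y and z agree modulo D, then z^-1 y lies in D \<inter> X A, hence is z1 a1
    with z1 in D \<inter> X and a1 in D \<inter> A. So y = (z z1) a1, and z z1 = y a1^-1 lies in A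
    as well as in X.\<close>
  have meet_D: "\<exists>u\<in>A \<inter> X. \<exists>e\<in>D. y = u \<otimes> e"
    if X: "sp X" and y: "y \<in> A" "z \<in> X" "y \<otimes> inv z \<in> D" for X y z
  proof -
    have c: "y \<in> carrier G" "z \<in> carrier G"
      using subgroup.mem_carrier[OF As y(1)] subgroup.mem_carrier[OF spD[OF X] y(2)] .
    have "inv z \<otimes> (y \<otimes> inv z) \<otimes> inv (inv z) \<in> D"
      using normalizesD[OF normal_normalizes[OF D_normal] inv_closed[OF c(2)] y(3)] .
    then have "inv z \<otimes> y \<in> D" using c by (simp add: word_simps)
    moreover have "inv z \<otimes> y \<in> X <#> A"
      using subgroup.m_inv_closed[OF spD[OF X] y(2)] y(1) by (intro set_multI)
    ultimately have "inv z \<otimes> y \<in> (D \<inter> X) <#> (D \<inter> A)" using dist[OF X A] by blast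
    then obtain z1 a1 where za: "z1 \<in> D \<inter> X" "a1 \<in> D \<inter> A" "inv z \<otimes> y = z1 \<otimes> a1" by (rule set_multE)
    have c1: "z1 \<in> carrier G" "a1 \<in> carrier G" using za subgroup.mem_carrier[OF Ds] by blast+
    have "z \<otimes> (inv z \<otimes> y) = z \<otimes> (z1 \<otimes> a1)" unfolding za(3) ..
    then have ye: "y = z \<otimes> z1 \<otimes> a1" using c c1 by (simp add: word_simps)
    have "z \<otimes> z1 \<in> X" using subgroup.m_closed[OF spD[OF X] y(2)] za(1) by blast
    moreover have "y \<otimes> inv a1 \<in> A"
      using subgroup.m_closed[OF As y(1)] subgroup.m_inv_closed[OF As] za(2) by blast
    then have "z \<otimes> z1 \<in> A" unfolding ye using c c1 by (simp add: word_simps)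
    ultimately show ?thesis using za(2) ye by blast
  qed
  obtain b c where bc: "b \<in> B" "c \<in> C" "x = b \<otimes> c" using IntD2[OF x] by (rule set_multE)
  have cc: "b \<in> carrier G" "c \<in> carrier G"
    using subgroup.mem_carrier[OF Bs bc(1)] subgroup.mem_carrier[OF Cs bc(2)] .
  have xc: "x \<in> carrier G" unfolding bc(3) using cc by simp
  have xA: "x \<in> A" using x by blast
  obtain p q p' q' :: int where pq: "p + q = 1" "x [^] p \<otimes> inv (b [^] p') \<in> D" "x [^] q \<otimes> inv (c [^] q') \<in> D"
    using cyclic_mod_D_split[OF cyc cc] unfolding bc(3) by blast
  obtain u1 e1 where u1: "u1 \<in> A \<inter> B" "e1 \<in> D" "x [^] p = u1 \<otimes> e1"
    using meet_D[OF B subgroup_int_pow_closed[OF As xA] subgroup_int_pow_closed[OF Bs bc(1)] pq(2)] by blast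
  obtain u2 e2 where u2: "u2 \<in> A \<inter> C" "e2 \<in> D" "x [^] q = u2 \<otimes> e2"
    using meet_D[OF C subgroup_int_pow_closed[OF As xA] subgroup_int_pow_closed[OF Cs bc(2)] pq(3)] by blast
  have cu: "u1 \<in> carrier G" "u2 \<in> carrier G" "e1 \<in> carrier G" "e2 \<in> carrier G"
    using u1(1,2) u2(1,2) subgroup.mem_carrier[OF As] subgroup.mem_carrier[OF Ds] by blast+
  \<comment> \<open>The two errors collected on the right, after \<open>e1\<close> has been moved
    across \<open>u2\<close>.\<close>
  define e where "e = inv u2 \<otimes> e1 \<otimes> u2 \<otimes> e2"
  have "x = x [^] p \<otimes> x [^] q" using int_pow_mult[OF xc, of p q] pq(1) xc by simp
  then have xe: "x = (u1 \<otimes> u2) \<otimes> e" unfolding u1(3) u2(3) e_def using cu by (simp add: word_simps)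
  have eD: "e \<in> D"
    unfolding e_def
    using subgroup.m_closed[OF Ds normalizesD_inv[OF normal_normalizes[OF D_normal] subgroup_self cu(2) u1(2)] u2(2)] .
  have ec: "e \<in> carrier G" using subgroup.mem_carrier[OF Ds eD] .
  let ?E = "(A \<inter> B) <#> (A \<inter> C)"
  have Es: "subgroup ?E G" using spD[OF mult[OF sp_Int[OF A B] sp_Int[OF A C]]] .
  have BCs: "subgroup (B <#> C) G" using spD[OF mult[OF B C]] .
  have uE: "u1 \<otimes> u2 \<in> ?E" using u1(1) u2(1) by (intro set_multI)
  have EA: "?E \<subseteq> A" by (rule set_mult_subset_subgroup[OF As]) blast+
  have EBC: "?E \<subseteq> B <#> C" by (rule mono_set_mult) blast+
  have e_eq: "e = inv (u1 \<otimes> u2) \<otimes> x" unfolding xe using cu ec by (simp add: word_simps)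
  have "e \<in> A" unfolding e_eq using uE EA xA subgroup.m_closed[OF As] subgroup.m_inv_closed[OF As] by blast
  moreover have "e \<in> B <#> C"
    unfolding e_eq using uE EBC x subgroup.m_closed[OF BCs] subgroup.m_inv_closed[OF BCs] by blast
  then have "e \<in> (D \<inter> B) <#> (D \<inter> C)" using eD dist[OF B C] by blast
  ultimately have "e \<in> (D \<inter> A) \<inter> ((D \<inter> B) <#> (D \<inter> C))" using eD by blast
  then have "e \<in> ((D \<inter> A) \<inter> (D \<inter> B)) <#> ((D \<inter> A) \<inter> (D \<inter> C))"
    using D_product_dist[OF coinc perm sp_Int[OF sD A] Int_lower1 sp_Int[OF sD B] Int_lower1 sp_Int[OF sD C] Int_lower1]
    by blast
  moreover have "((D \<inter> A) \<inter> (D \<inter> B)) <#> ((D \<inter> A) \<inter> (D \<inter> C)) \<subseteq> ?E" by (rule mono_set_mult) blast+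
  ultimately have "e \<in> ?E" by blast
  then show "x \<in> ?E" unfolding xe using subgroup.m_closed[OF Es uE] by blast
qed

end

section \<open>Joins and meets of \<sigma>-permutable subgroups\<close>

text \<open>The library defines join and meet by choice of a least upper and a greatest lower bound.
  This identifies them, for families of sets closed under intersection, with intersection and a
  given join, and is applied to both lattices of subgroups.\<close>

lemma set_family_lattice:
  fixes S :: "'a set set"
  defines "L \<equiv> \<lparr>carrier = S, eq = (=), le = (\<subseteq>)\<rparr>"
  assumes Int: "\<And>A B. A \<in> S \<Longrightarrow> B \<in> S \<Longrightarrow> A \<inter> B \<in> S"
    and j: "\<And>A B. A \<in> S \<Longrightarrow> B \<in> S \<Longrightarrow> j A B \<in> S"
    and j_upper: "\<And>A B. A \<in> S \<Longrightarrow> B \<in> S \<Longrightarrow> A \<union> B \<subseteq> j A B"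
    and j_least: "\<And>A B C. A \<in> S \<Longrightarrow> B \<in> S \<Longrightarrow> C \<in> S \<Longrightarrow> A \<union> B \<subseteq> C \<Longrightarrow> j A B \<subseteq> C"
  shows "Lattice.lattice L"
    and "\<And>A B. A \<in> S \<Longrightarrow> B \<in> S \<Longrightarrow> A \<squnion>\<^bsub>L\<^esub> B = j A B"
    and "\<And>A B. A \<in> S \<Longrightarrow> B \<in> S \<Longrightarrow> A \<sqinter>\<^bsub>L\<^esub> B = A \<inter> B"
proof -
  interpret partial_order L by unfold_locales (auto simp: L_def)
  have sup: "least L (j A B) (Upper L {A, B})" if "A \<in> S" "B \<in> S" for A B
    using that j[OF that] j_upper[OF that] j_least[OF that] unfolding least_def Upper_def L_def by auto
  have inf: "greatest L (A \<inter> B) (Lower L {A, B})" if "A \<in> S" "B \<in> S" for A B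
    using that Int[OF that] unfolding greatest_def Lower_def L_def by auto
  have c: "carrier L = S" by (simp add: L_def)
  show "Lattice.lattice L"
  proof unfold_locales
    show "\<exists>s. least L s (Upper L {A, B})" if "A \<in> carrier L" "B \<in> carrier L" for A B
      using sup that unfolding c by blast
    show "\<exists>s. greatest L s (Lower L {A, B})" if "A \<in> carrier L" "B \<in> carrier L" for A B
      using inf that unfolding c by blast
  qed
  then interpret Lattice.lattice L .
  show "A \<squnion>\<^bsub>L\<^esub> B = j A B" if AB: "A \<in> S" "B \<in> S" for A B
  proof (rule joinI)
    show "l = j A B" if "least L l (Upper L {A, B})" for l using least_unique[OF that sup[OF AB]] .
  qed (use AB c in simp_all)
  show "A \<sqinter>\<^bsub>L\<^esub> B = A \<inter> B" if AB: "A \<in> S" "B \<in> S" for A B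
  proof (rule meetI)
    show "i = A \<inter> B" if "greatest L i (Lower L {A, B})" for i using greatest_unique[OF that inf[OF AB]] .
  qed (use AB c in simp_all)
qed

section \<open>Identification with the lattices of the statement\<close>

context hall_full
begin

lemma sp_lattice:
  shows "Lattice.lattice (sigma_permutable_lattice \<pi> G)"
    and "sp A \<Longrightarrow> sp B \<Longrightarrow> A \<squnion>\<^bsub>sigma_permutable_lattice \<pi> G\<^esub> B = generate G (A \<union> B)"
    and "sp A \<Longrightarrow> sp B \<Longrightarrow> A \<sqinter>\<^bsub>sigma_permutable_lattice \<pi> G\<^esub> B = A \<inter> B"
proof -
  note l = set_family_lattice[of "{A. sp A}" "\<lambda>A B. generate G (A \<union> B)", folded sigma_permutable_lattice_def]
  have *: "sp A \<Longrightarrow> sp B \<Longrightarrow> sp C \<Longrightarrow> A \<union> B \<subseteq> C \<Longrightarrow> generate G (A \<union> B) \<subseteq> C" for A B C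
    using generate_subgroup_incl spD by blast
  show "Lattice.lattice (sigma_permutable_lattice \<pi> G)"
    by (rule l(1)) (use sp_Int sp_join * generate_incl in \<open>auto intro: generate.incl\<close>)
  show "A \<squnion>\<^bsub>sigma_permutable_lattice \<pi> G\<^esub> B = generate G (A \<union> B)" if "sp A" "sp B"
    by (rule l(2)) (use sp_Int sp_join * that in \<open>auto intro: generate.incl\<close>)
  show "A \<sqinter>\<^bsub>sigma_permutable_lattice \<pi> G\<^esub> B = A \<inter> B" if "sp A" "sp B"
    by (rule l(3)) (use sp_Int sp_join * that in \<open>auto intro: generate.incl\<close>)
qed

lemma carrier_sp_lattice: "carrier (sigma_permutable_lattice \<pi> G) = {A. sp A}"
  by (simp add: sigma_permutable_lattice_def)

lemma generate_meets_subset: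
  assumes "sp A" "sp B" "sp C"
  shows "generate G ((A \<inter> B) \<union> (A \<inter> C)) \<subseteq> A \<inter> generate G (B \<union> C)"
proof -
  have s: "subgroup (A \<inter> generate G (B \<union> C)) G"
    using spD[OF sp_Int[OF assms(1) sp_join[OF assms(2,3)]]] .
  show ?thesis by (rule generate_subgroup_incl[OF _ s]) (auto intro: generate.incl)
qed

lemma distributive_lattice_iff: "distributive_lattice (sigma_permutable_lattice \<pi> G) \<longleftrightarrow> join_dist"
proof -
  have "distributive_lattice (sigma_permutable_lattice \<pi> G) \<longleftrightarrow>
    (\<forall>A B C. sp A \<longrightarrow> sp B \<longrightarrow> sp C \<longrightarrow> A \<inter> generate G (B \<union> C) = generate G ((A \<inter> B) \<union> (A \<inter> C)))"
    using sp_lattice(1)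
    by (auto simp: distributive_lattice_def distributive_lattice_axioms_def carrier_sp_lattice
        sp_lattice(2,3) sp_join sp_Int)
  then show ?thesis unfolding join_dist_def using generate_meets_subset by (metis subset_antisym order_refl)
qed

lemma meet_distributive_D_iff: "meet_distributive (sigma_permutable_lattice \<pi> G) D \<longleftrightarrow>
  (\<forall>B C. sp B \<longrightarrow> sp C \<longrightarrow> D \<inter> generate G (B \<union> C) \<subseteq> generate G ((D \<inter> B) \<union> (D \<inter> C)))"
proof -
  have D: "sp D" using sp_normal[OF D_normal] .
  have "meet_distributive (sigma_permutable_lattice \<pi> G) D \<longleftrightarrow>
    (\<forall>B C. sp B \<longrightarrow> sp C \<longrightarrow> D \<inter> generate G (B \<union> C) = generate G ((D \<inter> B) \<union> (D \<inter> C)))"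
    using D by (auto simp: meet_distributive_def carrier_sp_lattice sp_lattice(2,3) sp_join sp_Int)
  then show ?thesis using generate_meets_subset[OF D] by (metis subset_antisym order_refl)
qed

lemma normal_join: 
  assumes "N \<lhd> G" "M \<lhd> G"
  shows "generate G (N \<union> M) \<lhd> G"
proof -
  have "N <#> M = M <#> N"
    by (rule normalizes_permutable[OF normal_imp_subgroup[OF assms(1)] normal_imp_subgroup[OF assms(2)]
          normalizes_mono[OF normal_normalizes[OF assms(2)] subgroup.subset[OF normal_imp_subgroup[OF assms(1)]]]])
  then show ?thesis
    using generate_eq_set_mult normal_imp_subgroup assms normal_set_mult_normal by metis
qed

lemma normal_Int: "N \<lhd> G \<Longrightarrow> M \<lhd> G \<Longrightarrow> N \<inter> M \<lhd> G"
  using subgroups_Inter_pair unfolding normal_iff_normalizes normalizes_def by blast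

text \<open>Normal subgroups are members, and their joins and meets are the same generated subgroups
  and intersections, so they form a sublattice.\<close>

lemma normal_lattice_distributive:
  assumes join_dist
  shows "distributive_lattice (normal_subgroup_lattice G)"
proof -
  note l = set_family_lattice[of "{N. N \<lhd> G}" "\<lambda>A B. generate G (A \<union> B)", folded normal_subgroup_lattice_def]
  have *: "A \<lhd> G \<Longrightarrow> B \<lhd> G \<Longrightarrow> C \<lhd> G \<Longrightarrow> A \<union> B \<subseteq> C \<Longrightarrow> generate G (A \<union> B) \<subseteq> C" for A B C
    using generate_subgroup_incl normal_imp_subgroup by blast
  have c: "carrier (normal_subgroup_lattice G) = {N. N \<lhd> G}" by (simp add: normal_subgroup_lattice_def)
  have 1: "Lattice.lattice (normal_subgroup_lattice G)"
    by (rule l(1)) (use normal_Int normal_join * in \<open>auto intro: generate.incl\<close>)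
  have 2: "A \<squnion>\<^bsub>normal_subgroup_lattice G\<^esub> B = generate G (A \<union> B)" if "A \<lhd> G" "B \<lhd> G" for A B
    by (rule l(2)) (use normal_Int normal_join * that in \<open>auto intro: generate.incl\<close>)
  have 3: "A \<sqinter>\<^bsub>normal_subgroup_lattice G\<^esub> B = A \<inter> B" if "A \<lhd> G" "B \<lhd> G" for A B
    by (rule l(3)) (use normal_Int normal_join * that in \<open>auto intro: generate.incl\<close>)
  have 4: "A \<inter> generate G (B \<union> C) = generate G ((A \<inter> B) \<union> (A \<inter> C))" if "A \<lhd> G" "B \<lhd> G" "C \<lhd> G" for A B C
    using assms generate_meets_subset sp_normal that unfolding join_dist_def by (meson subset_antisym)
  show ?thesis
    using 1 by (auto simp: distributive_lattice_def distributive_lattice_axioms_def c 2 3 4 normal_join normal_Int)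
qed

text \<open>Permutability and the product form of distributivity pass to G/R. Together they make the
  lattice of G/R distributive, and applying the first half of the theorem there shows that G/R is
  abelian modulo its own residual. Condition (3) is the dual of (2).\<close>

lemma join_dist_imp_sections_coincide:
  assumes join_dist
  shows sections_coincide_all
  unfolding sections_coincide_all_def
proof (intro allI impI)
  fix R assume R: "R \<lhd> G"
  interpret hall_quot G \<pi> R by (rule hall_quotI[OF R])
  interpret qd: hall_full Gq \<pi>' by (rule q.dual)
  have perm: "q.all_permute" and pd: "q.product_dist"
    using quotient_perm_dist dist_imp[OF assms] by blast+
  have comm: "q.comm_mod_D" using q.dist_imp(1)[OF q.product_dist_imp_dist[OF perm pd]] .
  have d: "qd.all_permute" "qd.product_dist" "qd.comm_mod_D"
    using perm pd comm
    unfolding qd.all_permute_def q.all_permute_def qd.product_dist_def q.product_dist_def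
      qd.comm_mod_D_def q.comm_mod_D_def q.sp_dual cc by blast+
  show "isomorphic_sections_coincide \<pi> \<pi> Gq \<and> isomorphic_sections_coincide \<pi> \<pi>' Gq"
    using q.sections_coincide[OF perm pd comm] qd.sections_coincide[OF d]
    unfolding isomorphic_sections_coincide_compl[OF primes] by blast
qed

theorem join_dist_iff:
  "join_dist \<longleftrightarrow> all_permute \<and> distributive_lattice (normal_subgroup_lattice G) \<and> cyclic_group (G Mod D) \<and>
    meet_distributive (sigma_permutable_lattice \<pi> G) D \<and> sections_coincide_all"
proof
  assume d: join_dist
  then have "meet_distributive (sigma_permutable_lattice \<pi> G) D"
    unfolding meet_distributive_D_iff join_dist_def using sp_normal[OF D_normal] by blast
  then show "all_permute \<and> distributive_lattice (normal_subgroup_lattice G) \<and> cyclic_group (G Mod D) \<and>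
    meet_distributive (sigma_permutable_lattice \<pi> G) D \<and> sections_coincide_all"
    using dist_imp(2)[OF d] normal_lattice_distributive[OF d] dist_cyclic[OF d]
      join_dist_imp_sections_coincide[OF d] by blast
next
  assume *: "all_permute \<and> distributive_lattice (normal_subgroup_lattice G) \<and> cyclic_group (G Mod D) \<and>
    meet_distributive (sigma_permutable_lattice \<pi> G) D \<and> sections_coincide_all"
  then have perm: all_permute by blast
  have sD: "sp D" using sp_normal[OF D_normal] .
  have "D \<inter> (B <#> C) \<subseteq> (D \<inter> B) <#> (D \<inter> C)" if s: "sp B" "sp C" for B C
  proof -
    have p: "X <#> Y = Y <#> X" if "sp X" "sp Y" for X Y using perm that unfolding all_permute_def by blast
    have "D \<inter> generate G (B \<union> C) \<subseteq> generate G ((D \<inter> B) \<union> (D \<inter> C))"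
      using * s unfolding meet_distributive_D_iff by blast
    then show ?thesis
      unfolding generate_eq_set_mult[OF spD[OF s(1)] spD[OF s(2)] p[OF s]]
        generate_eq_set_mult[OF spD[OF sp_Int[OF sD s(1)]] spD[OF sp_Int[OF sD s(2)]] p[OF sp_Int[OF sD s(1)] sp_Int[OF sD s(2)]]] .
  qed
  then have product_dist using conditions_imp_product_dist * by blast
  then show join_dist by (rule product_dist_imp_dist[OF perm])
qed

end

theorem corollary1p5:
  fixes G :: "('a, 'b) monoid_scheme" and \<pi> :: "nat set"
  defines "D \<equiv> pi_decomposable_residual \<pi> G"
    and "\<L> \<equiv> sigma_permutable_lattice \<pi> G"
  assumes "\<pi> \<subseteq> {p. Factorial_Ring.prime p}"
    and "group G" and "finite (carrier G)" and "pi_separable \<pi> G"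
  shows "distributive_lattice \<L> \<longleftrightarrow>
    ((\<forall>A\<in>carrier \<L>. \<forall>B\<in>carrier \<L>. permutable G A B) \<and>
     distributive_lattice (normal_subgroup_lattice G) \<and>
     cyclic_group (G Mod D) \<and> meet_distributive \<L> D) \<and>
    (\<forall>R. R \<lhd> G \<longrightarrow> isomorphic_sections_coincide \<pi> \<pi> (G Mod R)) \<and>
    (\<forall>R. R \<lhd> G \<longrightarrow> isomorphic_sections_coincide \<pi> (compl_primes \<pi>) (G Mod R))"
proof -
  interpret hall_full G \<pi>
  proof (intro hall_full.intro hall_full_axioms.intro assms)
    fix M \<tau> assume "subgroup M G" "\<tau> = \<pi> \<or> \<tau> = compl_primes \<pi>"
    then show "\<exists>H. subgroup H G \<and> H \<subseteq> M \<and> pi_number \<tau> (card H) \<and>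
        pi_number (compl_primes \<tau>) (card M div card H)"
      using group.pi_separable_hall[OF assms(4,5,6,3)] by blast
  qed
  have "(\<forall>A\<in>carrier \<L>. \<forall>B\<in>carrier \<L>. permutable G A B) \<longleftrightarrow> all_permute"
    unfolding \<L>_def carrier_sp_lattice all_permute_def permutable_def by blast
  moreover have "(\<forall>R. R \<lhd> G \<longrightarrow> isomorphic_sections_coincide \<pi> \<pi> (G Mod R)) \<and>
      (\<forall>R. R \<lhd> G \<longrightarrow> isomorphic_sections_coincide \<pi> (compl_primes \<pi>) (G Mod R)) \<longleftrightarrow> sections_coincide_all"
    unfolding sections_coincide_all_def by blast
  ultimately show ?thesis
    using join_dist_iff distributive_lattice_iff unfolding D_def \<L>_def decomposable_residual_eq by argo
qed

end
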